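(* Let $\alpha\in(0,2)$, $\beta^+,\beta^-\in(0,1)$, $B^+,B^->0$, let $b$ be the drift and $L$ the symmetric $\alpha$-stable process described in the context. Assume $\alpha>1-(\beta^+\wedge\beta^-)$ and $\beta^+\neq\beta^-$. For $\varepsilon>0$ let $X^\varepsilon=(X^\varepsilon_t)_{t\geq 0}$ be the unique strong solution of $$X^\varepsilon_t=\int_0^t b(X^\varepsilon_s)\,ds+\varepsilon L_t,\qquad t\geq 0.$$ Then for any $T>0$ the law $P^L_\varepsilon$ of $(X^\varepsilon_t)_{t\in[0,T]}$ on the Skorokhod space $\mathbb{D}([0,T];\mathbb{R})$ converges weakly, as $\varepsilon\to0+$: $$P^L_\varepsilon\ \overset{w}{\longrightarrow}\ p^+\delta_{x^+}+p^-\delta_{x^-},$$ where $x^{\pm}_t=\pm C^{\pm}t^{\frac{1}{1-\beta^{\pm}}}$ with $C^\pm=\big(B^\pm(1-\beta^\pm)\big)^{\frac1{1-\beta^\pm}}$ (restricted to $[0,T]$), $p^-=1-p^+$, and $$p^+=\begin{cases}1 & \text{if }\beta^+<\beta^-,\\ 0&\text{if }\beta^+>\beta^-.\end{cases}$$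
   Context: The drift is $b(x)=B^+|x|^{\beta^+}$ for $x\geq 0$ and $b(x)=-B^-|x|^{\beta^-}$ for $x<0$. The process $L=(L_t)_{t\ge0}$, defined on a filtered probability space $(\Omega,\mathcal F,\mathbb P)$, is a symmetric pure-jump $\alpha$-stable Lévy process, i.e. a Lévy process with characteristic triplet $(0,0,\nu)$ (drift $0$, no Gaussian part, truncation function $\mathbf 1\{|y|\le 1\}$) and Lévy measure $\nu(dy)=c|y|^{-\alpha-1}dy$ on $\mathbb R\setminus\{0\}$ for some $c>0$. It is known that under $\alpha\ge 1-(\beta^+\wedge\beta^-)$ the equation has a unique strong solution, which has the strong Markov property. $a\wedge b$ denotes the minimum; $\delta_{x^\pm}$ is the Dirac mass at the path $x^\pm$. *)

theory Defs
  imports "HOL-Probability.Probability"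
begin

section \<open>The Skorokhod space\<close>

text \<open>At an endpoint of \<open>S\<close> one of the two filters below is trivial, so the corresponding
  one-sided condition is void there.\<close>

definition cadlag_on :: "real set \<Rightarrow> (real \<Rightarrow> real) \<Rightarrow> bool" where
  "cadlag_on S x \<longleftrightarrow>
     (\<forall>t\<in>S. (x \<longlongrightarrow> x t) (at t within (S \<inter> {t<..})) \<and>
            (\<exists>l. (x \<longlongrightarrow> l) (at t within (S \<inter> {..<t}))))"

definition skorokhod_space :: "real \<Rightarrow> (real \<Rightarrow> real) set" where
  "skorokhod_space T = {x \<in> extensional {0..T}. cadlag_on {0..T} x}"

text \<open>A strictly increasing map of \<open>[0,T]\<close> onto itself is automatically a homeomorphism.\<close>

definition time_changes :: "real \<Rightarrow> (real \<Rightarrow> real) set" where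
  "time_changes T = {\<tau>. strict_mono_on {0..T} \<tau> \<and> \<tau> ` {0..T} = {0..T}}"

definition skorokhod_bounds :: "real \<Rightarrow> (real \<Rightarrow> real) \<Rightarrow> (real \<Rightarrow> real) \<Rightarrow> real set" where
  "skorokhod_bounds T x y =
     {e. 0 \<le> e \<and> (\<exists>\<tau>\<in>time_changes T. \<forall>t\<in>{0..T}. \<bar>\<tau> t - t\<bar> \<le> e \<and> \<bar>x t - y (\<tau> t)\<bar> \<le> e)}"

text \<open>The usual metric of the J1 topology. Its value off the space is irrelevant; it is set to 0
  because the locale \<open>Metric_space\<close> asks for nonnegativity everywhere.\<close>

definition skorokhod_dist :: "real \<Rightarrow> (real \<Rightarrow> real) \<Rightarrow> (real \<Rightarrow> real) \<Rightarrow> real" where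
  "skorokhod_dist T x y =
     (if x \<in> skorokhod_space T \<and> y \<in> skorokhod_space T then Inf (skorokhod_bounds T x y) else 0)"

definition skorokhod_topology :: "real \<Rightarrow> (real \<Rightarrow> real) topology" where
  "skorokhod_topology T = Metric_space.mtopology (skorokhod_space T) (skorokhod_dist T)"

lemma cadlag_on_bounded:
  assumes "cadlag_on S x" "compact S"
  shows "\<exists>B. \<forall>t\<in>S. \<bar>x t\<bar> \<le> B"
proof -
  have "\<exists>d B. d > 0 \<and> (\<forall>s\<in>S. dist s t < d \<longrightarrow> \<bar>x s\<bar> \<le> B)" if t: "t \<in> S" for t
  proof -
    from assms(1) t obtain l where
      r: "(x \<longlongrightarrow> x t) (at t within (S \<inter> {t<..}))" and l: "(x \<longlongrightarrow> l) (at t within (S \<inter> {..<t}))"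
      by (auto simp: cadlag_on_def)
    from tendstoD[OF r, of 1] obtain d1 where d1: "d1 > 0"
      "\<forall>s\<in>S \<inter> {t<..}. s \<noteq> t \<and> dist s t < d1 \<longrightarrow> dist (x s) (x t) < 1"
      by (auto simp: eventually_at)
    from tendstoD[OF l, of 1] obtain d2 where d2: "d2 > 0"
      "\<forall>s\<in>S \<inter> {..<t}. s \<noteq> t \<and> dist s t < d2 \<longrightarrow> dist (x s) l < 1"
      by (auto simp: eventually_at)
    have "\<bar>x s\<bar> \<le> \<bar>x t\<bar> + \<bar>l\<bar> + 1" if s: "s \<in> S" "dist s t < min d1 d2" for s
    proof (cases s t rule: linorder_cases)
      case less
      then have "dist (x s) l < 1" using d2(2) s by auto
      then show ?thesis by (auto simp: dist_real_def)
    next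
      case greater
      then have "dist (x s) (x t) < 1" using d1(2) s by auto
      then show ?thesis by (auto simp: dist_real_def)
    qed auto
    then show ?thesis using d1(1) d2(1)
      by (intro exI[of _ "min d1 d2"] exI[of _ "\<bar>x t\<bar> + \<bar>l\<bar> + 1"]) auto
  qed
  then obtain d B where dB: "\<And>t. t \<in> S \<Longrightarrow> d t > 0"
    "\<And>t s. t \<in> S \<Longrightarrow> s \<in> S \<Longrightarrow> dist s t < d t \<Longrightarrow> \<bar>x s\<bar> \<le> B t"
    by metis
  obtain C where C: "C \<subseteq> S" "finite C" "S \<subseteq> (\<Union>t\<in>C. ball t (d t))"
    by (rule compactE_image[OF assms(2), of S "\<lambda>t. ball t (d t)"]) (use dB(1) in auto)
  have "\<bar>x s\<bar> \<le> (\<Sum>t\<in>C. \<bar>B t\<bar>)" if s: "s \<in> S" for s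
  proof -
    obtain t where t: "t \<in> C" "dist t s < d t" using C(3) s by auto
    then have "\<bar>x s\<bar> \<le> B t" using dB(2)[of t s] C(1) s by (auto simp: dist_commute)
    also have "\<dots> \<le> \<bar>B t\<bar>" by simp
    also have "\<dots> \<le> (\<Sum>t\<in>C. \<bar>B t\<bar>)" using C(2) t(1) by (intro member_le_sum) auto
    finally show ?thesis .
  qed
  then show ?thesis by blast
qed

lemma time_changes_id: "(\<lambda>t. t) \<in> time_changes T"
  by (auto simp: time_changes_def strict_mono_on_def)

lemma time_changes_mem: "\<tau> \<in> time_changes T \<Longrightarrow> t \<in> {0..T} \<Longrightarrow> \<tau> t \<in> {0..T}"
  by (auto simp: time_changes_def)

lemma time_changes_inj: "\<tau> \<in> time_changes T \<Longrightarrow> inj_on \<tau> {0..T}"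
  unfolding time_changes_def using strict_mono_on_imp_inj_on by blast

lemma time_changes_inv:
  assumes "\<tau> \<in> time_changes T"
  shows "inv_into {0..T} \<tau> \<in> time_changes T"
proof -
  let ?i = "inv_into {0..T} \<tau>"
  have inj: "inj_on \<tau> {0..T}" by (rule time_changes_inj[OF assms])
  have im: "\<tau> ` {0..T} = {0..T}" and sm: "strict_mono_on {0..T} \<tau>"
    using assms by (auto simp: time_changes_def)
  have mem: "?i u \<in> {0..T}" and eq: "\<tau> (?i u) = u" if "u \<in> {0..T}" for u
    using that im by (metis inv_into_into, metis f_inv_into_f)
  have "?i u < ?i v" if "u \<in> {0..T}" "v \<in> {0..T}" "u < v" for u v
  proof (rule ccontr)
    assume "\<not> ?i u < ?i v"
    then have "\<tau> (?i v) \<le> \<tau> (?i u)"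
      using sm mem[OF that(1)] mem[OF that(2)]
      by (metis le_less_linear less_eq_real_def strict_mono_onD)
    with eq that show False by auto
  qed
  moreover have "?i ` {0..T} = {0..T}"
    using bij_betw_inv_into[of \<tau> "{0..T}" "{0..T}"] inj im by (simp add: bij_betw_def)
  ultimately show ?thesis by (auto simp: time_changes_def strict_mono_on_def)
qed

lemma skorokhod_bounds_nonempty:
  assumes "x \<in> skorokhod_space T" "y \<in> skorokhod_space T"
  shows "skorokhod_bounds T x y \<noteq> {}"
proof -
  obtain B C where B: "\<forall>t\<in>{0..T}. \<bar>x t\<bar> \<le> B" and C: "\<forall>t\<in>{0..T}. \<bar>y t\<bar> \<le> C"
    using assms cadlag_on_bounded[of "{0..T}"] by (fastforce simp: skorokhod_space_def)
  have "\<bar>x t - y t\<bar> \<le> \<bar>B\<bar> + \<bar>C\<bar>" if "t \<in> {0..T}" for t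
    using B[rule_format, OF that] C[rule_format, OF that] by linarith
  then have "\<bar>B\<bar> + \<bar>C\<bar> \<in> skorokhod_bounds T x y"
    unfolding skorokhod_bounds_def by (auto intro!: bexI[OF _ time_changes_id[of T]])
  then show ?thesis by blast
qed

lemma skorokhod_bounds_bdd: "bdd_below (skorokhod_bounds T x y)"
  by (rule bdd_belowI[of _ 0]) (auto simp: skorokhod_bounds_def)

lemma skorokhod_bounds_commute_aux:
  assumes "e \<in> skorokhod_bounds T x y"
  shows "e \<in> skorokhod_bounds T y x"
proof -
  obtain \<tau> where \<tau>: "\<tau> \<in> time_changes T" "0 \<le> e"
    "\<forall>t\<in>{0..T}. \<bar>\<tau> t - t\<bar> \<le> e \<and> \<bar>x t - y (\<tau> t)\<bar> \<le> e"
    using assms by (auto simp: skorokhod_bounds_def)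
  let ?i = "inv_into {0..T} \<tau>"
  have "\<bar>?i u - u\<bar> \<le> e \<and> \<bar>y u - x (?i u)\<bar> \<le> e" if u: "u \<in> {0..T}" for u
  proof -
    have im: "\<tau> ` {0..T} = {0..T}" using \<tau>(1) by (auto simp: time_changes_def)
    have "?i u \<in> {0..T}" "\<tau> (?i u) = u"
      using u im by (metis inv_into_into, metis f_inv_into_f)
    with \<tau>(3) show ?thesis by (metis abs_minus_commute)
  qed
  then show ?thesis
    using time_changes_inv[OF \<tau>(1)] \<tau>(2) unfolding skorokhod_bounds_def by blast
qed

lemma skorokhod_bounds_triangle:
  assumes "e \<in> skorokhod_bounds T x y" "f \<in> skorokhod_bounds T y z"
  shows "e + f \<in> skorokhod_bounds T x z"
proof -
  obtain \<tau> where \<tau>: "\<tau> \<in> time_changes T" "0 \<le> e"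
    "\<forall>t\<in>{0..T}. \<bar>\<tau> t - t\<bar> \<le> e \<and> \<bar>x t - y (\<tau> t)\<bar> \<le> e"
    using assms(1) by (auto simp: skorokhod_bounds_def)
  obtain \<sigma> where \<sigma>: "\<sigma> \<in> time_changes T" "0 \<le> f"
    "\<forall>t\<in>{0..T}. \<bar>\<sigma> t - t\<bar> \<le> f \<and> \<bar>y t - z (\<sigma> t)\<bar> \<le> f"
    using assms(2) by (auto simp: skorokhod_bounds_def)
  have "(\<sigma> \<circ> \<tau>) ` {0..T} = {0..T}"
    using \<tau>(1) \<sigma>(1) unfolding image_comp[symmetric] by (simp add: time_changes_def)
  moreover have "strict_mono_on {0..T} (\<sigma> \<circ> \<tau>)"
    using \<tau>(1) \<sigma>(1) time_changes_mem[OF \<tau>(1)]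
    by (auto simp: time_changes_def strict_mono_on_def)
  ultimately have "\<sigma> \<circ> \<tau> \<in> time_changes T"
    by (simp add: time_changes_def)
  moreover have "\<bar>\<sigma> (\<tau> t) - t\<bar> \<le> e + f \<and> \<bar>x t - z (\<sigma> (\<tau> t))\<bar> \<le> e + f" if t: "t \<in> {0..T}" for t
    using \<tau>(3)[rule_format, OF t] \<sigma>(3)[rule_format, OF time_changes_mem[OF \<tau>(1) t]] by linarith
  ultimately show ?thesis
    unfolding skorokhod_bounds_def using \<tau>(2) \<sigma>(2) by (auto intro!: bexI[of _ "\<sigma> \<circ> \<tau>"])
qed

lemma time_changes_top:
  assumes "\<tau> \<in> time_changes T" "0 \<le> T"
  shows "\<tau> T = T"
proof (rule ccontr)
  assume ne: "\<tau> T \<noteq> T"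
  have T: "T \<in> {0..T}" using assms(2) by simp
  then obtain t where t: "t \<in> {0..T}" "\<tau> t = T"
    using assms(1) unfolding time_changes_def by (smt (verit) imageE mem_Collect_eq)
  with ne have "t < T" by (cases "t = T") auto
  then have "\<tau> t < \<tau> T"
    using assms(1) t T by (auto simp: time_changes_def strict_mono_on_def)
  with t time_changes_mem[OF assms(1) T] show False by auto
qed

lemma skorokhod_dist_eq_0:
  assumes x: "x \<in> skorokhod_space T" and y: "y \<in> skorokhod_space T" and 0: "skorokhod_dist T x y = 0"
  shows "x = y"
proof (rule extensionalityI[of _ "{0..T}"])
  show "x \<in> extensional {0..T}" "y \<in> extensional {0..T}"
    using x y by (auto simp: skorokhod_space_def)
  fix t assume t: "t \<in> {0..T}"
  have Inf0: "Inf (skorokhod_bounds T x y) = 0" using 0 x y by (simp add: skorokhod_dist_def)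
  have close: "\<exists>\<tau>\<in>time_changes T. \<forall>s\<in>{0..T}. \<bar>\<tau> s - s\<bar> < \<delta> \<and> \<bar>x s - y (\<tau> s)\<bar> < \<delta>" if \<delta>: "\<delta> > 0" for \<delta>
  proof -
    obtain e where e: "e \<in> skorokhod_bounds T x y" "e < \<delta>"
      using cInf_lessD[OF skorokhod_bounds_nonempty[OF x y], of \<delta>] Inf0 \<delta> by metis
    then show ?thesis unfolding skorokhod_bounds_def by force
  qed
  have "\<bar>x t - y t\<bar> \<le> \<delta>" if \<delta>: "\<delta> > 0" for \<delta>
  proof (cases "t = T")
    case True
    from close[OF \<delta>] obtain \<tau> where \<tau>: "\<tau> \<in> time_changes T" "\<bar>x t - y (\<tau> t)\<bar> < \<delta>"
      using t by blast
    have "\<tau> t = t" using time_changes_top[OF \<tau>(1)] True t by simp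
    with \<tau>(2) show ?thesis by simp
  next
    case False
    then have tT: "t < T" using t by auto
    have rx: "(x \<longlongrightarrow> x t) (at t within ({0..T} \<inter> {t<..}))"
      and ry: "(y \<longlongrightarrow> y t) (at t within ({0..T} \<inter> {t<..}))"
      using x y t by (auto simp: skorokhod_space_def cadlag_on_def)
    have \<delta>3: "\<delta> / 3 > 0" using \<delta> by simp
    from tendstoD[OF rx \<delta>3] obtain d1 where d1: "d1 > 0"
      "\<forall>s\<in>{0..T} \<inter> {t<..}. s \<noteq> t \<and> dist s t < d1 \<longrightarrow> dist (x s) (x t) < \<delta> / 3"
      by (auto simp: eventually_at)
    from tendstoD[OF ry \<delta>3] obtain d2 where d2: "d2 > 0"
      "\<forall>s\<in>{0..T} \<inter> {t<..}. s \<noteq> t \<and> dist s t < d2 \<longrightarrow> dist (y s) (y t) < \<delta> / 3"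
      by (auto simp: eventually_at)
    define h where "h = Min {d1, d2, T - t} / 2"
    have h: "0 < h" "2 * h \<le> d1" "2 * h \<le> d2" "2 * h \<le> T - t"
      using d1(1) d2(1) tT by (auto simp: h_def)
    define s where "s = t + h"
    have s: "s \<in> {0..T}" "t < s" using h t by (auto simp: s_def)
    obtain \<tau> where \<tau>: "\<tau> \<in> time_changes T" "\<bar>\<tau> s - s\<bar> < min h (\<delta> / 3)" "\<bar>x s - y (\<tau> s)\<bar> < min h (\<delta> / 3)"
      using close[of "min h (\<delta> / 3)"] h(1) \<delta>3 s(1) by auto
    have "\<bar>x s - x t\<bar> < \<delta> / 3"
      using d1(2)[rule_format, of s] s h by (auto simp: dist_real_def s_def)
    moreover have "\<bar>y (\<tau> s) - y t\<bar> < \<delta> / 3"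
      using d2(2)[rule_format, of "\<tau> s"] time_changes_mem[OF \<tau>(1) s(1)] \<tau>(2) h
      by (auto simp: dist_real_def s_def)
    ultimately show ?thesis using \<tau>(3) by linarith
  qed
  then have "\<bar>x t - y t\<bar> \<le> 0" by (rule field_le_epsilon) simp
  then show "x t = y t" by simp
qed

interpretation Skorokhod: Metric_space "skorokhod_space T" "skorokhod_dist T" for T
proof
  fix x y z
  show "0 \<le> skorokhod_dist T x y"
    using skorokhod_bounds_nonempty[of x T y]
    by (auto simp: skorokhod_dist_def skorokhod_bounds_def intro!: cInf_greatest)
  have "skorokhod_bounds T x y = skorokhod_bounds T y x"
    using skorokhod_bounds_commute_aux by blast
  then show "skorokhod_dist T x y = skorokhod_dist T y x"
    by (auto simp: skorokhod_dist_def)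
  show "skorokhod_dist T x y = 0 \<longleftrightarrow> x = y" if "x \<in> skorokhod_space T" "y \<in> skorokhod_space T"
  proof
    assume "x = y"
    then have "0 \<in> skorokhod_bounds T x y"
      using time_changes_id[of T] by (auto simp: skorokhod_bounds_def intro!: bexI[of _ "\<lambda>t. t"])
    then have "Inf (skorokhod_bounds T x y) \<le> 0"
      by (rule cInf_lower[OF _ skorokhod_bounds_bdd])
    with \<open>0 \<le> skorokhod_dist T x y\<close> that show "skorokhod_dist T x y = 0"
      by (simp add: skorokhod_dist_def)
  qed (rule skorokhod_dist_eq_0[OF that])
  assume m: "x \<in> skorokhod_space T" "y \<in> skorokhod_space T" "z \<in> skorokhod_space T"
  have "Inf (skorokhod_bounds T x z) - f \<le> e"
    if "e \<in> skorokhod_bounds T x y" "f \<in> skorokhod_bounds T y z" for e f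
    using cInf_lower[OF skorokhod_bounds_triangle[OF that] skorokhod_bounds_bdd] by linarith
  then have "Inf (skorokhod_bounds T x z) - f \<le> Inf (skorokhod_bounds T x y)"
    if "f \<in> skorokhod_bounds T y z" for f
    using that by (intro cInf_greatest skorokhod_bounds_nonempty m)
  then have "Inf (skorokhod_bounds T x z) - Inf (skorokhod_bounds T x y) \<le> f"
    if "f \<in> skorokhod_bounds T y z" for f using that by force
  then have "Inf (skorokhod_bounds T x z) - Inf (skorokhod_bounds T x y) \<le> Inf (skorokhod_bounds T y z)"
    by (intro cInf_greatest skorokhod_bounds_nonempty m)
  then show "skorokhod_dist T x z \<le> skorokhod_dist T x y + skorokhod_dist T y z"
    using m by (simp add: skorokhod_dist_def)
qed

lemma topspace_skorokhod [simp]: "topspace (skorokhod_topology T) = skorokhod_space T"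
  by (simp add: skorokhod_topology_def)


section \<open>Borel measures on a topological space and weak convergence\<close>

definition borel_algebra :: "'a topology \<Rightarrow> 'a measure" where
  "borel_algebra X = sigma (topspace X) {U. openin X U}"

definition weakly_converges ::
  "'a topology \<Rightarrow> ('i \<Rightarrow> 'a measure) \<Rightarrow> 'a measure \<Rightarrow> 'i filter \<Rightarrow> bool" where
  "weakly_converges X \<mu> \<nu> G \<longleftrightarrow>
     (\<forall>\<^sub>F i in G. finite_measure (\<mu> i) \<and> sets (\<mu> i) = sets (borel_algebra X)) \<and>
     finite_measure \<nu> \<and> sets \<nu> = sets (borel_algebra X) \<and>
     (\<forall>f::'a \<Rightarrow> real. continuous_map X euclideanreal f \<longrightarrow> bounded (f ` topspace X) \<longrightarrow>
        ((\<lambda>i. \<integral>x. f x \<partial>\<mu> i) \<longlongrightarrow> (\<integral>x. f x \<partial>\<nu>)) G)"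

text \<open>Meaningful only when \<open>sets \<mu> = sets \<nu>\<close>.\<close>

definition add_measure :: "'a measure \<Rightarrow> 'a measure \<Rightarrow> 'a measure" where
  "add_measure \<mu> \<nu> = measure_of (space \<mu>) (sets \<mu>) (\<lambda>A. emeasure \<mu> A + emeasure \<nu> A)"

lemma emeasure_add_measure:
  assumes "sets \<mu> = sets \<nu>" "A \<in> sets \<mu>"
  shows "emeasure (add_measure \<mu> \<nu>) A = emeasure \<mu> A + emeasure \<nu> A"
proof -
  have "countably_additive (sets \<mu>) (\<lambda>A. emeasure \<mu> A + emeasure \<nu> A)"
  proof (rule countably_additiveI)
    fix A :: "nat \<Rightarrow> 'a set" assume A: "range A \<subseteq> sets \<mu>" "disjoint_family A"
    have "(\<Sum>i. emeasure \<mu> (A i) + emeasure \<nu> (A i)) = (\<Sum>i. emeasure \<mu> (A i)) + (\<Sum>i. emeasure \<nu> (A i))"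
      by (intro suminf_add[symmetric]) auto
    also have "\<dots> = emeasure \<mu> (\<Union>i. A i) + emeasure \<nu> (\<Union>i. A i)"
      using A assms(1) by (simp add: suminf_emeasure)
    finally show "(\<Sum>i. emeasure \<mu> (A i) + emeasure \<nu> (A i)) = emeasure \<mu> (\<Union>i. A i) + emeasure \<nu> (\<Union>i. A i)" .
  qed
  moreover have "positive (sets \<mu>) (\<lambda>A. emeasure \<mu> A + emeasure \<nu> A)"
    by (simp add: positive_def)
  ultimately show ?thesis
    unfolding add_measure_def using assms(2)
    by (intro emeasure_measure_of_sigma sets.sigma_algebra_axioms)
qed


section \<open>Levy processes\<close>

locale filtered_prob_space = prob_space M for M :: "'a measure" +
  fixes F :: "real \<Rightarrow> 'a measure"
  assumes F_subalgebra: "0 \<le> t \<Longrightarrow> subalgebra M (F t)"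
    and F_mono: "0 \<le> s \<Longrightarrow> s \<le> t \<Longrightarrow> subalgebra (F t) (F s)"

text \<open>Stochastic continuity is not listed: it follows from the regularity of the paths and the
  stationarity of the increments.\<close>

locale levy_process = filtered_prob_space M F for M :: "'a measure" and F +
  fixes L :: "real \<Rightarrow> 'a \<Rightarrow> real"
  assumes adapted: "0 \<le> t \<Longrightarrow> L t \<in> borel_measurable (F t)"
    and start: "AE \<omega> in M. L 0 \<omega> = 0"
    and cadlag: "AE \<omega> in M. cadlag_on {0..} (\<lambda>t. L t \<omega>)"
    and indep_increments: "0 \<le> s \<Longrightarrow> s \<le> t \<Longrightarrow>
      indep_set (sets (F s)) (sets (vimage_algebra (space M) (\<lambda>\<omega>. L t \<omega> - L s \<omega>) borel))"
    and stationary_increments: "0 \<le> s \<Longrightarrow> s \<le> t \<Longrightarrow>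
      distr M borel (\<lambda>\<omega>. L t \<omega> - L s \<omega>) = distr M borel (L (t - s))"

definition levy_measure :: "real measure \<Rightarrow> bool" where
  "levy_measure \<nu> \<longleftrightarrow>
     sets \<nu> = sets borel \<and> emeasure \<nu> {0} = 0 \<and> (\<integral>\<^sup>+y. ennreal (min 1 (y\<^sup>2)) \<partial>\<nu>) < \<infinity>"

text \<open>Triplet \<open>(\<gamma>, a, \<nu>)\<close> of drift, Gaussian variance and Levy measure,
  with truncation function \<open>1{|y| \<le> 1}\<close>.\<close>

definition levy_exponent :: "real \<Rightarrow> real \<Rightarrow> real measure \<Rightarrow> real \<Rightarrow> complex" where
  "levy_exponent \<gamma> a \<nu> u =
     \<i> * of_real (\<gamma> * u) - of_real (a * u\<^sup>2 / 2)
     + (\<integral>y. exp (\<i> * of_real (u * y)) - 1 - \<i> * of_real (u * y * indicator {-1..1} y) \<partial>\<nu>)"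

definition has_levy_triplet ::
  "'a measure \<Rightarrow> (real \<Rightarrow> 'a \<Rightarrow> real) \<Rightarrow> real \<Rightarrow> real \<Rightarrow> real measure \<Rightarrow> bool" where
  "has_levy_triplet M L \<gamma> a \<nu> \<longleftrightarrow>
     0 \<le> a \<and> levy_measure \<nu> \<and>
     (\<forall>t\<ge>0. \<forall>u. char (distr M borel (L t)) u = exp (of_real t * levy_exponent \<gamma> a \<nu> u))"

text \<open>The density vanishes at 0, since \<open>0 powr r = 0\<close>.\<close>

definition stable_levy_measure :: "real \<Rightarrow> real \<Rightarrow> real measure" where
  "stable_levy_measure \<alpha> c = density lborel (\<lambda>y. ennreal (c * \<bar>y\<bar> powr (- \<alpha> - 1)))"

definition symmetric_stable_process ::
  "'a measure \<Rightarrow> (real \<Rightarrow> 'a measure) \<Rightarrow> real \<Rightarrow> (real \<Rightarrow> 'a \<Rightarrow> real) \<Rightarrow> bool" where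
  "symmetric_stable_process M F \<alpha> L \<longleftrightarrow>
     levy_process M F L \<and> (\<exists>c>0. has_levy_triplet M L 0 0 (stable_levy_measure \<alpha> c))"


section \<open>The stochastic differential equation\<close>

definition drift :: "real \<Rightarrow> real \<Rightarrow> real \<Rightarrow> real \<Rightarrow> real \<Rightarrow> real" where
  "drift B\<^sub>p B\<^sub>m \<beta>\<^sub>p \<beta>\<^sub>m x = (if 0 \<le> x then B\<^sub>p * \<bar>x\<bar> powr \<beta>\<^sub>p else - B\<^sub>m * \<bar>x\<bar> powr \<beta>\<^sub>m)"

definition augmented_natural_filtration ::
  "'a measure \<Rightarrow> (real \<Rightarrow> 'a \<Rightarrow> real) \<Rightarrow> real \<Rightarrow> 'a measure" where
  "augmented_natural_filtration M L t =
     sigma (space M) ({L s -` A \<inter> space M | s A. s \<in> {0..t} \<and> A \<in> sets borel} \<union> null_sets M)"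

text \<open>A strong solution of \<open>X\<^sub>t = \<integral>\<^sub>0\<^sup>t b (X\<^sub>s) ds + \<epsilon> L\<^sub>t\<close>: the equation holds for all times
  simultaneously, almost surely, and \<open>X\<close> is adapted to the noise.\<close>

definition strong_solution ::
  "'a measure \<Rightarrow> (real \<Rightarrow> 'a \<Rightarrow> real) \<Rightarrow> (real \<Rightarrow> real) \<Rightarrow> real \<Rightarrow> (real \<Rightarrow> 'a \<Rightarrow> real) \<Rightarrow> bool" where
  "strong_solution M L b \<epsilon> X \<longleftrightarrow>
     (\<forall>t\<ge>0. X t \<in> borel_measurable (augmented_natural_filtration M L t)) \<and>
     (\<forall>\<omega>\<in>space M. cadlag_on {0..} (\<lambda>t. X t \<omega>)) \<and>
     (AE \<omega> in M. \<forall>t\<ge>0. X t \<omega> = (LINT s:{0..t}|lborel. b (X s \<omega>)) + \<epsilon> * L t \<omega>)"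

definition path_law :: "'a measure \<Rightarrow> real \<Rightarrow> (real \<Rightarrow> 'a \<Rightarrow> real) \<Rightarrow> (real \<Rightarrow> real) measure" where
  "path_law M T X =
     distr M (borel_algebra (skorokhod_topology T)) (\<lambda>\<omega>. \<lambda>t\<in>{0..T}. X t \<omega>)"

text \<open>The modulus of the extremal solutions of \<open>x' = b x\<close>, \<open>x 0 = 0\<close>; at \<open>t = 0\<close> it is 0.\<close>

definition extremal_path :: "real \<Rightarrow> real \<Rightarrow> real \<Rightarrow> real" where
  "extremal_path B \<beta> t = (B * (1 - \<beta>)) powr (1 / (1 - \<beta>)) * t powr (1 / (1 - \<beta>))"

end

theory Submission
  imports Defs
begin

text \<open>Without noise the equation has two extremal solutions leaving 0 at once, and a small noise has to
choose between them. Suppose \<open>\<beta>\<^sub>p < \<beta>\<^sub>m\<close>; the other case follows by applying the result to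
\<open>- X\<close> and \<open>- L\<close>. Close to 0 the positive drift \<open>x powr \<beta>\<^sub>p\<close> is then far stronger than the negative
drift \<open>\<bar>x\<bar> powr \<beta>\<^sub>m\<close>. The noise \<open>\<epsilon> * L\<close> balances the positive drift at the length
\<open>D = \<epsilon> powr (\<alpha> / (\<alpha> - (1 - \<beta>\<^sub>p)))\<close> and the duration \<open>D powr (1 - \<beta>\<^sub>p)\<close>. In these units the noise is,
by self-similarity, a stable process \<open>Z\<close> with the same law as \<open>L\<close>, the positive drift is of order
one, and the negative drift carries the vanishing factor \<open>D powr (\<beta>\<^sub>m - \<beta>\<^sub>p)\<close>. So over any fixed number
of time units the path stays, with high probability, above \<open>Z - 1\<close>: the drift on the negative side is
too weak to undo what the noise achieves.

The escape to the positive side can therefore be read off from the noise. First, the symmetric process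
\<open>Z\<close> very likely reaches any given level \<open>R + 1\<close> at one of finitely many deterministic times
(\<open>noise_eventually_high\<close>). Secondly, from each of these times on it very likely never falls by more than
\<open>R / 2 + \<kappa> * u powr \<gamma>\<close> after a further time \<open>u\<close>, where \<open>\<gamma> = 1 / (1 - \<beta>\<^sub>p)\<close> is the growth exponent of the
extremal solution (\<open>noise_above_power_curve\<close>): stable noise grows like \<open>u powr (1 / \<alpha>)\<close>, and
\<open>1 / \<alpha> < \<gamma>\<close> is exactly the assumption \<open>\<alpha> > 1 - \<beta>\<^sub>p\<close>. A path that sits at height \<open>R\<close> when such a good
stretch of noise begins is carried off by the drift and stays above \<open>\<kappa> * u powr \<gamma>\<close>
(\<open>stays_above_power_curve\<close>, \<open>escape_behind_high_noise\<close>).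

After a short macroscopic time the path is thus at a height independent of \<open>\<epsilon>\<close>, while the noise
\<open>\<epsilon> * L\<close> has become uniformly small. Since the drift is increasing, comparison with translates in
time of the extremal solution from below and from above pins the path to it
(\<open>escaped_path_near_extremal\<close>). Hence \<open>X \<epsilon>\<close> converges to the extremal path uniformly on \<open>[0,T]\<close> in
probability (\<open>selection_in_probability\<close>), which implies weak convergence to the Dirac mass in the
Skorokhod topology (\<open>weakly_converges_return\<close>). The laws are probability measures on the Borel sets of
that topology because the path map is measurable (\<open>path_map_measurable\<close>).\<close>

section \<open>Properties that hold outside a small event\<close>

text \<open>The exceptional set is an event, but the property need not be one. Statements about uncountably many
times can therefore be combined without checking that they are measurable.\<close>

definition likely :: "'a measure \<Rightarrow> real \<Rightarrow> ('a \<Rightarrow> bool) \<Rightarrow> bool" where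
  "likely M \<eta> P \<longleftrightarrow> (\<exists>N\<in>sets M. measure M N \<le> \<eta> \<and> (\<forall>\<omega>\<in>space M - N. P \<omega>))"

lemma likelyI:
  assumes "N \<in> sets M" "measure M N \<le> \<eta>" "\<And>\<omega>. \<omega> \<in> space M \<Longrightarrow> \<omega> \<notin> N \<Longrightarrow> P \<omega>"
  shows "likely M \<eta> P"
  using assms by (auto simp: likely_def)

lemma likely_mono:
  assumes "likely M \<eta> P" "\<eta> \<le> \<eta>'" "\<And>\<omega>. \<omega> \<in> space M \<Longrightarrow> P \<omega> \<Longrightarrow> Q \<omega>"
  shows "likely M \<eta>' Q"
proof -
  obtain N where "N \<in> sets M" "measure M N \<le> \<eta>" "\<forall>\<omega>\<in>space M - N. P \<omega>"
    using assms(1) by (auto simp: likely_def)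
  then show ?thesis using assms(2,3) by (intro likelyI[of N]) auto
qed

context prob_space
begin

lemma likely_conj:
  assumes "likely M a P" "likely M b Q"
  shows "likely M (a + b) (\<lambda>\<omega>. P \<omega> \<and> Q \<omega>)"
proof -
  obtain A B where "A \<in> sets M" "measure M A \<le> a" "\<forall>\<omega>\<in>space M - A. P \<omega>"
    "B \<in> sets M" "measure M B \<le> b" "\<forall>\<omega>\<in>space M - B. Q \<omega>"
    using assms by (auto simp: likely_def)
  then show ?thesis
    using measure_Un_le[of A M B] by (intro likelyI[of "A \<union> B"]) auto
qed

lemma likely_of_AE:
  assumes "AE \<omega> in M. P \<omega>"
  shows "likely M 0 P"
proof -
  obtain N where "{\<omega> \<in> space M. \<not> P \<omega>} \<subseteq> N" "emeasure M N = 0" "N \<in> sets M"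
    using assms by (rule AE_E)
  then show ?thesis by (intro likelyI[of N]) (auto simp: measure_def)
qed

lemma likely_Ball:
  fixes a :: real
  assumes "finite \<Theta>" "\<And>s. s \<in> \<Theta> \<Longrightarrow> likely M a (P s)"
  shows "likely M (card \<Theta> * a) (\<lambda>\<omega>. \<forall>s\<in>\<Theta>. P s \<omega>)"
  using assms
proof (induction \<Theta>)
  case empty
  then show ?case by (intro likelyI[of "{}"]) auto
next
  case (insert s \<Theta>)
  then have "likely M (a + card \<Theta> * a) (\<lambda>\<omega>. P s \<omega> \<and> (\<forall>s\<in>\<Theta>. P s \<omega>))"
    by (intro likely_conj) auto
  then show ?case using insert by (simp add: algebra_simps)
qed

lemma likely_countable:
  fixes a :: "nat \<Rightarrow> real"
  assumes "\<And>k. likely M (a k) (P k)" "summable a"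
  shows "likely M (suminf a) (\<lambda>\<omega>. \<forall>k. P k \<omega>)"
proof -
  obtain N where N: "\<And>k. N k \<in> sets M" "\<And>k. measure M (N k) \<le> a k" "\<And>k \<omega>. \<omega> \<in> space M - N k \<Longrightarrow> P k \<omega>"
    using assms(1) unfolding likely_def by metis
  have s: "summable (\<lambda>k. measure M (N k))"
    using N(2) by (intro summable_comparison_test'[OF assms(2), of 0]) auto
  have "measure M (\<Union>k. N k) \<le> (\<Sum>k. measure M (N k))"
    using N(1) s by (intro finite_measure_subadditive_countably) auto
  also have "\<dots> \<le> suminf a" by (intro suminf_le N(2) s assms(2))
  finally show ?thesis using N by (intro likelyI[of "\<Union>k. N k"]) auto
qed

end

section \<open>Measurability of the path map into the Skorokhod space\<close>

lemma skorokhod_dist_le: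
  assumes "x \<in> skorokhod_space T" "y \<in> skorokhod_space T" "\<tau> \<in> time_changes T" "0 \<le> e"
    and "\<And>t. t \<in> {0..T} \<Longrightarrow> \<bar>\<tau> t - t\<bar> \<le> e" "\<And>t. t \<in> {0..T} \<Longrightarrow> \<bar>x t - y (\<tau> t)\<bar> \<le> e"
  shows "skorokhod_dist T x y \<le> e"
proof -
  have "e \<in> skorokhod_bounds T x y"
    unfolding skorokhod_bounds_def using assms by (auto intro!: bexI[of _ \<tau>])
  then show ?thesis
    using assms(1,2) by (simp add: skorokhod_dist_def cInf_lower skorokhod_bounds_bdd)
qed

text \<open>Sampling a path at the multiples of \<open>h\<close> delays its jumps to the next multiple; the time change \<open>\<tau>\<close>
undoes the delay. The sampled path is followed up to the first multiple of \<open>h\<close> that is at least \<open>s\<close>,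
and \<open>\<tau>\<close> sends that time to \<open>s\<close>, so that matchings of consecutive time intervals can be glued.\<close>

definition grid_matched :: "real \<Rightarrow> (real \<Rightarrow> real) \<Rightarrow> real \<Rightarrow> real \<Rightarrow> bool" where
  "grid_matched e x s h \<longleftrightarrow>
     (\<exists>\<tau>. strict_mono_on {0..h * \<lceil>s / h\<rceil>} \<tau> \<and> \<tau> ` {0..h * \<lceil>s / h\<rceil>} = {0..s} \<and> \<tau> (h * \<lceil>s / h\<rceil>) = s \<and>
        (\<forall>t\<in>{0..h * \<lceil>s / h\<rceil>}. \<bar>\<tau> t - t\<bar> \<le> h) \<and>
        (\<forall>t\<in>{0..<h * \<lceil>s / h\<rceil>}. \<bar>x (h * \<lfloor>t / h\<rfloor>) - x (\<tau> t)\<bar> \<le> e))"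

lemma grid_matched_0: "grid_matched e x 0 h" if "h > 0"
  using that unfolding grid_matched_def
  by (intro exI[of _ "\<lambda>t. t"]) (auto simp: strict_mono_on_def)

lemma grid_ceiling_bounds:
  fixes s h :: real
  assumes "h > 0"
  shows "s \<le> h * \<lceil>s / h\<rceil>" "h * \<lceil>s / h\<rceil> < s + h"
proof -
  have "s / h \<le> \<lceil>s / h\<rceil>" by (rule le_of_int_ceiling)
  then show "s \<le> h * \<lceil>s / h\<rceil>" using assms by (metis mult.commute pos_divide_le_eq)
  have "\<lceil>s / h\<rceil> < s / h + 1" using ceiling_correct[of "s/h"] by linarith
  then show "h * \<lceil>s / h\<rceil> < s + h" using assms by (simp add: field_simps)
qed

text \<open>On a stretch where the path oscillates by at most \<open>e\<close> every increasing time change does; an affine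
piece joins the two endpoints, which are displaced by less than \<open>h\<close>, and so displaces no time by
more than \<open>h\<close>.\<close>

lemma grid_matched_extend:
  assumes g: "grid_matched e x s h" and h: "0 < h" "h < r - s" and s: "0 \<le> s"
    and osc: "\<And>u v. u \<in> {s..<r} \<Longrightarrow> v \<in> {s..<r} \<Longrightarrow> \<bar>x u - x v\<bar> \<le> e"
  shows "grid_matched e x r h"
proof -
  define s' r' where "s' = h * \<lceil>s / h\<rceil>" and "r' = h * \<lceil>r / h\<rceil>"
  have b: "s \<le> s'" "s' < s + h" "r \<le> r'" "r' < r + h"
    using grid_ceiling_bounds[OF h(1)] by (auto simp: s'_def r'_def)
  then have sr: "s < r" "s' < r'" "0 \<le> s'" using h s by auto
  obtain \<tau> where \<tau>: "strict_mono_on {0..s'} \<tau>" "\<tau> ` {0..s'} = {0..s}" "\<tau> s' = s"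
    "\<And>t. t \<in> {0..s'} \<Longrightarrow> \<bar>\<tau> t - t\<bar> \<le> h"
    "\<And>t. t \<in> {0..<s'} \<Longrightarrow> \<bar>x (h * \<lfloor>t / h\<rfloor>) - x (\<tau> t)\<bar> \<le> e"
    using g unfolding grid_matched_def s'_def by blast
  define a where "a = (r - s) / (r' - s')"
  have a: "a > 0" and ar: "a * (r' - s') = r - s" using sr by (auto simp: a_def)
  define \<rho> where "\<rho> t = (if t \<le> s' then \<tau> t else s + (t - s') * a)" for t
  have \<tau>le: "\<tau> t \<le> s" if "t \<in> {0..s'}" for t using \<tau>(2) that by fastforce
  have \<rho>aff: "\<rho> t = s + (t - s') * a" if "t \<ge> s'" for t
    using that \<tau>(3) by (auto simp: \<rho>_def)
  have "strict_mono_on {0..r'} \<rho>"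
  proof (rule strict_mono_onI)
    fix p q assume pq: "p \<in> {0..r'}" "q \<in> {0..r'}" "p < q"
    consider "q \<le> s'" | "p \<le> s'" "s' < q" | "s' < p" by linarith
    then show "\<rho> p < \<rho> q"
    proof cases
      case 1
      then show ?thesis using \<tau>(1) pq by (auto simp: \<rho>_def strict_mono_on_def)
    next
      case 2
      then have "\<rho> p \<le> s" using \<tau>le[of p] pq by (auto simp: \<rho>_def)
      also have "s < \<rho> q" using 2 a by (simp add: \<rho>_def)
      finally show ?thesis .
    next
      case 3
      then show ?thesis using pq a by (simp add: \<rho>_def)
    qed
  qed
  moreover have "\<rho> ` {0..r'} = {0..r}"
  proof -
    have "\<rho> ` {0..s'} = {0..s}" using \<tau>(2) by (auto simp: \<rho>_def)
    moreover have "\<rho> ` {s'..r'} = {s..r}"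
    proof
      show "\<rho> ` {s'..r'} \<subseteq> {s..r}"
      proof
        fix y assume "y \<in> \<rho> ` {s'..r'}"
        then obtain t where t: "t \<in> {s'..r'}" "y = s + (t - s') * a" using \<rho>aff by auto
        have "(t - s') * a \<le> (r' - s') * a" using t a by (intro mult_right_mono) auto
        moreover have "0 \<le> (t - s') * a" using t a by auto
        ultimately show "y \<in> {s..r}" using t ar by (auto simp: mult.commute)
      qed
      show "{s..r} \<subseteq> \<rho> ` {s'..r'}"
      proof
        fix y assume y: "y \<in> {s..r}"
        define t where "t = s' + (y - s) / a"
        have "(y - s) / a \<le> (r - s) / a" using y a by (intro divide_right_mono) auto
        also have "\<dots> = r' - s'" using ar a by (auto simp: field_simps)
        finally have "t \<in> {s'..r'}" using y a by (auto simp: t_def)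
        moreover have "\<rho> t = y" using \<rho>aff[of t] calculation a by (auto simp: t_def)
        ultimately show "y \<in> \<rho> ` {s'..r'}" by blast
      qed
    qed
    moreover have "{0..r'} = {0..s'} \<union> {s'..r'}" "{0..r} = {0..s} \<union> {s..r}"
      using sr s by auto
    ultimately show ?thesis by (simp only: image_Un)
  qed
  moreover have "\<rho> r' = r" using \<rho>aff[of r'] sr ar by (auto simp: mult.commute)
  moreover have "\<bar>\<rho> t - t\<bar> \<le> h" if t: "t \<in> {0..r'}" for t
  proof (cases "t \<le> s'")
    case True then show ?thesis using \<tau>(4) t by (auto simp: \<rho>_def)
  next
    case False
    (* The displacement is affine in t: a convex combination of those at the endpoints. *)
    define w where "w = (t - s') / (r' - s')"
    have w: "0 \<le> w" "w \<le> 1" using False t by (auto simp: w_def)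
    have wt: "w * (r' - s') = t - s'" using sr by (simp add: w_def)
    have "(t - s') * a = w * (r - s)" unfolding wt[symmetric] using ar by (simp add: mult.assoc mult.commute)
    then have "\<rho> t - t = (1 - w) * (s - s') + w * (r - r')"
      using False wt by (simp add: \<rho>_def algebra_simps)
    moreover have "\<bar>(1 - w) * (s - s') + w * (r - r')\<bar> \<le> (1 - w) * h + w * h"
    proof -
      have "\<bar>(1 - w) * (s - s')\<bar> \<le> (1 - w) * h"
        using w b by (auto simp: abs_mult intro!: mult_left_mono)
      moreover have "\<bar>w * (r - r')\<bar> \<le> w * h"
        using w b by (auto simp: abs_mult intro!: mult_left_mono)
      ultimately show ?thesis by linarith
    qed
    ultimately show ?thesis by (simp add: algebra_simps)
  qed
  moreover have "\<bar>x (h * \<lfloor>t / h\<rfloor>) - x (\<rho> t)\<bar> \<le> e" if t: "t \<in> {0..<r'}" for t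
  proof (cases "t < s'")
    case True then show ?thesis using \<tau>(5) t by (auto simp: \<rho>_def)
  next
    case False
    have "\<lceil>s / h\<rceil> \<le> \<lfloor>t / h\<rfloor>"
      using False h by (simp add: le_floor_iff s'_def field_simps)
    then have 1: "s' \<le> h * \<lfloor>t / h\<rfloor>" using h by (simp add: s'_def)
    have "h * \<lfloor>t / h\<rfloor> \<le> t" using h floor_divide_lower[of h t] by (simp add: mult.commute)
    then have "h * \<lfloor>t / h\<rfloor> < h * \<lceil>r / h\<rceil>" using t unfolding r'_def by auto
    then have "\<lfloor>t / h\<rfloor> < \<lceil>r / h\<rceil>" using h by simp
    then have "\<lfloor>t / h\<rfloor> < r / h" by (simp add: less_ceiling_iff)
    then have 2: "h * \<lfloor>t / h\<rfloor> < r" using h by (simp add: field_simps)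
    have "(t - s') * a < (r' - s') * a" using t a by (intro mult_strict_right_mono) auto
    then have "\<rho> t \<in> {s..<r}" using False a ar \<rho>aff[of t] by (auto simp: mult.commute)
    then show ?thesis using 1 2 b by (intro osc) auto
  qed
  ultimately show ?thesis unfolding grid_matched_def r'_def by blast
qed

text \<open>Continuous induction on the time up to which the matching succeeds: the left limit at the supremum of
these times shows that it is attained, and right continuity moves it further to the right unless it
is \<open>T\<close>.\<close>

lemma eventually_grid_matched:
  assumes x: "cadlag_on {0..T} x" and T: "T > 0" and e: "e > 0"
  shows "\<forall>\<^sub>F h in at_right 0. grid_matched e x T h"
proof -
  define Q where "Q s \<longleftrightarrow> (\<forall>\<^sub>F h in at_right 0. grid_matched e x s h)" for s
  have ext: "Q r" if Qs: "Q s" "0 \<le> s" "s < r" and xl: "\<And>u. u \<in> {s..<r} \<Longrightarrow> \<bar>x u - l\<bar> < e / 2" for s r l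
  proof -
    have osc: "\<bar>x u - x v\<bar> \<le> e" if uv: "u \<in> {s..<r}" "v \<in> {s..<r}" for u v
      using xl[OF uv(1)] xl[OF uv(2)] by linarith
    have "\<forall>\<^sub>F h in at_right 0. h \<in> {0<..<r - s}"
      using Qs by (intro eventually_at_right_real) auto
    with \<open>Q s\<close>[unfolded Q_def] show ?thesis unfolding Q_def
      by eventually_elim (rule grid_matched_extend[OF _ _ _ Qs(2) osc], auto)
  qed
  define S where "S = {s \<in> {0..T}. Q s}"
  have "Q 0"
    unfolding Q_def by (rule eventually_mono[OF eventually_at_right_less]) (rule grid_matched_0)
  then have 0: "0 \<in> S" using T by (simp add: S_def)
  have bdd: "bdd_above S" by (rule bdd_aboveI[of _ T]) (auto simp: S_def)
  define c where "c = Sup S"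
  have "0 \<le> c" unfolding c_def by (rule cSup_upper[OF 0 bdd])
  moreover have "c \<le> T"
    unfolding c_def
  proof (rule cSup_least)
    show "S \<noteq> {}" using 0 by blast
  qed (simp add: S_def)
  ultimately have c: "0 \<le> c" "c \<le> T" by auto
  have ul: "\<exists>l. (x \<longlongrightarrow> l) (at c within {0..T} \<inter> {..<c})"
    and ur: "(x \<longlongrightarrow> x c) (at c within {0..T} \<inter> {c<..})"
    using x c by (auto simp: cadlag_on_def)
  have "Q c"
  proof -
    obtain l where l: "(x \<longlongrightarrow> l) (at c within {0..T} \<inter> {..<c})" using ul by blast
    from tendstoD[OF l, of "e/2"] e obtain d where d: "d > 0"
      "\<And>u. u \<in> {0..T} \<Longrightarrow> u < c \<Longrightarrow> dist u c < d \<Longrightarrow> dist (x u) l < e / 2"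
      by (auto simp: eventually_at)
    obtain s where s: "s \<in> S" "c - d < s" using less_cSup_iff[of S "c - d"] 0 bdd d(1) by (auto simp: c_def)
    have sc: "s \<le> c" using cSup_upper[OF s(1) bdd] by (simp add: c_def)
    show ?thesis
    proof (cases "s = c")
      case True then show ?thesis using s by (simp add: S_def)
    next
      case False
      then show ?thesis using s sc d(2) c
        by (intro ext[of s c l]) (auto simp: S_def dist_real_def)
    qed
  qed
  have "c = T"
  proof (rule ccontr)
    assume "c \<noteq> T"
    from tendstoD[OF ur, of "e/2"] e obtain d where d: "d > 0"
      "\<And>u. u \<in> {0..T} \<Longrightarrow> u > c \<Longrightarrow> dist u c < d \<Longrightarrow> dist (x u) (x c) < e / 2"
      by (auto simp: eventually_at)
    define r where "r = min T (c + d)"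
    have r: "c < r" "r \<le> T" "r \<le> c + d" using \<open>c \<noteq> T\<close> c d by (auto simp: r_def)
    have "\<bar>x u - x c\<bar> < e / 2" if "u \<in> {c..<r}" for u
      using d(2)[of u] that r c e by (cases "u = c") (auto simp: dist_real_def)
    then have "Q r" using \<open>Q c\<close> c r by (intro ext[of c r "x c"]) auto
    then have "r \<in> S" using r c by (auto simp: S_def)
    then show False using cSup_upper[OF _ bdd, of r] r by (auto simp: c_def)
  qed
  with \<open>Q c\<close> show ?thesis by (simp add: Q_def)
qed

text \<open>The values are multiples of \<open>1 / n\<close>, so that for each \<open>n\<close> only countably many functions arise.\<close>

definition grid_step :: "real \<Rightarrow> nat \<Rightarrow> (nat \<Rightarrow> int) \<Rightarrow> real \<Rightarrow> real" where
  "grid_step T n v = (\<lambda>t\<in>{0..T}. v (nat \<lfloor>t / (T / n)\<rfloor>) / n)"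

lemma cadlag_on_floor:
  fixes h :: real assumes h: "h > 0"
  shows "cadlag_on S (\<lambda>t. v \<lfloor>t / h\<rfloor>)"
  unfolding cadlag_on_def
proof (intro ballI conjI exI)
  fix t
  define k where "k = \<lfloor>t / h\<rfloor>"
  have k: "k \<le> t / h" "t / h < k + 1" by (auto simp: k_def)
  have "\<forall>\<^sub>F s in at t within S \<inter> {t<..}. \<lfloor>s / h\<rfloor> = k"
    unfolding eventually_at
  proof (intro exI conjI ballI impI)
    show "h * (k + 1) - t > 0" using k h by (simp add: field_simps)
    fix s assume "s \<in> S \<inter> {t<..}" "s \<noteq> t \<and> dist s t < h * (k + 1) - t"
    then have "t < s" "s < h * (k + 1)" by (auto simp: dist_real_def)
    then have "t / h < s / h" "s / h < k + 1" using h by (auto simp: field_simps)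
    then show "\<lfloor>s / h\<rfloor> = k" using k by (intro floor_unique) auto
  qed
  then have "\<forall>\<^sub>F s in at t within S \<inter> {t<..}. v \<lfloor>s / h\<rfloor> = v \<lfloor>t / h\<rfloor>"
    by eventually_elim (simp add: k_def)
  then show "((\<lambda>t. v \<lfloor>t / h\<rfloor>) \<longlongrightarrow> v \<lfloor>t / h\<rfloor>) (at t within S \<inter> {t<..})"
    by (rule tendsto_eventually)
  define j where "j = \<lceil>t / h\<rceil> - 1"
  have j: "j < t / h" "t / h \<le> j + 1" unfolding j_def by linarith+
  have "\<forall>\<^sub>F s in at t within S \<inter> {..<t}. \<lfloor>s / h\<rfloor> = j"
    unfolding eventually_at
  proof (intro exI conjI ballI impI)
    show "t - h * j > 0" using j h by (simp add: field_simps)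
    fix s assume "s \<in> S \<inter> {..<t}" "s \<noteq> t \<and> dist s t < t - h * j"
    then have "s < t" "h * j < s" by (auto simp: dist_real_def)
    then have "s / h < t / h" "j < s / h" using h by (auto simp: field_simps)
    then show "\<lfloor>s / h\<rfloor> = j" using j by (intro floor_unique) auto
  qed
  then have "\<forall>\<^sub>F s in at t within S \<inter> {..<t}. v \<lfloor>s / h\<rfloor> = v j"
    by eventually_elim simp
  then show "((\<lambda>t. v \<lfloor>t / h\<rfloor>) \<longlongrightarrow> v j) (at t within S \<inter> {..<t})"
    by (rule tendsto_eventually)
qed

lemma cadlag_on_cong:
  assumes "\<And>t. t \<in> S \<Longrightarrow> x t = y t" "cadlag_on S x"
  shows "cadlag_on S y"
proof -
  have "(x \<longlongrightarrow> l) (at t within S \<inter> A) \<longleftrightarrow> (y \<longlongrightarrow> l) (at t within S \<inter> A)" for t l A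
    by (rule Lim_cong_within) (auto simp: assms(1))
  then show ?thesis using assms by (simp add: cadlag_on_def)
qed

lemma cadlag_on_subset:
  assumes "cadlag_on S x" "R \<subseteq> S"
  shows "cadlag_on R x"
  unfolding cadlag_on_def
proof (intro ballI conjI)
  fix t assume "t \<in> R"
  with assms obtain l where "(x \<longlongrightarrow> x t) (at t within S \<inter> {t<..})" "(x \<longlongrightarrow> l) (at t within S \<inter> {..<t})"
    unfolding cadlag_on_def by blast
  with assms(2) show "(x \<longlongrightarrow> x t) (at t within R \<inter> {t<..})" "\<exists>l. (x \<longlongrightarrow> l) (at t within R \<inter> {..<t})"
    by (meson tendsto_within_subset Int_mono order_refl)+
qed

lemma restrict_in_skorokhod_space:
  assumes "cadlag_on S x" "{0..T} \<subseteq> S"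
  shows "restrict x {0..T} \<in> skorokhod_space T"
  unfolding skorokhod_space_def
  using cadlag_on_cong[OF _ cadlag_on_subset[OF assms], of "restrict x {0..T}"] by auto

lemma grid_step_in_skorokhod_space:
  assumes "T > 0" "n > 0"
  shows "grid_step T n v \<in> skorokhod_space T"
  unfolding grid_step_def
  by (rule restrict_in_skorokhod_space[OF cadlag_on_floor[of "T / n" UNIV "\<lambda>k. v (nat k) / n"]]) (use assms in auto)

lemma grid_step_approximates:
  fixes x :: "real \<Rightarrow> real"
  assumes x: "cadlag_on S x" "{0..T} \<subseteq> S" and T: "T > 0" and e: "e > 0"
  shows "\<forall>\<^sub>F n in sequentially. skorokhod_dist T
    (grid_step T n (\<lambda>k. \<lfloor>n * x (k * (T / n))\<rfloor>)) (restrict x {0..T}) < e"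
proof -
  have e3: "e / 3 > 0" using e by simp
  have lim: "filterlim (\<lambda>n. T / real n) (at_right 0) sequentially"
    unfolding filterlim_at using T
    by (auto intro!: tendsto_eq_intros lim_const_over_n eventually_mono[OF eventually_gt_at_top[of 0]])
  have "\<forall>\<^sub>F n in sequentially. grid_matched (e / 3) x T (T / real n)"
    using eventually_compose_filterlim[OF eventually_grid_matched[OF cadlag_on_subset[OF x] T e3] lim] .
  moreover have "\<forall>\<^sub>F n in sequentially. T / real n < e / 3"
    using order_tendstoD(2)[OF lim_const_over_n[of T] e3] .
  moreover have "\<forall>\<^sub>F n in sequentially. 1 / real n < e / 3"
    using order_tendstoD(2)[OF lim_const_over_n[of 1] e3] .
  ultimately show ?thesis using eventually_gt_at_top[of 0]
  proof eventually_elim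
    case (elim n)
    define h where "h = T / real n"
    have h: "h > 0" using T elim by (simp add: h_def)
    have nh: "h * \<lceil>T / h\<rceil> = T" using T elim by (simp add: h_def)
    obtain \<tau> where \<tau>: "strict_mono_on {0..T} \<tau>" "\<tau> ` {0..T} = {0..T}" "\<tau> T = T"
      "\<And>t. t \<in> {0..T} \<Longrightarrow> \<bar>\<tau> t - t\<bar> \<le> h"
      "\<And>t. t \<in> {0..<T} \<Longrightarrow> \<bar>x (h * \<lfloor>t / h\<rfloor>) - x (\<tau> t)\<bar> \<le> e / 3"
      using elim(1) unfolding grid_matched_def h_def[symmetric] nh by blast
    have tc: "\<tau> \<in> time_changes T" using \<tau> by (simp add: time_changes_def)
    let ?y = "grid_step T n (\<lambda>k. \<lfloor>n * x (k * (T / n))\<rfloor>)"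
    have close: "\<bar>?y t - restrict x {0..T} (\<tau> t)\<bar> \<le> 2 * (e / 3)" if t: "t \<in> {0..T}" for t
    proof -
      define u where "u = h * \<lfloor>t / h\<rfloor>"
      have "0 \<le> \<lfloor>t / h\<rfloor>" using t h by auto
      then have y: "?y t = \<lfloor>n * x u\<rfloor> / n"
        using t by (simp add: grid_step_def u_def h_def mult.commute)
      have "\<bar>\<lfloor>n * x u\<rfloor> - n * x u\<bar> \<le> 1" by linarith
      then have "\<bar>\<lfloor>n * x u\<rfloor> - n * x u\<bar> / n \<le> 1 / n" by (rule divide_right_mono) simp
      moreover have "(\<lfloor>n * x u\<rfloor> - n * x u) / n = \<lfloor>n * x u\<rfloor> / n - x u"
        using elim by (simp add: field_simps)
      ultimately have "\<bar>\<lfloor>n * x u\<rfloor> / n - x u\<bar> \<le> 1 / n"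
        by (metis abs_divide abs_of_nat)
      moreover have "\<bar>x u - x (\<tau> t)\<bar> \<le> e / 3"
      proof (cases "t = T")
        case True
        have "u = T" unfolding u_def True using T elim by (simp add: h_def)
        then show ?thesis using \<tau>(3) True e by simp
      next
        case False
        then show ?thesis using \<tau>(5)[of t] t by (simp add: u_def)
      qed
      moreover have "restrict x {0..T} (\<tau> t) = x (\<tau> t)" using \<tau>(2) t by auto
      ultimately show ?thesis using y elim by linarith
    qed
    have "skorokhod_dist T ?y (restrict x {0..T}) \<le> 2 * (e / 3)"
    proof (rule skorokhod_dist_le[OF _ _ tc])
      show "?y \<in> skorokhod_space T" using T elim by (intro grid_step_in_skorokhod_space) auto
      show "restrict x {0..T} \<in> skorokhod_space T" by (rule restrict_in_skorokhod_space[OF x])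
      show "\<bar>\<tau> t - t\<bar> \<le> 2 * (e / 3)" if "t \<in> {0..T}" for t
        using \<tau>(4)[OF that] elim(2) e unfolding h_def by linarith
    qed (use e close in auto)
    then show ?case using e by simp
  qed
qed

lemma sets_borel_algebra: "sets (borel_algebra X) = sigma_sets (topspace X) {U. openin X U}"
  unfolding borel_algebra_def by (rule sets_measure_of) (auto simp: openin_subset[THEN subsetD])

lemma space_borel_algebra [simp]: "space (borel_algebra X) = topspace X"
  unfolding borel_algebra_def by (rule space_measure_of) (auto simp: openin_subset[THEN subsetD])

text \<open>The Borel sets of the Skorokhod topology are not described through coordinates. Instead the path is
the limit of its grid approximations, which take countably many values, so that the preimage of an
arbitrary set under an approximation is measurable. A limit lies in an open set \<open>U\<close> iff for some \<open>k\<close>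
the approximations eventually lie in the set \<open>V k\<close> of points whose ball of radius \<open>1 / Suc k\<close> is
contained in \<open>U\<close>.\<close>

lemma path_map_measurable:
  assumes X: "\<And>t. 0 \<le> t \<Longrightarrow> X t \<in> borel_measurable M"
    and cad: "\<And>\<omega>. \<omega> \<in> space M \<Longrightarrow> cadlag_on {0..} (\<lambda>t. X t \<omega>)" and T: "T > 0"
  shows "(\<lambda>\<omega>. \<lambda>t\<in>{0..T}. X t \<omega>) \<in> measurable M (borel_algebra (skorokhod_topology T))"
proof -
  define \<pi> where "\<pi> \<omega> = (\<lambda>t\<in>{0..T}. X t \<omega>)" for \<omega>
  define c where "c n \<omega> = map (\<lambda>k. \<lfloor>real n * X (real k * (T / n)) \<omega>\<rfloor>) [0..<Suc n]" for n \<omega>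
  define \<pi>' where "\<pi>' n \<omega> = grid_step T n (\<lambda>k. \<lfloor>real n * X (real k * (T / n)) \<omega>\<rfloor>)" for n \<omega>
  have \<pi>'_c: "\<pi>' n \<omega> = grid_step T n ((!) (c n \<omega>))" if "n > 0" for n \<omega>
  proof -
    have "nat \<lfloor>t / (T / n)\<rfloor> < Suc n" if "t \<in> {0..T}" for t
    proof -
      have "t / (T / n) \<le> n" using that T \<open>n > 0\<close> by (auto simp: field_simps)
      then have "\<lfloor>t / (T / n)\<rfloor> \<le> n" by linarith
      then show ?thesis by simp
    qed
    then show ?thesis unfolding \<pi>'_def grid_step_def c_def
      by (intro restrict_ext) (simp del: upt_Suc)
  qed
  have \<pi>: "\<pi> \<omega> \<in> skorokhod_space T" if "\<omega> \<in> space M" for \<omega>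
    unfolding \<pi>_def by (rule restrict_in_skorokhod_space[OF cad[OF that]]) auto
  have \<pi>': "\<pi>' n \<omega> \<in> skorokhod_space T" if "n > 0" for n \<omega>
    unfolding \<pi>'_def by (rule grid_step_in_skorokhod_space[OF T that])
  have approx: "\<forall>\<^sub>F n in sequentially. skorokhod_dist T (\<pi>' n \<omega>) (\<pi> \<omega>) < e"
    if "\<omega> \<in> space M" "e > 0" for \<omega> e
    unfolding \<pi>_def \<pi>'_def by (rule grid_step_approximates[OF cad[OF that(1)] _ T that(2)]) auto
  have discrete: "{\<omega> \<in> space M. \<pi>' n \<omega> \<in> V} \<in> sets M" if n: "n > 0" for n V
  proof -
    have "{\<omega> \<in> space M. c n \<omega> = l} \<in> sets M" for l
    proof -
      have "{\<omega> \<in> space M. c n \<omega> = l} =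
        (if length l = Suc n then {\<omega> \<in> space M. \<forall>k\<in>{..<Suc n}. \<lfloor>real n * X (real k * (T / n)) \<omega>\<rfloor> = l ! k} else {})"
        unfolding c_def by (auto simp: list_eq_iff_nth_eq simp del: upt_Suc)
      also have "\<dots> \<in> sets M"
      proof -
        have "X (real k * (T / n)) \<in> borel_measurable M" for k using T by (intro X) auto
        then show ?thesis by (auto intro!: sets.sets_Collect_finite_All')
      qed
      finally show ?thesis .
    qed
    then have "(\<Union>l\<in>{l. grid_step T n ((!) l) \<in> V}. {\<omega> \<in> space M. c n \<omega> = l}) \<in> sets M"
      by (intro sets.countable_UN') auto
    also have "(\<Union>l\<in>{l. grid_step T n ((!) l) \<in> V}. {\<omega> \<in> space M. c n \<omega> = l}) = {\<omega> \<in> space M. \<pi>' n \<omega> \<in> V}"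
      using \<pi>'_c[OF n] by auto
    finally show ?thesis .
  qed
  have "\<pi> \<in> measurable M (borel_algebra (skorokhod_topology T))"
    unfolding borel_algebra_def
  proof (rule measurable_measure_of)
    show "{U. openin (skorokhod_topology T) U} \<subseteq> Pow (topspace (skorokhod_topology T))"
      using openin_subset by blast
    show "\<pi> \<in> space M \<rightarrow> topspace (skorokhod_topology T)" using \<pi> by auto
    fix U assume "U \<in> {U. openin (skorokhod_topology T) U}"
    then have U: "\<And>x. x \<in> U \<Longrightarrow> \<exists>r>0. Skorokhod.mball T x r \<subseteq> U"
      by (auto simp: skorokhod_topology_def Skorokhod.openin_mtopology)
    define V where "V k = {y \<in> skorokhod_space T. Skorokhod.mball T y (1 / real (Suc k)) \<subseteq> U}" for k
    have "\<pi> \<omega> \<in> U \<longleftrightarrow> (\<exists>k N. \<forall>n\<ge>N. \<pi>' (Suc n) \<omega> \<in> V k)" if \<omega>: "\<omega> \<in> space M" for \<omega>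
    proof
      assume "\<pi> \<omega> \<in> U"
      then obtain r where r: "r > 0" "Skorokhod.mball T (\<pi> \<omega>) r \<subseteq> U" using U by blast
      obtain k where k: "1 / real (Suc k) < r / 2" using r(1) nat_approx_posE[of "r/2"] by auto
      obtain N where N: "\<And>n. n \<ge> N \<Longrightarrow> skorokhod_dist T (\<pi>' n \<omega>) (\<pi> \<omega>) < r / 2"
        using approx[OF \<omega>, of "r/2"] r(1) by (auto simp: eventually_sequentially)
      have "\<pi>' (Suc n) \<omega> \<in> V k" if "n \<ge> N" for n
      proof -
        have "skorokhod_dist T (\<pi> \<omega>) z < r"
          if z: "z \<in> skorokhod_space T" "skorokhod_dist T (\<pi>' (Suc n) \<omega>) z < 1 / real (Suc k)" for z
          using Skorokhod.triangle[OF \<pi>[OF \<omega>] \<pi>'[of "Suc n" \<omega>] z(1)] N[of "Suc n"] \<open>n \<ge> N\<close> z(2) k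
            Skorokhod.commute[of T "\<pi> \<omega>" "\<pi>' (Suc n) \<omega>"] by simp
        then have "Skorokhod.mball T (\<pi>' (Suc n) \<omega>) (1 / real (Suc k)) \<subseteq> Skorokhod.mball T (\<pi> \<omega>) r"
          using \<pi>[OF \<omega>] by auto
        then show ?thesis using r(2) \<pi>' by (auto simp: V_def)
      qed
      then show "\<exists>k N. \<forall>n\<ge>N. \<pi>' (Suc n) \<omega> \<in> V k" by blast
    next
      assume "\<exists>k N. \<forall>n\<ge>N. \<pi>' (Suc n) \<omega> \<in> V k"
      then obtain k N where kN: "\<And>n. n \<ge> N \<Longrightarrow> \<pi>' (Suc n) \<omega> \<in> V k" by blast
      obtain N' where N': "\<And>n. n \<ge> N' \<Longrightarrow> skorokhod_dist T (\<pi>' n \<omega>) (\<pi> \<omega>) < 1 / real (Suc k)"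
        using approx[OF \<omega>, of "1 / real (Suc k)"] by (auto simp: eventually_sequentially)
      have "\<pi> \<omega> \<in> Skorokhod.mball T (\<pi>' (Suc (max N N')) \<omega>) (1 / real (Suc k))"
        using N'[of "Suc (max N N')"] \<pi>[OF \<omega>] \<pi>' by auto
      then show "\<pi> \<omega> \<in> U" using kN[of "max N N'"] by (auto simp: V_def)
    qed
    then have "\<pi> -` U \<inter> space M = (\<Union>k. \<Union>N. \<Inter>n\<in>{N..}. {\<omega> \<in> space M. \<pi>' (Suc n) \<omega> \<in> V k})"
      by (intro set_eqI) (simp add: conj_commute cong: conj_cong, blast)
    also have "\<dots> \<in> sets M"
      by (intro sets.countable_UN' countableI_type image_subsetI sets.countable_INT') (use discrete in auto)
    finally show "\<pi> -` U \<inter> space M \<in> sets M" .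
  qed
  then show ?thesis by (simp add: \<pi>_def[abs_def])
qed

section \<open>Symmetric stable laws\<close>

definition stable_law :: "real \<Rightarrow> real \<Rightarrow> real measure \<Rightarrow> bool" where
  "stable_law \<alpha> c \<mu> \<longleftrightarrow> real_distribution \<mu> \<and> (\<forall>u. char \<mu> u = of_real (exp (- (c * \<bar>u\<bar> powr \<alpha>))))"

text \<open>Averaging the characteristic function against a Gaussian law and exchanging the integrals gives a
positive, bump-shaped test function on the side of \<open>\<mu>\<close>. Small \<open>R\<close> yields the tails of \<open>\<mu>\<close>, large
\<open>R\<close> its mass near 0.\<close>

lemma stable_law_gaussian_identity:
  assumes "stable_law \<alpha> c \<mu>"
  shows "(\<integral>y. exp (- ((R * y)\<^sup>2) / 2) \<partial>\<mu>)
    = (\<integral>z. exp (- (c * \<bar>R * z\<bar> powr \<alpha>)) \<partial>std_normal_distribution)"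
proof -
  interpret \<mu>: real_distribution \<mu> using assms by (simp add: stable_law_def)
  interpret N: real_distribution std_normal_distribution by (rule real_dist_normal_dist)
  interpret P: pair_prob_space \<mu> std_normal_distribution ..
  have ch: "char \<mu> u = of_real (exp (- (c * \<bar>u\<bar> powr \<alpha>)))" for u
    using assms by (simp add: stable_law_def)
  have "complex_of_real (\<integral>y. exp (- ((R * y)\<^sup>2) / 2) \<partial>\<mu>) = (\<integral>y. char std_normal_distribution (R * y) \<partial>\<mu>)"
    by (simp add: char_std_normal_distribution del: of_real_exp flip: integral_complex_of_real)
  also have "\<dots> = (\<integral>y. (\<integral>z. iexp (R * y * z) \<partial>std_normal_distribution) \<partial>\<mu>)"
    by (simp add: char_def)
  also have "\<dots> = (\<integral>z. (\<integral>y. iexp (R * y * z) \<partial>\<mu>) \<partial>std_normal_distribution)"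
  proof (rule P.Fubini_integral[symmetric])
    show "integrable (\<mu> \<Otimes>\<^sub>M std_normal_distribution) (\<lambda>(y, z). iexp (R * y * z))"
      by (intro P.integrable_const_bound[of _ 1]) (auto simp: split_beta)
  qed
  also have "\<dots> = (\<integral>z. char \<mu> (R * z) \<partial>std_normal_distribution)"
    by (simp add: char_def ac_simps)
  also have "\<dots> = of_real (\<integral>z. exp (- (c * \<bar>R * z\<bar> powr \<alpha>)) \<partial>std_normal_distribution)"
    by (simp add: ch del: of_real_exp)
  finally show ?thesis unfolding of_real_eq_iff .
qed

lemma std_normal_second_moment:
  "integrable std_normal_distribution (\<lambda>z. 1 + z\<^sup>2)" "(\<integral>z. 1 + z\<^sup>2 \<partial>std_normal_distribution) = 2"
proof -
  interpret N: real_distribution std_normal_distribution by (rule real_dist_normal_dist)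
  have "(\<integral>z. z ^ (2 * 1) \<partial>std_normal_distribution) = fact (2 * 1) / (2 ^ 1 * fact 1)"
    by (rule std_normal_distribution_even_moments)
  then have 2: "(\<integral>z. z\<^sup>2 \<partial>std_normal_distribution) = 1" by (simp add: numeral_2_eq_2)
  have i: "integrable std_normal_distribution (\<lambda>z. z\<^sup>2)"
    using std_normal_distribution_even_moments(2)[of 1] by simp
  show "integrable std_normal_distribution (\<lambda>z. 1 + z\<^sup>2)" using i by simp
  show "(\<integral>z. 1 + z\<^sup>2 \<partial>std_normal_distribution) = 2" using i 2 N.prob_space[unfolded N.space_eq_univ] by simp
qed

lemma powr_le_one_plus_square:
  fixes z \<alpha> :: real
  assumes "0 < \<alpha>" "\<alpha> \<le> 2"
  shows "\<bar>z\<bar> powr \<alpha> \<le> 1 + z\<^sup>2"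
proof (cases "\<bar>z\<bar> \<le> 1")
  case True
  then have "\<bar>z\<bar> powr \<alpha> \<le> 1 powr \<alpha>" using assms by (intro powr_mono2) auto
  then show ?thesis by (simp add: add_increasing2)
next
  case False
  then have "\<bar>z\<bar> powr \<alpha> \<le> \<bar>z\<bar> powr 2" using assms by (intro powr_mono) auto
  then show ?thesis using False by simp
qed

text \<open>With \<open>R = 1 / x\<close>, the function \<open>1 - exp (- (R * y)\<^sup>2 / 2)\<close> is at least \<open>1 / 3\<close> beyond \<open>x\<close>, and its
mean is at most \<open>c * R powr \<alpha>\<close> times the absolute moment of order \<open>\<alpha>\<close> of a normal variable.\<close>

lemma stable_law_tail:
  assumes \<mu>: "stable_law \<alpha> c \<mu>" and \<alpha>: "0 < \<alpha>" "\<alpha> \<le> 2" and c: "0 \<le> c" and x: "0 < x"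
  shows "measure \<mu> {y. x \<le> \<bar>y\<bar>} \<le> 6 * c * x powr - \<alpha>"
proof -
  interpret \<mu>: real_distribution \<mu> using assms by (simp add: stable_law_def)
  interpret N: real_distribution std_normal_distribution by (rule real_dist_normal_dist)
  have int1: "integrable \<mu> (\<lambda>y. exp (- ((1 / x * y)\<^sup>2) / 2))"
    by (rule \<mu>.integrable_const_bound[of _ 1]) auto
  have int2: "integrable std_normal_distribution (\<lambda>z. exp (- (c * \<bar>1 / x * z\<bar> powr \<alpha>)))"
    using c by (intro N.integrable_const_bound[of _ 1]) auto
  have *: "1 / 3 \<le> 1 - exp (- ((1 / x * y)\<^sup>2) / 2)" if "x \<le> \<bar>y\<bar>" for y
  proof -
    have "1 \<le> (1 / x * y)\<^sup>2"
      using that x by (simp add: power_divide abs_le_square_iff[of x y, symmetric])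
    then have "exp (- ((1 / x * y)\<^sup>2) / 2) \<le> exp (- (1 / 2 :: real))" by simp
    moreover have "3 / 2 \<le> exp (1 / 2 :: real)" using exp_ge_add_one_self[of "1/2 :: real"] by simp
    then have "exp (- (1 / 2 :: real)) \<le> 2 / 3" by (simp add: exp_minus field_simps)
    ultimately show ?thesis by linarith
  qed
  have int0: "integrable \<mu> (\<lambda>y. (1 / 3 :: real) * indicator {y. x \<le> \<bar>y\<bar>} y)"
    by (rule \<mu>.integrable_const_bound[of _ 1]) (auto simp: indicator_def)
  have "1 / 3 * measure \<mu> {y. x \<le> \<bar>y\<bar>} = (\<integral>y. 1 / 3 * indicator {y. x \<le> \<bar>y\<bar>} y \<partial>\<mu>)"
    by simp
  also have "\<dots> \<le> (\<integral>y. 1 - exp (- ((1 / x * y)\<^sup>2) / 2) \<partial>\<mu>)"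
    by (rule integral_mono[OF int0]) (use * int1 in \<open>auto simp: indicator_def\<close>)
  also have "\<dots> = (\<integral>z. 1 - exp (- (c * \<bar>1 / x * z\<bar> powr \<alpha>)) \<partial>std_normal_distribution)"
    using int1 int2 stable_law_gaussian_identity[OF \<mu>, of "1 / x"]
    using \<mu>.prob_space[unfolded \<mu>.space_eq_univ] N.prob_space[unfolded N.space_eq_univ] by simp
  also have "\<dots> \<le> (\<integral>z. c * x powr - \<alpha> * (1 + z\<^sup>2) \<partial>std_normal_distribution)"
  proof (rule integral_mono)
    show "integrable std_normal_distribution (\<lambda>z. 1 - exp (- (c * \<bar>1 / x * z\<bar> powr \<alpha>)))"
      using int2 by simp
    show "integrable std_normal_distribution (\<lambda>z. c * x powr - \<alpha> * (1 + z\<^sup>2))"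
      using std_normal_second_moment(1) by (intro integrable_mult_right) auto
    fix z
    have "1 - exp (- (c * \<bar>1 / x * z\<bar> powr \<alpha>)) \<le> c * \<bar>1 / x * z\<bar> powr \<alpha>"
      using exp_ge_add_one_self[of "- (c * \<bar>1 / x * z\<bar> powr \<alpha>)"] by linarith
    also have "\<dots> = c * (x powr - \<alpha> * \<bar>z\<bar> powr \<alpha>)"
      using x by (simp add: abs_mult powr_divide powr_minus field_simps)
    also have "\<dots> \<le> c * (x powr - \<alpha> * (1 + z\<^sup>2))"
      using c powr_le_one_plus_square[OF \<alpha>, of z] by (intro mult_left_mono) auto
    also have "\<dots> = c * x powr - \<alpha> * (1 + z\<^sup>2)" by simp
    finally show "1 - exp (- (c * \<bar>1 / x * z\<bar> powr \<alpha>)) \<le> c * x powr - \<alpha> * (1 + z\<^sup>2)" .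
  qed
  also have "\<dots> = 2 * c * x powr - \<alpha>" using std_normal_second_moment by simp
  finally show ?thesis by simp
qed

text \<open>The Gaussian identity bounds the mass of the ball of radius \<open>A\<close> by a function of \<open>q = c * A powr - \<alpha>\<close>
alone, which vanishes as \<open>q\<close> grows, since \<open>exp (- (q * \<bar>z\<bar> powr \<alpha>))\<close> tends to 0 for almost all \<open>z\<close>.\<close>

lemma stable_law_small_ball:
  fixes \<alpha> \<eta> :: real
  assumes \<alpha>: "0 < \<alpha>" and \<eta>: "0 < \<eta>"
  shows "\<exists>q. \<forall>c A \<mu>. stable_law \<alpha> c \<mu> \<longrightarrow> 0 < A \<longrightarrow> q \<le> c * A powr - \<alpha> \<longrightarrow>
    measure \<mu> {y. \<bar>y\<bar> \<le> A} \<le> \<eta>"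
proof -
  interpret N: real_distribution std_normal_distribution by (rule real_dist_normal_dist)
  have "((\<lambda>q. \<integral>z. exp (- (q * \<bar>z\<bar> powr \<alpha>)) \<partial>std_normal_distribution)
    \<longlongrightarrow> (\<integral>z. 0 \<partial>std_normal_distribution)) at_top"
  proof (rule integral_dominated_convergence_at_top[where w = "\<lambda>_. 1"])
    have "AE z in std_normal_distribution. z \<noteq> 0"
      by (subst AE_density) (auto intro: AE_lborel_singleton AE_mp)
    then show "AE z in std_normal_distribution. ((\<lambda>q. exp (- (q * \<bar>z\<bar> powr \<alpha>))) \<longlongrightarrow> 0) at_top"
    proof eventually_elim
      case (elim z)
      then have p: "\<bar>z\<bar> powr \<alpha> > 0" by simp
      show ?case
        by (intro filterlim_compose[OF exp_at_bot] filterlim_compose[OF filterlim_uminus_at_bot_at_top]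
          filterlim_at_top_mult_tendsto_pos[OF tendsto_const p] filterlim_ident)
    qed
    show "\<forall>\<^sub>F q in at_top. AE z in std_normal_distribution. norm (exp (- (q * \<bar>z\<bar> powr \<alpha>))) \<le> 1"
      using eventually_ge_at_top[of 0] by eventually_elim auto
  qed auto
  from order_tendstoD(2)[OF this, of "\<eta> / 2"] \<eta> obtain q0 where
    q0: "\<And>q. q \<ge> q0 \<Longrightarrow> (\<integral>z. exp (- (q * \<bar>z\<bar> powr \<alpha>)) \<partial>std_normal_distribution) < \<eta> / 2"
    by (auto simp: eventually_at_top_linorder)
  show ?thesis
  proof (intro exI[of _ q0] allI impI)
    fix c A :: real and \<mu> assume \<mu>: "stable_law \<alpha> c \<mu>" and A: "0 < A" and q: "q0 \<le> c * A powr - \<alpha>"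
    interpret \<mu>: real_distribution \<mu> using \<mu> by (simp add: stable_law_def)
    have int1: "integrable \<mu> (\<lambda>y. exp (- ((1 / A * y)\<^sup>2) / 2))"
      by (rule \<mu>.integrable_const_bound[of _ 1]) auto
    have *: "1 / 2 \<le> exp (- ((1 / A * y)\<^sup>2) / 2)" if "\<bar>y\<bar> \<le> A" for y
    proof -
      have "(1 / A * y)\<^sup>2 \<le> 1"
        using that A abs_le_square_iff[of y A] by (simp add: power_divide)
      then have "1 / 2 \<le> 1 + (- ((1 / A * y)\<^sup>2) / 2)" by simp
      also have "\<dots> \<le> exp (- ((1 / A * y)\<^sup>2) / 2)" by (rule exp_ge_add_one_self)
      finally show ?thesis .
    qed
    have int0: "integrable \<mu> (\<lambda>y. (1 / 2 :: real) * indicator {y. \<bar>y\<bar> \<le> A} y)"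
      by (rule \<mu>.integrable_const_bound[of _ 1]) (auto simp: indicator_def)
    have "1 / 2 * measure \<mu> {y. \<bar>y\<bar> \<le> A} = (\<integral>y. 1 / 2 * indicator {y. \<bar>y\<bar> \<le> A} y \<partial>\<mu>)"
      by simp
    also have "\<dots> \<le> (\<integral>y. exp (- ((1 / A * y)\<^sup>2) / 2) \<partial>\<mu>)"
      by (rule integral_mono[OF int0]) (use * int1 in \<open>auto simp: indicator_def\<close>)
    also have "\<dots> = (\<integral>z. exp (- (c * \<bar>1 / A * z\<bar> powr \<alpha>)) \<partial>std_normal_distribution)"
      by (rule stable_law_gaussian_identity[OF \<mu>])
    also have "(\<lambda>z. c * \<bar>1 / A * z\<bar> powr \<alpha>) = (\<lambda>z. c * A powr - \<alpha> * \<bar>z\<bar> powr \<alpha>)"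
      using A by (auto simp: abs_mult powr_divide powr_minus field_simps)
    finally show "measure \<mu> {y. \<bar>y\<bar> \<le> A} \<le> \<eta>" using q0[OF q] by simp
  qed
qed

lemma stable_law_symmetric:
  assumes \<mu>: "stable_law \<alpha> c \<mu>"
  shows "measure \<mu> {y. y < - A} = measure \<mu> {y. A < y}"
proof -
  interpret \<mu>: real_distribution \<mu> using assms by (simp add: stable_law_def)
  have rd: "real_distribution (distr \<mu> borel uminus)" by (rule \<mu>.real_distribution_distr) simp
  have ch: "char \<mu> u = of_real (exp (- (c * \<bar>u\<bar> powr \<alpha>)))" for u
    using assms by (simp add: stable_law_def)
  have "char (distr \<mu> borel uminus) u = char \<mu> u" for u
  proof -
    have "char (distr \<mu> borel uminus) u = char \<mu> (- u)"
      by (simp add: char_def integral_distr)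
    then show ?thesis by (simp add: ch)
  qed
  then have eq: "distr \<mu> borel uminus = \<mu>"
    using Levy_uniqueness[OF rd \<mu>.real_distribution_axioms] by blast
  have "measure \<mu> {y. A < y} = measure (distr \<mu> borel uminus) {y. A < y}" by (simp add: eq)
  also have "\<dots> = measure \<mu> {y. y < - A}"
    by (subst measure_distr) (auto intro!: arg_cong[where f = "measure \<mu>"])
  finally show ?thesis by simp
qed

text \<open>If at most half of the mass lies in \<open>[-A, A]\<close>, symmetry puts at least a quarter of it above \<open>A\<close>.\<close>

lemma stable_law_upper_tail:
  fixes \<alpha> :: real
  assumes \<alpha>: "0 < \<alpha>"
  obtains q where "\<And>c A \<mu>. stable_law \<alpha> c \<mu> \<Longrightarrow> 0 < A \<Longrightarrow> q \<le> c * A powr - \<alpha> \<Longrightarrow>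
    measure \<mu> {y. y \<le> A} \<le> 3 / 4"
proof -
  obtain q where q: "\<And>c A \<mu>. stable_law \<alpha> c \<mu> \<Longrightarrow> 0 < A \<Longrightarrow> q \<le> c * A powr - \<alpha> \<Longrightarrow>
    measure \<mu> {y. \<bar>y\<bar> \<le> A} \<le> 1 / 2"
    using stable_law_small_ball[OF \<alpha>, of "1/2"] by auto
  have "measure \<mu> {y. y \<le> A} \<le> 3 / 4" if *: "stable_law \<alpha> c \<mu>" "0 < A" "q \<le> c * A powr - \<alpha>" for c A \<mu>
  proof -
    interpret \<mu>: real_distribution \<mu> using * by (simp add: stable_law_def)
    have "measure \<mu> {y. y \<le> A} = measure \<mu> {y. \<bar>y\<bar> \<le> A} + measure \<mu> {y. y < - A}"
      using *(2) by (subst \<mu>.finite_measure_Union[symmetric]) (auto intro!: arg_cong[where f = "measure \<mu>"])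
    moreover have "measure \<mu> {y. y \<le> A} = 1 - measure \<mu> {y. A < y}"
    proof -
      have "measure \<mu> {y. y \<le> A} = measure \<mu> (space \<mu> - {y. A < y})"
        by (auto intro!: arg_cong[where f = "measure \<mu>"])
      then show ?thesis using \<mu>.prob_compl[of "{y. A < y}"] by simp
    qed
    ultimately show ?thesis using stable_law_symmetric[OF *(1), of A] q[OF *] by linarith
  qed
  then show ?thesis by (rule that)
qed

section \<open>Symmetric stable noise\<close>

text \<open>Only the law of the increments is prescribed, through the index \<open>\<alpha>\<close> and the intensity \<open>\<sigma>\<close>. This form
is preserved by the rescalings of \<open>stable_noise_rescale\<close>.\<close>

locale stable_noise = filtered_prob_space M F for M :: "'a measure" and F +
  fixes L :: "real \<Rightarrow> 'a \<Rightarrow> real" and \<alpha> \<sigma> :: real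
  assumes adapted: "0 \<le> t \<Longrightarrow> L t \<in> borel_measurable (F t)"
    and start: "AE \<omega> in M. L 0 \<omega> = 0"
    and cadlag: "AE \<omega> in M. cadlag_on {0..} (\<lambda>t. L t \<omega>)"
    and indep_increments: "0 \<le> s \<Longrightarrow> s \<le> t \<Longrightarrow>
      indep_set (sets (F s)) (sets (vimage_algebra (space M) (\<lambda>\<omega>. L t \<omega> - L s \<omega>) borel))"
    and increment_law: "0 \<le> s \<Longrightarrow> s \<le> t \<Longrightarrow>
      stable_law \<alpha> (\<sigma> * (t - s)) (distr M borel (\<lambda>\<omega>. L t \<omega> - L s \<omega>))"
    and index: "0 < \<alpha>" "\<alpha> \<le> 2"
    and intensity: "0 < \<sigma>"
begin

lemma adapted_later: "0 \<le> s \<Longrightarrow> s \<le> t \<Longrightarrow> L s \<in> borel_measurable (F t)"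
  using measurable_from_subalg[OF F_mono adapted] by simp

lemma measurable_L: "0 \<le> t \<Longrightarrow> L t \<in> borel_measurable M"
  using measurable_from_subalg[OF F_subalgebra adapted] .

lemma space_F: "0 \<le> t \<Longrightarrow> space (F t) = space M"
  using F_subalgebra by (simp add: subalgebra_def)

lemma sets_F: "0 \<le> t \<Longrightarrow> A \<in> sets (F t) \<Longrightarrow> A \<in> sets M"
  using F_subalgebra by (auto simp: subalgebra_def)

lemma increment_tail:
  assumes "0 \<le> s" "s \<le> t" "0 < x"
  shows "prob {\<omega> \<in> space M. x \<le> \<bar>L t \<omega> - L s \<omega>\<bar>} \<le> 6 * \<sigma> * (t - s) * x powr - \<alpha>"
proof -
  have [measurable]: "L t \<in> borel_measurable M" "L s \<in> borel_measurable M"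
    using assms by (auto intro: measurable_L)
  have "measure (distr M borel (\<lambda>\<omega>. L t \<omega> - L s \<omega>)) {y. x \<le> \<bar>y\<bar>} = prob {\<omega> \<in> space M. x \<le> \<bar>L t \<omega> - L s \<omega>\<bar>}"
    by (subst measure_distr) (auto intro!: arg_cong[where f = prob])
  then show ?thesis
    using stable_law_tail[OF increment_law[OF assms(1,2)] index _ assms(3)] intensity assms by simp
qed

lemma past_indep_increment:
  assumes "0 \<le> s" "s \<le> t" "A \<in> sets (F s)" "B \<in> sets borel"
  shows "prob (A \<inter> {\<omega> \<in> space M. L t \<omega> - L s \<omega> \<in> B}) = prob A * prob {\<omega> \<in> space M. L t \<omega> - L s \<omega> \<in> B}"
proof -
  have "(\<lambda>\<omega>. L t \<omega> - L s \<omega>) -` B \<inter> space M \<in> sets (vimage_algebra (space M) (\<lambda>\<omega>. L t \<omega> - L s \<omega>) borel)"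
    by (rule in_vimage_algebra[OF assms(4)])
  moreover have "(\<lambda>\<omega>. L t \<omega> - L s \<omega>) -` B \<inter> space M = {\<omega> \<in> space M. L t \<omega> - L s \<omega> \<in> B}" by auto
  ultimately show ?thesis using indep_setD[OF indep_increments[OF assms(1,2)] assms(3)] by simp
qed

text \<open>Ottaviani's argument: at the first time when the displacement exceeds \<open>2 * x\<close> the remaining increment is
independent of the past and, with probability at least \<open>1 - q\<close>, smaller than \<open>x\<close>, so that the final
displacement exceeds \<open>x\<close>. If \<open>q\<close> is at least \<open>1 / 2\<close>, the bound is at least 1.\<close>

lemma maximal_inequality_grid:
  fixes t :: "nat \<Rightarrow> real"
  assumes t: "mono t" "0 \<le> t 0" and x: "0 < x"
  shows "prob {\<omega> \<in> space M. \<exists>j\<le>m. 2 * x < \<bar>L (t j) \<omega> - L (t 0) \<omega>\<bar>} \<le> 12 * \<sigma> * (t m - t 0) * x powr - \<alpha>"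
proof -
  define q where "q = 6 * \<sigma> * (t m - t 0) * x powr - \<alpha>"
  (* The events A j that the threshold is first exceeded at step j are disjoint. *)
  define A where "A j = {\<omega> \<in> space M. (\<forall>i<j. \<bar>L (t i) \<omega> - L (t 0) \<omega>\<bar> \<le> 2 * x) \<and> 2 * x < \<bar>L (t j) \<omega> - L (t 0) \<omega>\<bar>}" for j
  define B where "B j = {\<omega> \<in> space M. L (t m) \<omega> - L (t j) \<omega> \<in> {-x<..<x}}" for j
  have t0: "0 \<le> t j" for j using t monoD[OF t(1), of 0 j] by simp
  have [measurable]: "L (t j) \<in> borel_measurable M" for j by (rule measurable_L[OF t0])
  have A: "A j \<in> sets (F (t j))" for j
  proof -
    have m: "L (t i) \<in> borel_measurable (F (t j))" if "i \<le> j" for i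
      using t0 monoD[OF t(1) that] by (rule adapted_later)
    have [measurable]: "L (t 0) \<in> borel_measurable (F (t j))" "L (t j) \<in> borel_measurable (F (t j))"
      by (auto intro: m)
    have "{\<omega> \<in> space (F (t j)). \<bar>L (t i) \<omega> - L (t 0) \<omega>\<bar> \<le> 2 * x} \<in> sets (F (t j))" if "i < j" for i
    proof -
      have [measurable]: "L (t i) \<in> borel_measurable (F (t j))" using that by (intro m) simp
      show ?thesis by measurable
    qed
    then have "{\<omega> \<in> space (F (t j)). (\<forall>i\<in>{..<j}. \<bar>L (t i) \<omega> - L (t 0) \<omega>\<bar> \<le> 2 * x)} \<in> sets (F (t j))"
      by (intro sets.sets_Collect_finite_All) auto
    moreover have "{\<omega> \<in> space (F (t j)). 2 * x < \<bar>L (t j) \<omega> - L (t 0) \<omega>\<bar>} \<in> sets (F (t j))"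
      by measurable
    ultimately have "{\<omega> \<in> space (F (t j)). (\<forall>i\<in>{..<j}. \<bar>L (t i) \<omega> - L (t 0) \<omega>\<bar> \<le> 2 * x) \<and> 2 * x < \<bar>L (t j) \<omega> - L (t 0) \<omega>\<bar>} \<in> sets (F (t j))"
      by (intro sets.sets_Collect_conj)
    then show ?thesis by (simp only: A_def space_F[OF t0] Ball_def lessThan_iff)
  qed
  have AM: "A j \<in> sets M" for j using sets_F[OF t0 A] .
  have disj: "disjoint_family_on A I" for I
  proof -
    have "A i \<inter> A j = {}" if "i < j" for i j
      unfolding A_def using that by fastforce
    then show ?thesis unfolding disjoint_family_on_def by (metis Int_commute linorder_neqE_nat)
  qed
  have E: "{\<omega> \<in> space M. \<exists>j\<le>m. 2 * x < \<bar>L (t j) \<omega> - L (t 0) \<omega>\<bar>} = (\<Union>j\<le>m. A j)"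
  proof (intro set_eqI iffI)
    fix \<omega> assume "\<omega> \<in> {\<omega> \<in> space M. \<exists>j\<le>m. 2 * x < \<bar>L (t j) \<omega> - L (t 0) \<omega>\<bar>}"
    then obtain j where j: "\<omega> \<in> space M" "j \<le> m" "2 * x < \<bar>L (t j) \<omega> - L (t 0) \<omega>\<bar>" by auto
    define k where "k = (LEAST j. 2 * x < \<bar>L (t j) \<omega> - L (t 0) \<omega>\<bar>)"
    have "2 * x < \<bar>L (t k) \<omega> - L (t 0) \<omega>\<bar>" unfolding k_def using j(3) by (rule LeastI)
    moreover have "k \<le> j" unfolding k_def using j(3) by (rule Least_le)
    moreover have "\<bar>L (t i) \<omega> - L (t 0) \<omega>\<bar> \<le> 2 * x" if "i < k" for i
      using not_less_Least[OF that[unfolded k_def]] by simp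
    ultimately show "\<omega> \<in> (\<Union>j\<le>m. A j)" using j by (auto simp: A_def intro!: bexI[of _ k])
  qed (auto simp: A_def)
  show ?thesis
  proof (cases "q < 1 / 2")
    case False
    have "prob {\<omega> \<in> space M. \<exists>j\<le>m. 2 * x < \<bar>L (t j) \<omega> - L (t 0) \<omega>\<bar>} \<le> 1" by simp
    also have "1 \<le> 2 * q" using False by simp
    finally show ?thesis by (simp add: q_def)
  next
    case True
    have PB: "1 - q \<le> prob (B j)" if j: "j \<le> m" for j
    proof -
      have "B j = space M - {\<omega> \<in> space M. x \<le> \<bar>L (t m) \<omega> - L (t j) \<omega>\<bar>}" by (auto simp: B_def)
      then have "prob (B j) = 1 - prob {\<omega> \<in> space M. x \<le> \<bar>L (t m) \<omega> - L (t j) \<omega>\<bar>}"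
        using prob_compl[of "{\<omega> \<in> space M. x \<le> \<bar>L (t m) \<omega> - L (t j) \<omega>\<bar>}"] by simp
      moreover have "prob {\<omega> \<in> space M. x \<le> \<bar>L (t m) \<omega> - L (t j) \<omega>\<bar>} \<le> 6 * \<sigma> * (t m - t j) * x powr - \<alpha>"
        using t0 monoD[OF t(1) j] x by (rule increment_tail)
      moreover have "\<dots> \<le> q"
        unfolding q_def using intensity monoD[OF t(1), of 0 j] by (intro mult_right_mono mult_left_mono) auto
      ultimately show ?thesis by linarith
    qed
    have "(1 - q) * prob (\<Union>j\<le>m. A j) = (\<Sum>j\<le>m. (1 - q) * prob (A j))"
      using finite_measure_finite_Union[OF finite_atMost image_subsetI disj, of m] AM
      by (simp add: sum_distrib_left)
    also have "\<dots> \<le> (\<Sum>j\<le>m. prob (A j) * prob (B j))"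
    proof (rule sum_mono)
      fix j assume "j \<in> {..m}"
      then show "(1 - q) * prob (A j) \<le> prob (A j) * prob (B j)"
        using mult_left_mono[OF PB, of j "prob (A j)"] by (simp add: mult.commute)
    qed
    also have "\<dots> = (\<Sum>j\<le>m. prob (A j \<inter> B j))"
      unfolding B_def using monoD[OF t(1)] A by (intro sum.cong past_indep_increment[symmetric] t0) auto
    also have "\<dots> = prob (\<Union>j\<le>m. A j \<inter> B j)"
    proof (rule finite_measure_finite_Union[symmetric])
      show "disjoint_family_on (\<lambda>j. A j \<inter> B j) {..m}"
        using disj[of "{..m}"] by (fastforce simp: disjoint_family_on_def)
      have "B j \<in> sets M" for j unfolding B_def by measurable
      then show "(\<lambda>j. A j \<inter> B j) ` {..m} \<subseteq> events" using AM by auto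
    qed auto
    also have "\<dots> \<le> prob {\<omega> \<in> space M. x \<le> \<bar>L (t m) \<omega> - L (t 0) \<omega>\<bar>}"
      by (rule finite_measure_mono) (auto simp: A_def B_def)
    also have "\<dots> \<le> q"
      unfolding q_def using monoD[OF t(1), of 0 m] by (intro increment_tail t x) auto
    finally have "(1 - q) * prob (\<Union>j\<le>m. A j) \<le> q" .
    moreover have "1 / 2 * prob (\<Union>j\<le>m. A j) \<le> (1 - q) * prob (\<Union>j\<le>m. A j)"
      using True by (intro mult_right_mono) auto
    ultimately show ?thesis unfolding E q_def by simp
  qed
qed

text \<open>By right continuity the supremum over the interval is the one over dyadic times, to which the grid
inequality applies with a bound that does not depend on the mesh.\<close>

lemma maximal_inequality:
  assumes s: "0 \<le> s" and h: "0 \<le> h" and x: "0 < x"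
  shows "likely M (12 * \<sigma> * h * x powr - \<alpha>) (\<lambda>\<omega>. \<forall>t\<in>{s..s + h}. \<bar>L t \<omega> - L s \<omega>\<bar> \<le> 2 * x)"
proof -
  define g where "g k j = s + h * (real j / 2 ^ k)" for k j :: nat
  define E where "E k = {\<omega> \<in> space M. \<exists>j\<le>2 ^ k. 2 * x < \<bar>L (g k j) \<omega> - L s \<omega>\<bar>}" for k
  have g0: "0 \<le> g k j" for k j using s h by (simp add: g_def)
  have [measurable]: "L (g k j) \<in> borel_measurable M" for k j by (rule measurable_L[OF g0])
  have [measurable]: "L s \<in> borel_measurable M" by (rule measurable_L[OF s])
  have EM: "E k \<in> sets M" for k unfolding E_def by measurable
  have PE: "prob (E k) \<le> 12 * \<sigma> * h * x powr - \<alpha>" for k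
  proof -
    have "mono (g k)" unfolding g_def using h
      by (intro monoI add_left_mono mult_left_mono divide_right_mono) auto
    from maximal_inequality_grid[OF this g0 x, of "2 ^ k"] show ?thesis
      by (simp add: E_def g_def)
  qed
  have "incseq E"
  proof (rule incseq_SucI, rule subsetI)
    fix k \<omega> assume "\<omega> \<in> E k"
    then obtain j where j: "\<omega> \<in> space M" "j \<le> 2 ^ k" "2 * x < \<bar>L (g k j) \<omega> - L s \<omega>\<bar>"
      by (auto simp: E_def)
    have "g k j = g (Suc k) (2 * j)" by (simp add: g_def)
    with j show "\<omega> \<in> E (Suc k)" by (auto simp: E_def intro!: exI[of _ "2 * j"])
  qed
  then have "(\<lambda>k. prob (E k)) \<longlonglongrightarrow> prob (\<Union>k. E k)"
    using EM by (intro finite_Lim_measure_incseq) auto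
  then have "prob (\<Union>k. E k) \<le> 12 * \<sigma> * h * x powr - \<alpha>"
    using PE by (intro LIMSEQ_le_const2) auto
  then have "likely M (12 * \<sigma> * h * x powr - \<alpha>) (\<lambda>\<omega>. \<forall>k j. j \<le> 2 ^ k \<longrightarrow> \<bar>L (g k j) \<omega> - L s \<omega>\<bar> \<le> 2 * x)"
    using EM by (intro likelyI[of "\<Union>k. E k"]) (auto simp: E_def not_less)
  from likely_conj[OF this likely_of_AE[OF cadlag]]
  show ?thesis
  proof (rule likely_mono)
    fix \<omega>
    assume "(\<forall>k j. j \<le> 2 ^ k \<longrightarrow> \<bar>L (g k j) \<omega> - L s \<omega>\<bar> \<le> 2 * x) \<and> cadlag_on {0..} (\<lambda>t. L t \<omega>)"
    then have grid: "\<And>k j. j \<le> 2 ^ k \<Longrightarrow> \<bar>L (g k j) \<omega> - L s \<omega>\<bar> \<le> 2 * x"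
      and cad: "cadlag_on {0..} (\<lambda>t. L t \<omega>)" by auto
    show "\<forall>t\<in>{s..s + h}. \<bar>L t \<omega> - L s \<omega>\<bar> \<le> 2 * x"
    proof
      fix t assume t: "t \<in> {s..s + h}"
      show "\<bar>L t \<omega> - L s \<omega>\<bar> \<le> 2 * x"
      proof (cases "t = s + h")
        case True
        then show ?thesis using grid[of 1 0] by (simp add: g_def)
      next
        case False
        with t have th: "t < s + h" "s \<le> t" by auto
        then have h0: "0 < h" by simp
        have "((\<lambda>t. L t \<omega>) \<longlongrightarrow> L t \<omega>) (at t within {0..} \<inter> {t<..})"
          using cad s th by (auto simp: cadlag_on_def)
        then have lim: "((\<lambda>u. \<bar>L u \<omega> - L s \<omega>\<bar>) \<longlongrightarrow> \<bar>L t \<omega> - L s \<omega>\<bar>) (at t within {0..} \<inter> {t<..})"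
          by (intro tendsto_intros)
        show ?thesis
        proof (rule ccontr)
          assume "\<not> ?thesis"
          then have "2 * x < \<bar>L t \<omega> - L s \<omega>\<bar>" by simp
          from order_tendstoD(1)[OF lim this] obtain d where d: "d > 0"
            "\<And>u. 0 \<le> u \<Longrightarrow> t < u \<Longrightarrow> dist u t < d \<Longrightarrow> 2 * x < \<bar>L u \<omega> - L s \<omega>\<bar>"
            by (auto simp: eventually_at)
          obtain k where k: "(1 / 2) ^ k < d / h"
            using real_arch_pow_inv[of "d / h" "1 / 2"] d h0 by auto
          then have k': "h / 2 ^ k < d" using h0 by (simp add: power_divide field_simps)
          define r where "r = (t - s) / h * 2 ^ k"
          have "(t - s) / h < 1" using th h0 by (simp add: field_simps)
          then have r: "0 \<le> r" "r < 2 ^ k"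
            using th h0 mult_strict_right_mono[of "(t - s) / h" 1 "2 ^ k"] by (auto simp: r_def)
          define j where "j = Suc (nat \<lfloor>r\<rfloor>)"
          have j: "r < real j" "real j \<le> r + 1" using r by (auto simp: j_def) linarith+
          have "\<lfloor>r\<rfloor> < 2 ^ k" using r by (simp add: floor_less_iff)
          then have j2: "j \<le> 2 ^ k" unfolding j_def using r
            by (metis Suc_leI nat_less_iff of_nat_numeral of_nat_power zero_le_floor)
          have tr: "t = s + h * (r / 2 ^ k)" using h0 by (simp add: r_def)
          have "t < g k j" unfolding g_def tr using h0 j
            by (intro add_strict_left_mono mult_strict_left_mono divide_strict_right_mono) auto
          moreover have "g k j \<le> t + h / 2 ^ k"
          proof -
            have "g k j \<le> s + h * ((r + 1) / 2 ^ k)" unfolding g_def using h0 j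
              by (intro add_left_mono mult_left_mono divide_right_mono) auto
            also have "\<dots> = t + h / 2 ^ k" unfolding tr by (simp add: field_simps)
            finally show ?thesis .
          qed
          ultimately have "2 * x < \<bar>L (g k j) \<omega> - L s \<omega>\<bar>"
            using k' g0 by (intro d(2)) (auto simp: dist_real_def)
          then show False using grid[OF j2] by simp
        qed
      qed
    qed
  qed auto
qed

text \<open>The constant \<open>R / 2\<close> covers the times up to \<open>H\<close>, and the power covers each of the later blocks from
\<open>H * 2 ^ k\<close> to \<open>H * 2 ^ Suc k\<close>. The failure probabilities of the blocks form a geometric series with ratio
\<open>2 powr (1 - \<alpha> * \<gamma>)\<close>.\<close>

lemma likely_above_power_curve:
  assumes s: "0 \<le> s" and H: "0 < H" and R: "0 < R" and \<kappa>: "0 < \<kappa>" and \<gamma>: "1 < \<alpha> * \<gamma>"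
  shows "likely M (12 * \<sigma> * H * (R / 4) powr - \<alpha>
      + 24 * \<sigma> * (\<kappa> / 2) powr - \<alpha> / (1 - 2 powr (1 - \<alpha> * \<gamma>)) * H powr (1 - \<alpha> * \<gamma>))
    (\<lambda>\<omega>. \<forall>t\<ge>s. - R / 2 - \<kappa> * (t - s) powr \<gamma> \<le> L t \<omega> - L s \<omega>)"
proof -
  have \<gamma>0: "0 < \<gamma>" using \<gamma> index by (metis less_trans mult_pos_pos zero_less_mult_pos zero_less_one)
  define x where "x k = \<kappa> * (H * 2 ^ k) powr \<gamma> / 2" for k :: nat
  have x0: "0 < x k" for k using \<kappa> H by (simp add: x_def)
  define a where "a k = 12 * \<sigma> * (H * 2 ^ Suc k) * x k powr - \<alpha>" for k :: nat
  define \<rho> where "\<rho> = 2 powr (1 - \<alpha> * \<gamma>)"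
  have \<rho>: "0 < \<rho>" "\<rho> < 1" using \<gamma> powr_less_mono[of "1 - \<alpha> * \<gamma>" 0 2] by (auto simp: \<rho>_def)
  define c where "c = 24 * \<sigma> * (\<kappa> / 2) powr - \<alpha> * H powr (1 - \<alpha> * \<gamma>)"
  have a: "a k = c * \<rho> ^ k" for k
  proof -
    have "x k powr - \<alpha> = (\<kappa> / 2) powr - \<alpha> * (H * 2 ^ k) powr (- (\<alpha> * \<gamma>))"
      using \<kappa> H by (simp add: x_def powr_mult powr_powr mult.commute[of \<gamma> \<alpha>] flip: times_divide_eq_left)
    moreover have "H * 2 ^ Suc k = 2 * (H * 2 ^ k) powr 1" using H by simp
    ultimately have "a k = 24 * \<sigma> * (\<kappa> / 2) powr - \<alpha> * ((H * 2 ^ k) powr 1 * (H * 2 ^ k) powr (- (\<alpha> * \<gamma>)))"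
      by (simp add: a_def)
    also have "(H * 2 ^ k) powr 1 * (H * 2 ^ k) powr (- (\<alpha> * \<gamma>)) = (H * 2 ^ k) powr (1 - \<alpha> * \<gamma>)"
      by (metis powr_add add_uminus_conv_diff)
    also have "\<dots> = H powr (1 - \<alpha> * \<gamma>) * \<rho> ^ k"
      using H by (simp add: powr_mult \<rho>_def powr_power powr_realpow[symmetric] powr_powr mult.commute)
    finally show ?thesis by (simp add: c_def)
  qed
  have "(\<lambda>k. c * \<rho> ^ k) sums (c * (1 / (1 - \<rho>)))"
    using \<rho> by (intro sums_mult geometric_sums) auto
  moreover have "a = (\<lambda>k. c * \<rho> ^ k)" using a by blast
  ultimately have sums: "a sums (c * (1 / (1 - \<rho>)))" by simp
  have "likely M (12 * \<sigma> * H * (R / 4) powr - \<alpha>) (\<lambda>\<omega>. \<forall>t\<in>{s..s + H}. \<bar>L t \<omega> - L s \<omega>\<bar> \<le> 2 * (R / 4))"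
    using s H R by (intro maximal_inequality) auto
  moreover have "likely M (suminf a) (\<lambda>\<omega>. \<forall>k. \<forall>t\<in>{s..s + H * 2 ^ Suc k}. \<bar>L t \<omega> - L s \<omega>\<bar> \<le> 2 * x k)"
  proof (rule likely_countable)
    show "summable a" using sums by (rule sums_summable)
    show "likely M (a k) (\<lambda>\<omega>. \<forall>t\<in>{s..s + H * 2 ^ Suc k}. \<bar>L t \<omega> - L s \<omega>\<bar> \<le> 2 * x k)" for k
      unfolding a_def using s H x0 by (intro maximal_inequality) auto
  qed
  ultimately have "likely M (12 * \<sigma> * H * (R / 4) powr - \<alpha> + suminf a)
    (\<lambda>\<omega>. (\<forall>t\<in>{s..s + H}. \<bar>L t \<omega> - L s \<omega>\<bar> \<le> 2 * (R / 4)) \<and>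
      (\<forall>k. \<forall>t\<in>{s..s + H * 2 ^ Suc k}. \<bar>L t \<omega> - L s \<omega>\<bar> \<le> 2 * x k))"
    by (rule likely_conj)
  then show ?thesis
  proof (rule likely_mono)
    have "suminf a = c * (1 / (1 - \<rho>))" using sums by (rule sums_unique[symmetric])
    then show "12 * \<sigma> * H * (R / 4) powr - \<alpha> + suminf a \<le> 12 * \<sigma> * H * (R / 4) powr - \<alpha>
      + 24 * \<sigma> * (\<kappa> / 2) powr - \<alpha> / (1 - 2 powr (1 - \<alpha> * \<gamma>)) * H powr (1 - \<alpha> * \<gamma>)"
      by (simp add: c_def \<rho>_def)
    fix \<omega> assume *: "(\<forall>t\<in>{s..s + H}. \<bar>L t \<omega> - L s \<omega>\<bar> \<le> 2 * (R / 4)) \<and>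
      (\<forall>k. \<forall>t\<in>{s..s + H * 2 ^ Suc k}. \<bar>L t \<omega> - L s \<omega>\<bar> \<le> 2 * x k)"
    show "\<forall>t\<ge>s. - R / 2 - \<kappa> * (t - s) powr \<gamma> \<le> L t \<omega> - L s \<omega>"
    proof (intro allI impI)
      fix t assume t: "s \<le> t"
      show "- R / 2 - \<kappa> * (t - s) powr \<gamma> \<le> L t \<omega> - L s \<omega>"
      proof (cases "t \<le> s + H")
        case True
        then have "\<bar>L t \<omega> - L s \<omega>\<bar> \<le> 2 * (R / 4)" using * t by auto
        moreover have "0 \<le> \<kappa> * (t - s) powr \<gamma>" using \<kappa> by simp
        ultimately show ?thesis by linarith
      next
        case False
        have ex: "\<exists>k. t - s \<le> H * 2 ^ Suc k"
        proof -
          obtain n where "(t - s) / H < 2 ^ n" using real_arch_pow[of 2] by auto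
          also have "(2 :: real) ^ n \<le> 2 ^ Suc n" by simp
          finally show ?thesis using H by (intro exI[of _ n]) (simp add: field_simps)
        qed
        define k where "k = (LEAST k. t - s \<le> H * 2 ^ Suc k)"
        have k: "t - s \<le> H * 2 ^ Suc k" unfolding k_def by (rule LeastI_ex[OF ex])
        have k2: "H * 2 ^ k \<le> t - s"
        proof (cases k)
          case 0 then show ?thesis using False by simp
        next
          case (Suc j)
          then show ?thesis using not_less_Least[of j "\<lambda>k. t - s \<le> H * 2 ^ Suc k"] by (simp add: k_def)
        qed
        have "\<bar>L t \<omega> - L s \<omega>\<bar> \<le> 2 * x k" using * k t by auto
        moreover have "2 * x k \<le> \<kappa> * (t - s) powr \<gamma>"
          using k2 \<kappa> H \<gamma>0 by (auto simp: x_def intro!: mult_left_mono powr_mono2)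
        ultimately show ?thesis using R by linarith
      qed
    qed
  qed
qed

end

text \<open>First \<open>H\<close> is chosen to make the contribution of the late blocks small, then \<open>R\<close> for the early times. The
choice depends on the process only through \<open>\<alpha>\<close> and \<open>\<sigma>\<close>, so that it is the same for all rescaled copies
of the noise.\<close>

lemma noise_above_power_curve:
  fixes \<alpha> \<sigma> \<gamma> \<kappa> \<eta> :: real
  assumes \<gamma>: "1 < \<alpha> * \<gamma>" and \<kappa>: "0 < \<kappa>" and \<eta>: "0 < \<eta>" and \<alpha>: "0 < \<alpha>"
  obtains R where "0 < R"
    and "\<And>(M :: 'a measure) F L s. stable_noise M F L \<alpha> \<sigma> \<Longrightarrow> 0 \<le> s \<Longrightarrow>
      likely M \<eta> (\<lambda>\<omega>. \<forall>t\<ge>s. - R / 2 - \<kappa> * (t - s) powr \<gamma> \<le> L t \<omega> - L s \<omega>)"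
proof -
  define c where "c = 24 * \<sigma> * (\<kappa> / 2) powr - \<alpha> / (1 - 2 powr (1 - \<alpha> * \<gamma>))"
  have "((\<lambda>H. c * H powr (1 - \<alpha> * \<gamma>)) \<longlongrightarrow> c * 0) at_top"
    using \<gamma> by (intro tendsto_intros tendsto_neg_powr filterlim_ident) auto
  then have "\<forall>\<^sub>F H in at_top. c * H powr (1 - \<alpha> * \<gamma>) < \<eta> / 2"
    using \<eta> by (intro order_tendstoD(2)) auto
  from eventually_conj[OF this eventually_gt_at_top[of 0]] obtain H where H: "c * H powr (1 - \<alpha> * \<gamma>) < \<eta> / 2" "0 < H"
    by (auto simp: eventually_at_top_linorder)
  have "((\<lambda>R. 12 * \<sigma> * H * (R / 4) powr - \<alpha>) \<longlongrightarrow> 12 * \<sigma> * H * 0) at_top"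
    using \<alpha> by (intro tendsto_intros tendsto_neg_powr filterlim_tendsto_pos_mult_at_top[OF tendsto_const _ filterlim_ident, of "1/4", simplified]) auto
  then have "\<forall>\<^sub>F R in at_top. 12 * \<sigma> * H * (R / 4) powr - \<alpha> < \<eta> / 2"
    using \<eta> by (intro order_tendstoD(2)) auto
  from eventually_conj[OF this eventually_gt_at_top[of 0]] obtain R where R: "12 * \<sigma> * H * (R / 4) powr - \<alpha> < \<eta> / 2" "0 < R"
    by (auto simp: eventually_at_top_linorder)
  have "likely M \<eta> (\<lambda>\<omega>. \<forall>t\<ge>s. - R / 2 - \<kappa> * (t - s) powr \<gamma> \<le> L t \<omega> - L s \<omega>)"
    if "stable_noise M F L \<alpha> \<sigma>" "0 \<le> s" for M :: "'a measure" and F L s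
    by (rule likely_mono[OF stable_noise.likely_above_power_curve[OF that H(2) R(2) \<kappa> \<gamma>]])
      (use H R in \<open>auto simp: c_def\<close>)
  with R(2) show ?thesis by (rule that)
qed

lemma noise_bounded_with_high_probability:
  fixes \<alpha> \<sigma> h \<eta> :: real
  assumes h: "0 \<le> h" and \<eta>: "0 < \<eta>" and \<alpha>: "0 < \<alpha>"
  shows "\<exists>m>0. \<forall>(M :: 'a measure) F L. stable_noise M F L \<alpha> \<sigma> \<longrightarrow>
    likely M \<eta> (\<lambda>\<omega>. \<forall>t\<in>{0..h}. \<bar>L t \<omega> - L 0 \<omega>\<bar> \<le> m)"
proof -
  have "((\<lambda>x. 12 * \<sigma> * h * x powr - \<alpha>) \<longlongrightarrow> 12 * \<sigma> * h * 0) at_top"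
    using \<alpha> by (intro tendsto_intros tendsto_neg_powr filterlim_ident) auto
  then have "\<forall>\<^sub>F x in at_top. 12 * \<sigma> * h * x powr - \<alpha> < \<eta>"
    using \<eta> by (intro order_tendstoD(2)) auto
  from eventually_conj[OF this eventually_gt_at_top[of 0]] obtain x where x: "12 * \<sigma> * h * x powr - \<alpha> < \<eta>" "0 < x"
    by (auto simp: eventually_at_top_linorder)
  have "likely M \<eta> (\<lambda>\<omega>. \<forall>t\<in>{0..h}. \<bar>L t \<omega> - L 0 \<omega>\<bar> \<le> 2 * x)"
    if "stable_noise M F L \<alpha> \<sigma>" for M :: "'a measure" and F L
  proof (rule likely_mono)
    show "likely M (12 * \<sigma> * h * x powr - \<alpha>) (\<lambda>\<omega>. \<forall>t\<in>{0..0 + h}. \<bar>L t \<omega> - L 0 \<omega>\<bar> \<le> 2 * x)"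
      by (rule stable_noise.maximal_inequality[OF that order_refl h x(2)])
  qed (use x(1) in auto)
  then show ?thesis using x(2) by (intro exI[of _ "2 * x"]) simp
qed

text \<open>Take rapidly growing times. Each new increment dwarfs the position reached before and, by symmetry, lifts
the process above \<open>A\<close> with probability at least \<open>1 / 4\<close> independently of the past; \<open>n\<close> failures in a row
have probability at most \<open>(3 / 4) ^ n + \<eta> / 2\<close>. The number of times is fixed before the level \<open>A\<close>:
the level will be chosen to make the behaviour after every one of these times good, with a failure
probability that must beat \<open>n\<close>.\<close>

lemma noise_eventually_high:
  fixes \<alpha> \<sigma> \<eta> :: real
  assumes \<alpha>: "0 < \<alpha>" and \<eta>: "0 < \<eta>" and \<sigma>: "0 < \<sigma>"
  obtains n where "\<And>A. 0 < A \<Longrightarrow> \<exists>\<Theta>. finite \<Theta> \<and> \<Theta> \<subseteq> {0<..} \<and> card \<Theta> \<le> n \<and>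
      (\<forall>(M :: 'a measure) F L. stable_noise M F L \<alpha> \<sigma> \<longrightarrow> likely M \<eta> (\<lambda>\<omega>. \<exists>s\<in>\<Theta>. A \<le> L s \<omega> - L 0 \<omega>))"
proof -
  obtain q where q: "\<And>c A \<mu>. stable_law \<alpha> c \<mu> \<Longrightarrow> 0 < A \<Longrightarrow> q \<le> c * A powr - \<alpha> \<Longrightarrow>
    measure \<mu> {y. y \<le> A} \<le> 3 / 4"
    using stable_law_upper_tail[OF \<alpha>] by blast
  have *: "\<exists>\<Theta>. finite \<Theta> \<and> \<Theta> \<subseteq> {0<..} \<and> card \<Theta> \<le> n \<and>
      (\<forall>(M :: 'a measure) F L. stable_noise M F L \<alpha> \<sigma> \<longrightarrow>
        measure M {\<omega> \<in> space M. \<forall>s\<in>\<Theta>. L s \<omega> - L 0 \<omega> < A} \<le> (3 / 4) ^ n + \<eta> / 2)"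
    if A: "0 < A" for A n
  proof (induction n)
    case 0
    have "measure M {\<omega> \<in> space M. \<forall>s\<in>{}. L s \<omega> - L 0 \<omega> < A} \<le> (3 / 4) ^ 0 + \<eta> / 2"
      if "stable_noise M F L \<alpha> \<sigma>" for M :: "'a measure" and F L
    proof -
      interpret stable_noise M F L \<alpha> \<sigma> by fact
      have "prob {\<omega> \<in> space M. \<forall>s\<in>{}. L s \<omega> - L 0 \<omega> < A} \<le> 1" by (rule prob_le_1)
      also have "1 \<le> (3 / 4) ^ 0 + \<eta> / 2" using \<eta> by simp
      finally show ?thesis .
    qed
    then show ?case by (intro exI[of _ "{}"]) auto
  next
    case (Suc n)
    then obtain \<Theta> where \<Theta>: "finite \<Theta>" "\<Theta> \<subseteq> {0<..}" "card \<Theta> \<le> n"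
      and P\<Theta>: "\<And>(M :: 'a measure) F L. stable_noise M F L \<alpha> \<sigma> \<Longrightarrow>
        measure M {\<omega> \<in> space M. \<forall>s\<in>\<Theta>. L s \<omega> - L 0 \<omega> < A} \<le> (3 / 4) ^ n + \<eta> / 2"
      by blast
    define K where "K = Max (insert 0 \<Theta>)"
    have K: "0 \<le> K" "\<And>s. s \<in> \<Theta> \<Longrightarrow> s \<le> K" using \<Theta>(1) by (auto simp: K_def)
    have "((\<lambda>D. 6 * \<sigma> * K * D powr - \<alpha>) \<longlongrightarrow> 6 * \<sigma> * K * 0) at_top"
      using \<alpha> by (intro tendsto_intros tendsto_neg_powr filterlim_ident) auto
    then have "\<forall>\<^sub>F D in at_top. 6 * \<sigma> * K * D powr - \<alpha> < \<eta> / 8"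
      using \<eta> by (intro order_tendstoD(2)) auto
    from eventually_conj[OF this eventually_gt_at_top[of 0]] obtain D where D: "6 * \<sigma> * K * D powr - \<alpha> < \<eta> / 8" "0 < D"
      by (auto simp: eventually_at_top_linorder)
    (* K' - K is so large that an increment over it exceeds A + D with probability at least 1/4,
       where D bounds the position at time K up to probability eta / 8. *)
    define K' where "K' = K + (\<bar>q\<bar> + 1) / (\<sigma> * (A + D) powr - \<alpha>)"
    have pos: "0 < \<sigma> * (A + D) powr - \<alpha>" using \<sigma> A D by simp
    have KK': "K < K'" unfolding K'_def using pos by simp
    have "\<sigma> * (K' - K) * (A + D) powr - \<alpha> = \<bar>q\<bar> + 1"
      using \<sigma> A D by (simp add: K'_def field_simps)
    then have qK': "q \<le> \<sigma> * (K' - K) * (A + D) powr - \<alpha>" by linarith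
    have "measure M {\<omega> \<in> space M. \<forall>s\<in>insert K' \<Theta>. L s \<omega> - L 0 \<omega> < A} \<le> (3 / 4) ^ Suc n + \<eta> / 2"
      if sn: "stable_noise M F L \<alpha> \<sigma>" for M :: "'a measure" and F L
    proof -
      interpret stable_noise M F L \<alpha> \<sigma> by fact
      have [measurable]: "L K \<in> borel_measurable M" "L K' \<in> borel_measurable M" "L 0 \<in> borel_measurable M"
        using K KK' by (auto intro!: measurable_L)
      define E where "E = {\<omega> \<in> space M. \<forall>s\<in>\<Theta>. L s \<omega> - L 0 \<omega> < A}"
      define G where "G = {\<omega> \<in> space M. L K' \<omega> - L K \<omega> \<in> {..A + D}}"
      have E: "E \<in> sets (F K)"
      proof -
        have "{\<omega> \<in> space (F K). L s \<omega> - L 0 \<omega> < A} \<in> sets (F K)" if "s \<in> \<Theta>" for s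
        proof -
          have [measurable]: "L s \<in> borel_measurable (F K)" "L 0 \<in> borel_measurable (F K)"
            using that \<Theta> K by (auto intro!: adapted_later)
          show ?thesis by measurable
        qed
        then have "{\<omega> \<in> space (F K). \<forall>s\<in>\<Theta>. L s \<omega> - L 0 \<omega> < A} \<in> sets (F K)"
          by (intro sets.sets_Collect_finite_All \<Theta>(1)) auto
        then show ?thesis by (simp add: E_def space_F[OF K(1)])
      qed
      have G: "prob G \<le> 3 / 4"
      proof -
        have "measure (distr M borel (\<lambda>\<omega>. L K' \<omega> - L K \<omega>)) {y. y \<le> A + D} \<le> 3 / 4"
          using A D KK' by (intro q[OF increment_law[OF K(1)] _ qK']) auto
        moreover have "measure (distr M borel (\<lambda>\<omega>. L K' \<omega> - L K \<omega>)) {y. y \<le> A + D} = prob G"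
          unfolding G_def by (subst measure_distr) (auto intro!: arg_cong[where f = prob])
        ultimately show ?thesis by simp
      qed
      have EM: "E \<in> sets M" using sets_F[OF K(1) E] .
      have GM: "G \<in> sets M" unfolding G_def by measurable
      have "prob {\<omega> \<in> space M. \<forall>s\<in>insert K' \<Theta>. L s \<omega> - L 0 \<omega> < A}
        \<le> prob ((E \<inter> G) \<union> {\<omega> \<in> space M. D \<le> \<bar>L K \<omega> - L 0 \<omega>\<bar>})"
      proof (rule finite_measure_mono)
        show "E \<inter> G \<union> {\<omega> \<in> space M. D \<le> \<bar>L K \<omega> - L 0 \<omega>\<bar>} \<in> sets M"
          using EM GM by (intro sets.Un sets.Int) (auto intro: borel_measurable_le simp: abs_le_iff)
      qed (auto simp: E_def G_def)
      also have "\<dots> \<le> prob (E \<inter> G) + prob {\<omega> \<in> space M. D \<le> \<bar>L K \<omega> - L 0 \<omega>\<bar>}"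
        using EM GM by (intro measure_Un_le) auto
      also have "prob (E \<inter> G) = prob E * prob G"
        unfolding G_def using K KK' E by (intro past_indep_increment) auto
      also have "prob E * prob G \<le> ((3 / 4) ^ n + \<eta> / 2) * (3 / 4)"
        using P\<Theta>[OF sn] G \<eta> unfolding E_def by (intro mult_mono) auto
      also have "prob {\<omega> \<in> space M. D \<le> \<bar>L K \<omega> - L 0 \<omega>\<bar>} \<le> \<eta> / 8"
        using increment_tail[OF order_refl K(1) D(2)] D(1) by simp
      finally show ?thesis by (simp add: field_simps)
    qed
    moreover have "card (insert K' \<Theta>) \<le> Suc n" using \<Theta> by (simp add: card_insert_if)
    ultimately show ?case using \<Theta> K KK' by (intro exI[of _ "insert K' \<Theta>"]) auto
  qed
  obtain n where n: "(3 / 4 :: real) ^ n < \<eta> / 2"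
    using real_arch_pow_inv[of "\<eta> / 2" "3 / 4"] \<eta> by auto
  have "\<exists>\<Theta>. finite \<Theta> \<and> \<Theta> \<subseteq> {0<..} \<and> card \<Theta> \<le> n \<and>
      (\<forall>(M :: 'a measure) F L. stable_noise M F L \<alpha> \<sigma> \<longrightarrow> likely M \<eta> (\<lambda>\<omega>. \<exists>s\<in>\<Theta>. A \<le> L s \<omega> - L 0 \<omega>))"
    if A: "0 < A" for A
  proof -
    obtain \<Theta> where \<Theta>: "finite \<Theta>" "\<Theta> \<subseteq> {0<..}" "card \<Theta> \<le> n"
      and P\<Theta>: "\<And>(M :: 'a measure) F L. stable_noise M F L \<alpha> \<sigma> \<Longrightarrow>
        measure M {\<omega> \<in> space M. \<forall>s\<in>\<Theta>. L s \<omega> - L 0 \<omega> < A} \<le> (3 / 4) ^ n + \<eta> / 2"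
      using *[OF A, of n] by blast
    have "likely M \<eta> (\<lambda>\<omega>. \<exists>s\<in>\<Theta>. A \<le> L s \<omega> - L 0 \<omega>)"
      if sn: "stable_noise M F L \<alpha> \<sigma>" for M :: "'a measure" and F L
    proof (rule likelyI)
      interpret stable_noise M F L \<alpha> \<sigma> by fact
      have "{\<omega> \<in> space M. L s \<omega> - L 0 \<omega> < A} \<in> sets M" if "s \<in> \<Theta>" for s
      proof -
        have [measurable]: "L s \<in> borel_measurable M" "L 0 \<in> borel_measurable M"
          using that \<Theta> by (auto intro!: measurable_L)
        show ?thesis by measurable
      qed
      then show "{\<omega> \<in> space M. \<forall>s\<in>\<Theta>. L s \<omega> - L 0 \<omega> < A} \<in> sets M"
        by (intro sets.sets_Collect_finite_All \<Theta>(1)) auto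
      show "measure M {\<omega> \<in> space M. \<forall>s\<in>\<Theta>. L s \<omega> - L 0 \<omega> < A} \<le> \<eta>"
        using P\<Theta>[OF sn] n by simp
    qed (auto simp: not_less)
    with \<Theta> show ?thesis by blast
  qed
  then show ?thesis by (rule that)
qed

lemma stable_law_scale:
  assumes "stable_law \<alpha> k \<mu>"
  shows "stable_law \<alpha> (k * \<bar>c\<bar> powr \<alpha>) (distr \<mu> borel (\<lambda>y. c * y))"
proof -
  interpret \<mu>: real_distribution \<mu> using assms by (simp add: stable_law_def)
  have "char (distr \<mu> borel (\<lambda>y. c * y)) u = char \<mu> (c * u)" for u
    by (simp add: char_def integral_distr ac_simps)
  then show ?thesis
    using assms by (auto simp: stable_law_def abs_mult powr_mult ac_simps intro!: \<mu>.real_distribution_distr)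
qed

text \<open>For \<open>0 < c\<close> this is self-similarity; for \<open>c = - 1\<close> and \<open>\<tau> = 1\<close> it is symmetry.\<close>

lemma stable_noise_rescale:
  assumes "stable_noise M F L \<alpha> \<sigma>" and \<tau>: "0 < \<tau>" and c: "\<bar>c\<bar> powr \<alpha> * \<tau> = 1"
  shows "stable_noise M (\<lambda>t. F (\<tau> * t)) (\<lambda>t \<omega>. c * L (\<tau> * t) \<omega>) \<alpha> \<sigma>"
proof -
  interpret stable_noise M F L \<alpha> \<sigma> by fact
  show ?thesis
  proof
    show "0 \<le> t \<Longrightarrow> subalgebra M (F (\<tau> * t))" for t using \<tau> by (intro F_subalgebra) auto
    show "0 \<le> s \<Longrightarrow> s \<le> t \<Longrightarrow> subalgebra (F (\<tau> * t)) (F (\<tau> * s))" for s t using \<tau> by (intro F_mono) auto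
    show "0 \<le> t \<Longrightarrow> (\<lambda>\<omega>. c * L (\<tau> * t) \<omega>) \<in> borel_measurable (F (\<tau> * t))" for t
      using \<tau> adapted[of "\<tau> * t"] by simp
    show "AE \<omega> in M. c * L (\<tau> * 0) \<omega> = 0" using start by simp
    show "AE \<omega> in M. cadlag_on {0..} (\<lambda>t. c * L (\<tau> * t) \<omega>)"
      using cadlag
    proof eventually_elim
      case (elim \<omega>)
      show ?case unfolding cadlag_on_def
      proof (intro ballI conjI)
        fix t :: real assume t: "t \<in> {0..}"
        then have "\<tau> * t \<in> {0..}" using \<tau> by simp
        with elim obtain l where r: "((\<lambda>t. L t \<omega>) \<longlongrightarrow> L (\<tau> * t) \<omega>) (at (\<tau> * t) within {0..} \<inter> {\<tau> * t<..})"
          and l: "((\<lambda>t. L t \<omega>) \<longlongrightarrow> l) (at (\<tau> * t) within {0..} \<inter> {..<\<tau> * t})"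
          unfolding cadlag_on_def by blast
        have "filterlim (\<lambda>s. \<tau> * s) (at (\<tau> * t) within {0..} \<inter> {\<tau> * t<..}) (at t within {0..} \<inter> {t<..})"
          unfolding filterlim_at using \<tau> by (auto intro!: tendsto_intros simp: eventually_at_filter)
        then show "((\<lambda>t. c * L (\<tau> * t) \<omega>) \<longlongrightarrow> c * L (\<tau> * t) \<omega>) (at t within {0..} \<inter> {t<..})"
          by (intro tendsto_intros filterlim_compose[OF r])
        have "filterlim (\<lambda>s. \<tau> * s) (at (\<tau> * t) within {0..} \<inter> {..<\<tau> * t}) (at t within {0..} \<inter> {..<t})"
          unfolding filterlim_at using \<tau> by (auto intro!: tendsto_intros simp: eventually_at_filter)
        then have "((\<lambda>t. c * L (\<tau> * t) \<omega>) \<longlongrightarrow> c * l) (at t within {0..} \<inter> {..<t})"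
          by (intro tendsto_intros filterlim_compose[OF l])
        then show "\<exists>l. ((\<lambda>t. c * L (\<tau> * t) \<omega>) \<longlongrightarrow> l) (at t within {0..} \<inter> {..<t})" by blast
      qed
    qed
    fix s t :: real assume st: "0 \<le> s" "s \<le> t"
    then have st': "0 \<le> \<tau> * s" "\<tau> * s \<le> \<tau> * t" using \<tau> by auto
    have [measurable]: "L (\<tau> * s) \<in> borel_measurable M" "L (\<tau> * t) \<in> borel_measurable M"
      using st' by (auto intro!: measurable_L)
    have sub: "sets (vimage_algebra (space M) (\<lambda>\<omega>. c * L (\<tau> * t) \<omega> - c * L (\<tau> * s) \<omega>) borel)
      \<subseteq> sets (vimage_algebra (space M) (\<lambda>\<omega>. L (\<tau> * t) \<omega> - L (\<tau> * s) \<omega>) borel)"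
    proof
      fix A assume "A \<in> sets (vimage_algebra (space M) (\<lambda>\<omega>. c * L (\<tau> * t) \<omega> - c * L (\<tau> * s) \<omega>) borel)"
      then obtain B where B: "B \<in> sets borel" "A = (\<lambda>\<omega>. c * L (\<tau> * t) \<omega> - c * L (\<tau> * s) \<omega>) -` B \<inter> space M"
        by (subst (asm) sets_vimage_algebra2) auto
      have "(\<lambda>y. c * y) -` B \<in> sets borel"
        using B(1) by (intro measurable_sets_borel[where M = borel]) auto
      from in_vimage_algebra[OF this, of "\<lambda>\<omega>. L (\<tau> * t) \<omega> - L (\<tau> * s) \<omega>" "space M"]
      show "A \<in> sets (vimage_algebra (space M) (\<lambda>\<omega>. L (\<tau> * t) \<omega> - L (\<tau> * s) \<omega>) borel)"
        unfolding B(2) by (simp add: vimage_def algebra_simps)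
    qed
    show "indep_set (sets (F (\<tau> * s))) (sets (vimage_algebra (space M) (\<lambda>\<omega>. c * L (\<tau> * t) \<omega> - c * L (\<tau> * s) \<omega>) borel))"
      using indep_increments[OF st'] unfolding indep_set_def
      by (rule indep_sets_mono_sets) (use sub in \<open>auto split: bool.split\<close>)
    have "stable_law \<alpha> (\<sigma> * (\<tau> * t - \<tau> * s) * \<bar>c\<bar> powr \<alpha>)
      (distr (distr M borel (\<lambda>\<omega>. L (\<tau> * t) \<omega> - L (\<tau> * s) \<omega>)) borel (\<lambda>y. c * y))"
      by (intro stable_law_scale increment_law st')
    moreover have "\<sigma> * (\<tau> * t - \<tau> * s) * \<bar>c\<bar> powr \<alpha> = \<sigma> * (t - s) * (\<bar>c\<bar> powr \<alpha> * \<tau>)"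
      by (simp add: algebra_simps)
    moreover have "distr (distr M borel (\<lambda>\<omega>. L (\<tau> * t) \<omega> - L (\<tau> * s) \<omega>)) borel (\<lambda>y. c * y)
      = distr M borel (\<lambda>\<omega>. c * L (\<tau> * t) \<omega> - c * L (\<tau> * s) \<omega>)"
      by (subst distr_distr) (auto simp: comp_def algebra_simps)
    ultimately show "stable_law \<alpha> (\<sigma> * (t - s)) (distr M borel (\<lambda>\<omega>. c * L (\<tau> * t) \<omega> - c * L (\<tau> * s) \<omega>))"
      using c by simp
  qed (use index intensity in auto)
qed

text \<open>The substitution of \<open>- y\<close> for \<open>y\<close> conjugates the integrand and so removes its imaginary part together with
the compensator; that of \<open>y / \<bar>u\<bar>\<close> shows that the real part is homogeneous of degree \<open>\<alpha>\<close> in \<open>u\<close>.\<close>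

lemma stable_levy_exponent:
  assumes c: "0 < c" and lm: "levy_measure (stable_levy_measure \<alpha> c)"
  obtains \<sigma> where "0 < \<sigma>"
    "\<And>u. levy_exponent 0 0 (stable_levy_measure \<alpha> c) u = of_real (- (\<sigma> * \<bar>u\<bar> powr \<alpha>))"
proof -
  define w where "w y = c * \<bar>y\<bar> powr (- \<alpha> - 1)" for y :: real
  define \<nu> where "\<nu> = stable_levy_measure \<alpha> c"
  define h where "h u y = exp (\<i> * of_real (u * y)) - 1 - \<i> * of_real (u * y * indicator {-1..1} y)" for u y :: real
  have w0: "0 \<le> w y" for y using c by (simp add: w_def)
  have [measurable]: "w \<in> borel_measurable borel" unfolding w_def by measurable
  have [measurable]: "h u \<in> borel_measurable borel" for u unfolding h_def by measurable
  have \<nu>: "\<nu> = density lborel (\<lambda>y. ennreal (w y))"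
    by (simp add: \<nu>_def stable_levy_measure_def w_def)
  have [measurable_cong]: "sets \<nu> = sets borel" by (simp add: \<nu>)
  have dens: "(\<integral>y. f y \<partial>\<nu>) = (\<integral>y. w y *\<^sub>R f y \<partial>lborel)"
    if "f \<in> borel_measurable borel" for f :: "real \<Rightarrow> 'b :: {banach, second_countable_topology}"
    unfolding \<nu> using that w0 by (intro integral_density) auto
  have int_min: "integrable \<nu> (\<lambda>y. min 1 (y\<^sup>2))"
    using lm by (intro integrableI_nonneg) (auto simp: levy_measure_def \<nu>_def)
  have int_h: "integrable \<nu> (h u)" for u
  proof (rule Bochner_Integration.integrable_bound)
    show "integrable \<nu> (\<lambda>y. (2 + u\<^sup>2) * min 1 (y\<^sup>2))" using int_min by simp
    have "norm (h u y) \<le> (2 + u\<^sup>2) * min 1 (y\<^sup>2)" for y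
    proof (cases "\<bar>y\<bar> \<le> 1")
      case True
      then have y2: "y\<^sup>2 \<le> 1" by (simp add: abs_square_le_1)
      have "norm (iexp (u * y) - (\<Sum>k\<le>1. (\<i> * (u * y)) ^ k / fact k)) \<le> \<bar>u * y\<bar> ^ Suc 1 / fact (Suc 1)"
        by (rule iexp_approx1)
      moreover have "iexp (u * y) - (\<Sum>k\<le>1. (\<i> * (u * y)) ^ k / fact k) = h u y"
        using True by (simp add: h_def indicator_def abs_le_iff)
      ultimately have "norm (h u y) \<le> (u * y)\<^sup>2 / 2" by (simp add: numeral_2_eq_2)
      also have "\<dots> \<le> (2 + u\<^sup>2) * y\<^sup>2" by (simp add: power_mult_distrib algebra_simps)
      finally show ?thesis using y2 by (simp add: min_def)
    next
      case False
      then have "1 \<le> y\<^sup>2" by (simp add: abs_square_le_1[symmetric] linorder_not_le less_imp_le abs_square_less_1)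
      moreover have "norm (h u y) \<le> 2"
      proof -
        have "h u y = iexp (u * y) - 1" using False by (auto simp: h_def indicator_def)
        then have "norm (h u y) \<le> norm (iexp (u * y)) + norm (1 :: complex)" by (metis norm_triangle_ineq4)
        then show ?thesis by simp
      qed
      ultimately show ?thesis by (simp add: min_def add_increasing2)
    qed
    then show "AE y in \<nu>. norm (h u y) \<le> norm ((2 + u\<^sup>2) * min 1 (y\<^sup>2))" by (auto simp: abs_mult)
  qed measurable
  have real: "Im (\<integral>y. h u y \<partial>\<nu>) = 0" for u
  proof -
    have "(\<integral>y. h u y \<partial>\<nu>) = (\<integral>y. w y *\<^sub>R h u y \<partial>lborel)" by (rule dens) measurable
    also have "\<dots> = (\<integral>y. w (- y) *\<^sub>R h u (- y) \<partial>lborel)"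
      using lborel_integral_real_affine[of "-1" "\<lambda>y. w y *\<^sub>R h u y" 0] by simp
    also have "\<dots> = (\<integral>y. cnj (w y *\<^sub>R h u y) \<partial>lborel)"
      by (intro Bochner_Integration.integral_cong) (auto simp: w_def h_def indicator_def exp_cnj)
    also have "\<dots> = cnj (\<integral>y. w y *\<^sub>R h u y \<partial>lborel)" by (rule Bochner_Integration.integral_cnj)
    also have "(\<integral>y. w y *\<^sub>R h u y \<partial>lborel) = (\<integral>y. h u y \<partial>\<nu>)" by (rule dens[symmetric]) measurable
    finally show ?thesis by (simp add: complex_eq_iff)
  qed
  define \<Phi> where "\<Phi> u = (\<integral>y. w y * (1 - cos (u * y)) \<partial>lborel)" for u
  have Re_h: "Re (h u y) = cos (u * y) - 1" for u y by (simp add: h_def Re_exp)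
  have Re: "Re (\<integral>y. h u y \<partial>\<nu>) = - \<Phi> u" for u
  proof -
    have "Re (\<integral>y. h u y \<partial>\<nu>) = (\<integral>y. Re (h u y) \<partial>\<nu>)" using int_h by simp
    also have "\<dots> = (\<integral>y. w y *\<^sub>R (cos (u * y) - 1) \<partial>lborel)" unfolding Re_h by (rule dens) measurable
    also have "\<dots> = (\<integral>y. - (w y * (1 - cos (u * y))) \<partial>lborel)" by (simp add: algebra_simps)
    finally show ?thesis by (simp add: \<Phi>_def)
  qed
  have scale: "\<Phi> u = \<Phi> 1 * \<bar>u\<bar> powr \<alpha>" for u
  proof (cases "u = 0")
    case True then show ?thesis by (simp add: \<Phi>_def)
  next
    case False
    have "\<Phi> u = \<bar>1 / \<bar>u\<bar>\<bar> *\<^sub>R (\<integral>y. w (0 + 1 / \<bar>u\<bar> * y) * (1 - cos (u * (0 + 1 / \<bar>u\<bar> * y))) \<partial>lborel)"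
      unfolding \<Phi>_def using False by (intro lborel_integral_real_affine) auto
    also have "(\<lambda>y. w (0 + 1 / \<bar>u\<bar> * y) * (1 - cos (u * (0 + 1 / \<bar>u\<bar> * y)))) = (\<lambda>y. \<bar>u\<bar> powr (\<alpha> + 1) * (w y * (1 - cos (1 * y))))"
    proof
      fix y
      have "w (0 + 1 / \<bar>u\<bar> * y) = \<bar>u\<bar> powr (\<alpha> + 1) * w y"
        using False by (simp add: w_def abs_mult powr_divide powr_minus field_simps powr_diff powr_add)
      moreover have "cos (u * (0 + 1 / \<bar>u\<bar> * y)) = cos y"
        using False by (cases "0 < u") (auto simp: abs_if)
      ultimately show "w (0 + 1 / \<bar>u\<bar> * y) * (1 - cos (u * (0 + 1 / \<bar>u\<bar> * y))) = \<bar>u\<bar> powr (\<alpha> + 1) * (w y * (1 - cos (1 * y)))"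
        by simp
    qed
    also have "\<bar>1 / \<bar>u\<bar>\<bar> *\<^sub>R (\<integral>y. \<bar>u\<bar> powr (\<alpha> + 1) * (w y * (1 - cos (1 * y))) \<partial>lborel) = \<bar>u\<bar> powr \<alpha> * \<Phi> 1"
      unfolding \<Phi>_def using False by (simp add: powr_add)
    finally show ?thesis by simp
  qed
  have int_cos: "integrable \<nu> (\<lambda>y. 1 - cos y)"
  proof -
    have "integrable \<nu> (\<lambda>y. - Re (h 1 y))" using int_h by simp
    then show ?thesis by (simp add: Re_h)
  qed
  have \<Phi>1: "\<Phi> 1 = (\<integral>y. 1 - cos y \<partial>\<nu>)"
    unfolding \<Phi>_def by (subst dens) auto
  have "0 < \<Phi> 1"
  proof (rule ccontr)
    assume "\<not> 0 < \<Phi> 1"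
    moreover have "0 \<le> \<Phi> 1" unfolding \<Phi>1 by (rule integral_nonneg_AE) simp
    ultimately have "(\<integral>y. 1 - cos y \<partial>\<nu>) = 0" unfolding \<Phi>1 by linarith
    then have "AE y in \<nu>. 1 - cos y = 0"
      by (subst (asm) integral_nonneg_eq_0_iff_AE[OF int_cos]) auto
    then have "AE y in lborel. 0 < w y \<longrightarrow> 1 - cos y = 0"
      unfolding \<nu> by (subst (asm) AE_density) auto
    moreover have "w y > 0 \<and> 1 - cos y \<noteq> 0" if "y \<in> {0<..<1}" for y
    proof -
      have "cos y < cos 0" using that pi_gt3 by (intro cos_monotone_0_pi) auto
      then show ?thesis using that c by (auto simp: w_def)
    qed
    ultimately have "AE y in lborel. y \<notin> {0<..<1::real}"
      by (auto elim!: eventually_mono)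
    then have "{0<..<1::real} \<in> null_sets lborel"
      by (subst AE_iff_null_sets) auto
    then show False using null_setsD1 by fastforce
  qed
  moreover have "levy_exponent 0 0 (stable_levy_measure \<alpha> c) u = of_real (- (\<Phi> 1 * \<bar>u\<bar> powr \<alpha>))" for u
  proof -
    have "levy_exponent 0 0 (stable_levy_measure \<alpha> c) u = (\<integral>y. h u y \<partial>\<nu>)"
      by (simp add: levy_exponent_def h_def \<nu>_def)
    also have "\<dots> = of_real (- \<Phi> u)" using real Re by (simp add: complex_eq_iff)
    finally show ?thesis by (simp only: scale[of u])
  qed
  ultimately show ?thesis by (rule that)
qed

lemma symmetric_stable_process_stable_noise:
  assumes "symmetric_stable_process M F \<alpha> L" and \<alpha>: "0 < \<alpha>" "\<alpha> \<le> 2"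
  obtains \<sigma> where "stable_noise M F L \<alpha> \<sigma>"
proof -
  obtain c where c: "0 < c" "has_levy_triplet M L 0 0 (stable_levy_measure \<alpha> c)"
    and lp: "levy_process M F L"
    using assms by (auto simp: symmetric_stable_process_def)
  interpret levy_process M F L by (rule lp)
  obtain \<sigma> where \<sigma>: "0 < \<sigma>" "\<And>u. levy_exponent 0 0 (stable_levy_measure \<alpha> c) u = of_real (- (\<sigma> * \<bar>u\<bar> powr \<alpha>))"
    using stable_levy_exponent[OF c(1)] c(2) by (auto simp: has_levy_triplet_def)
  have "stable_noise M F L \<alpha> \<sigma>"
  proof
    fix s t :: real assume st: "0 \<le> s" "s \<le> t"
    have [measurable]: "L s \<in> borel_measurable M" "L t \<in> borel_measurable M"
      using st measurable_from_subalg[OF F_subalgebra adapted] by auto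
    have "char (distr M borel (\<lambda>\<omega>. L t \<omega> - L s \<omega>)) u = of_real (exp (- (\<sigma> * (t - s) * \<bar>u\<bar> powr \<alpha>)))" for u
    proof -
      have "char (distr M borel (\<lambda>\<omega>. L t \<omega> - L s \<omega>)) u = char (distr M borel (L (t - s))) u"
        using stationary_increments[OF st] by simp
      also have "\<dots> = exp (of_real (t - s) * of_real (- (\<sigma> * \<bar>u\<bar> powr \<alpha>)))"
        using c(2) st unfolding has_levy_triplet_def \<sigma>(2)[symmetric] by auto
      also have "\<dots> = of_real (exp ((t - s) * - (\<sigma> * \<bar>u\<bar> powr \<alpha>)))"
        by (simp only: of_real_mult[symmetric] exp_of_real)
      finally show ?thesis by (simp add: mult_ac)
    qed
    moreover have "real_distribution (distr M borel (\<lambda>\<omega>. L t \<omega> - L s \<omega>))"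
      by (rule real_distribution_distr) measurable
    ultimately show "stable_law \<alpha> (\<sigma> * (t - s)) (distr M borel (\<lambda>\<omega>. L t \<omega> - L s \<omega>))"
      by (simp add: stable_law_def)
  qed (use adapted start cadlag indep_increments \<alpha> \<sigma> in auto)
  then show ?thesis by (rule that)
qed

section \<open>Paths driven by a fixed noise path\<close>

text \<open>Otherwise \<open>D\<close> would be positive up to the first time at which it is not. All comparisons of paths below are
instances, with \<open>D\<close> a continuous function, although the paths themselves jump.\<close>

lemma barrier:
  fixes D :: "real \<Rightarrow> real"
  assumes cont: "continuous_on {s..T} D"
    and step: "\<And>t. t \<in> {s..T} \<Longrightarrow> (\<And>u. u \<in> {s..<t} \<Longrightarrow> 0 < D u) \<Longrightarrow> 0 < D t"
    and t: "t \<in> {s..T}"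
  shows "0 < D t"
proof (rule ccontr)
  assume "\<not> 0 < D t"
  define Z where "Z = {u \<in> {s..T}. D u \<le> 0}"
  have "Z = {s..T} \<inter> D -` {..0}" by (auto simp: Z_def)
  moreover have "closed ({s..T} \<inter> D -` {..0})"
    using cont by (intro continuous_closed_preimage) auto
  moreover have "bounded Z" by (rule bounded_subset[of "{s..T}"]) (auto simp: Z_def)
  ultimately have "compact Z" by (simp add: compact_eq_bounded_closed)
  moreover have "Z \<noteq> {}" using t \<open>\<not> 0 < D t\<close> by (auto simp: Z_def)
  ultimately obtain z where z: "z \<in> Z" "\<And>u. u \<in> Z \<Longrightarrow> z \<le> u"
    using compact_attains_inf[of Z] by blast
  have "0 < D z"
  proof (rule step)
    fix u assume "u \<in> {s..<z}"
    then have "u \<in> {s..T}" "u \<notin> Z" using z(1) z(2)[of u] by (auto simp: Z_def)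
    then show "0 < D u" by (simp add: Z_def)
  qed (use z in \<open>auto simp: Z_def\<close>)
  then show False using z by (simp add: Z_def)
qed

lemma mono_drift: "0 < B\<^sub>p \<Longrightarrow> 0 < B\<^sub>m \<Longrightarrow> 0 < \<beta>\<^sub>p \<Longrightarrow> 0 < \<beta>\<^sub>m \<Longrightarrow> mono (drift B\<^sub>p B\<^sub>m \<beta>\<^sub>p \<beta>\<^sub>m)"
proof (rule monoI)
  fix x y :: real
  assume *: "0 < B\<^sub>p" "0 < B\<^sub>m" "0 < \<beta>\<^sub>p" "0 < \<beta>\<^sub>m" "x \<le> y"
  consider "0 \<le> x" | "x < 0" "0 \<le> y" | "y < 0" by linarith
  then show "drift B\<^sub>p B\<^sub>m \<beta>\<^sub>p \<beta>\<^sub>m x \<le> drift B\<^sub>p B\<^sub>m \<beta>\<^sub>p \<beta>\<^sub>m y"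
  proof cases
    case 1
    then show ?thesis using * by (auto simp: drift_def intro!: mult_left_mono powr_mono2)
  next
    case 2
    then have "drift B\<^sub>p B\<^sub>m \<beta>\<^sub>p \<beta>\<^sub>m x \<le> 0" "0 \<le> drift B\<^sub>p B\<^sub>m \<beta>\<^sub>p \<beta>\<^sub>m y" using * by (auto simp: drift_def)
    then show ?thesis by linarith
  next
    case 3
    then show ?thesis using * by (auto simp: drift_def intro!: mult_left_mono powr_mono2)
  qed
qed

lemma drift_minus: "drift B\<^sub>p B\<^sub>m \<beta>\<^sub>p \<beta>\<^sub>m (- x) = - drift B\<^sub>m B\<^sub>p \<beta>\<^sub>m \<beta>\<^sub>p x"
  by (auto simp: drift_def)

text \<open>By right continuity the path is the limit of its values at grid points strictly to the right.\<close>

lemma cadlag_on_borel_measurable: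
  assumes x: "cadlag_on {0..} x"
  shows "(\<lambda>s. indicator {0..} s * x s) \<in> borel_measurable borel"
proof (rule borel_measurable_LIMSEQ_real)
  fix s :: real
  define u where "u n = (\<lfloor>real (Suc n) * s\<rfloor> + 1) / real (Suc n)" for n
  have u: "s < u n" "u n \<le> s + 1 / real (Suc n)" for n
  proof -
    have "real (Suc n) * s < \<lfloor>real (Suc n) * s\<rfloor> + 1" "\<lfloor>real (Suc n) * s\<rfloor> \<le> real (Suc n) * s" by linarith+
    then show "s < u n" "u n \<le> s + 1 / real (Suc n)" unfolding u_def by (simp_all add: field_simps del: of_nat_Suc)
  qed
  show "(\<lambda>n. indicator {0..} s * x (u n)) \<longlonglongrightarrow> indicator {0..} s * x s"
  proof (cases "0 \<le> s")
    case True
    then have "(x \<longlongrightarrow> x s) (at s within {0..} \<inter> {s<..})" using x by (auto simp: cadlag_on_def)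
    moreover have "filterlim u (at s within {0..} \<inter> {s<..}) sequentially"
      unfolding filterlim_at
    proof
      show "\<forall>\<^sub>F n in sequentially. u n \<in> {0..} \<inter> {s<..} \<and> u n \<noteq> s"
        using True u(1) by (auto intro!: always_eventually less_imp_le elim: order_le_less_trans simp: less_imp_neq[symmetric])
      have "(\<lambda>n. s + 1 / real (Suc n)) \<longlonglongrightarrow> s + 0"
        by (intro tendsto_intros LIMSEQ_Suc[OF lim_const_over_n])
      then show "u \<longlonglongrightarrow> s"
        using u by (intro tendsto_sandwich[of "\<lambda>_. s" u _ "\<lambda>n. s + 1 / real (Suc n)"]) (auto intro!: always_eventually less_imp_le)
    qed
    ultimately have "(\<lambda>n. x (u n)) \<longlonglongrightarrow> x s" by (rule filterlim_compose)
    then show ?thesis by (intro tendsto_intros)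
  qed auto
next
  fix n
  have "(\<lambda>s::real. x ((\<lfloor>real (Suc n) * s\<rfloor> + 1) / real (Suc n))) \<in> borel_measurable borel"
    by (rule measurable_compose[where f = "\<lambda>s. \<lfloor>real (Suc n) * s\<rfloor>" and N = "count_space UNIV"
      and g = "\<lambda>k::int. x (real_of_int (k + 1) / real (Suc n))"]) auto
  then show "(\<lambda>s::real. indicator {0..} s * x ((\<lfloor>real (Suc n) * s\<rfloor> + 1) / real (Suc n))) \<in> borel_measurable borel"
    by measurable
qed

lemma set_integrable_mono_of_cadlag:
  fixes b :: "real \<Rightarrow> real"
  assumes b: "mono b" and x: "cadlag_on {0..} x"
  shows "set_integrable lborel {0..t} (\<lambda>s. b (x s))"
proof -
  have "cadlag_on {0..t} x" 
    using x unfolding cadlag_on_def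
    by (meson Icc_subset_Ici_iff Int_mono atLeastAtMost_iff atLeast_iff order_refl tendsto_within_subset)
  from cadlag_on_bounded[OF this compact_Icc]
  obtain K where K: "\<And>s. s \<in> {0..t} \<Longrightarrow> \<bar>x s\<bar> \<le> K" by blast
  have bound: "\<bar>b (x s)\<bar> \<le> \<bar>b K\<bar> + \<bar>b (- K)\<bar>" if "s \<in> {0..t}" for s
    using monoD[OF b, of "x s" K] monoD[OF b, of "- K" "x s"] K[OF that] by linarith
  have "(\<lambda>s. indicator {0..t} s * b (indicator {0..} s * x s)) \<in> borel_measurable borel"
    using measurable_compose[OF cadlag_on_borel_measurable[OF x] borel_measurable_mono[OF b]] by measurable
  also have "(\<lambda>s. indicator {0..t} s * b (indicator {0..} s * x s)) = (\<lambda>s. indicator {0..t} s * b (x s))"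
    by (auto simp: indicator_def)
  finally have m: "set_borel_measurable lborel {0..t} (\<lambda>s. b (x s))"
    by (simp add: set_borel_measurable_def)
  have "set_integrable lborel {0..t} (\<lambda>s. \<bar>b K\<bar> + \<bar>b (- K)\<bar>)"
    by (rule borel_integrable_atLeastAtMost') simp
  then show ?thesis
    by (rule set_integrable_bound[OF _ m]) (use bound in auto)
qed

text \<open>In the comparison arguments the inequality between the integrands is known before time \<open>t\<close> only.\<close>

lemma integral_mono_halfopen:
  fixes f h :: "real \<Rightarrow> real"
  assumes "f integrable_on {s..t}" "h integrable_on {s..t}" "\<And>u. u \<in> {s..<t} \<Longrightarrow> f u \<le> h u"
  shows "integral {s..t} f \<le> integral {s..t} h"
proof -
  define h' where "h' u = (if u = t then f t else h u)" for u
  have "(h has_integral integral {s..t} h) {s..t}" using assms(2) by (rule integrable_integral)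
  then have h': "(h' has_integral integral {s..t} h) {s..t}"
    by (rule has_integral_spike[of "{t}", rotated 2]) (auto simp: h'_def)
  show ?thesis
    by (rule has_integral_le[OF integrable_integral[OF assms(1)] h']) (use assms(3) in \<open>auto simp: h'_def\<close>)
qed

lemma has_integral_power_curve:
  fixes a s t \<gamma> :: real
  assumes "a \<le> s" "s \<le> t" "1 \<le> \<gamma>"
  shows "((\<lambda>u. \<gamma> * (u - a) powr (\<gamma> - 1)) has_integral ((t - a) powr \<gamma> - (s - a) powr \<gamma>)) {s..t}"
proof (rule fundamental_theorem_of_calculus_interior[OF assms(2)])
  show "continuous_on {s..t} (\<lambda>u. (u - a) powr \<gamma>)"
    using assms by (intro continuous_on_powr' continuous_intros) auto
  fix u assume "u \<in> {s<..<t}"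
  then show "((\<lambda>u. (u - a) powr \<gamma>) has_vector_derivative \<gamma> * (u - a) powr (\<gamma> - 1)) (at u)"
    using assms unfolding has_real_derivative_iff_has_vector_derivative[symmetric]
    by (auto intro!: derivative_eq_intros)
qed

text \<open>The constant \<open>C\<close> of the extremal path solves \<open>B\<^sub>p * C powr \<beta>\<^sub>p = C * \<gamma>\<close>, and \<open>\<gamma> * \<beta>\<^sub>p = \<gamma> - 1\<close>, so the drift along
the path is its derivative. As the equation is autonomous, the translates by \<open>a\<close> are solutions too.\<close>

lemma extremal_path_integral_equation:
  assumes B: "0 < B\<^sub>p" "0 < B\<^sub>m" and \<beta>: "0 < \<beta>\<^sub>p" "\<beta>\<^sub>p < 1" and "a \<le> s" "s \<le> t"
  shows "((\<lambda>u. drift B\<^sub>p B\<^sub>m \<beta>\<^sub>p \<beta>\<^sub>m (extremal_path B\<^sub>p \<beta>\<^sub>p (u - a))) has_integral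
    (extremal_path B\<^sub>p \<beta>\<^sub>p (t - a) - extremal_path B\<^sub>p \<beta>\<^sub>p (s - a))) {s..t}"
proof -
  define \<gamma> where "\<gamma> = 1 / (1 - \<beta>\<^sub>p)"
  define C where "C = (B\<^sub>p * (1 - \<beta>\<^sub>p)) powr \<gamma>"
  have \<gamma>: "1 \<le> \<gamma>" "\<gamma> * \<beta>\<^sub>p = \<gamma> - 1" using \<beta> by (auto simp: \<gamma>_def field_simps)
  have C: "0 < C" using B \<beta> by (simp add: C_def)
  have p: "B\<^sub>p * (1 - \<beta>\<^sub>p) > 0" using B \<beta> by simp
  have "C = (B\<^sub>p * (1 - \<beta>\<^sub>p)) powr (1 + \<gamma> * \<beta>\<^sub>p)" unfolding C_def \<gamma>(2) by simp
  also have "\<dots> = B\<^sub>p * (1 - \<beta>\<^sub>p) * C powr \<beta>\<^sub>p"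
    using p by (simp add: powr_add C_def powr_powr)
  finally have CC: "B\<^sub>p * C powr \<beta>\<^sub>p = C * \<gamma>" using \<beta> by (simp add: \<gamma>_def field_simps)
  have "drift B\<^sub>p B\<^sub>m \<beta>\<^sub>p \<beta>\<^sub>m (extremal_path B\<^sub>p \<beta>\<^sub>p (u - a)) = C * (\<gamma> * (u - a) powr (\<gamma> - 1))" for u
  proof -
    have e: "extremal_path B\<^sub>p \<beta>\<^sub>p (u - a) = C * (u - a) powr \<gamma>"
      by (simp add: extremal_path_def C_def \<gamma>_def)
    have "drift B\<^sub>p B\<^sub>m \<beta>\<^sub>p \<beta>\<^sub>m (extremal_path B\<^sub>p \<beta>\<^sub>p (u - a)) = B\<^sub>p * (C powr \<beta>\<^sub>p * (u - a) powr (\<gamma> * \<beta>\<^sub>p))"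
      unfolding e using C by (simp add: drift_def powr_mult powr_powr)
    also have "\<dots> = C * \<gamma> * (u - a) powr (\<gamma> - 1)" unfolding \<gamma>(2) CC[symmetric] by simp
    finally show ?thesis by simp
  qed
  then show ?thesis
    using has_integral_mult_right[OF has_integral_power_curve[OF assms(5,6) \<gamma>(1)], of C]
    by (simp add: extremal_path_def C_def \<gamma>_def algebra_simps)
qed

text \<open>One realisation of the equation, with \<open>g\<close> in the role of \<open>\<epsilon> * L\<close>. The path has the jumps of \<open>g\<close>, but
the integrated drift \<open>I\<close> is continuous, and the comparisons are carried out for \<open>I\<close>.\<close>

locale driven_path =
  fixes B\<^sub>p B\<^sub>m \<beta>\<^sub>p \<beta>\<^sub>m T :: real and x g :: "real \<Rightarrow> real"
  assumes params: "0 < B\<^sub>p" "0 < B\<^sub>m" "0 < \<beta>\<^sub>p" "\<beta>\<^sub>p < 1" "0 < \<beta>\<^sub>m"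
    and integrable: "(\<lambda>s. drift B\<^sub>p B\<^sub>m \<beta>\<^sub>p \<beta>\<^sub>m (x s)) integrable_on {0..T}"
    and equation: "t \<in> {0..T} \<Longrightarrow> x t = integral {0..t} (\<lambda>s. drift B\<^sub>p B\<^sub>m \<beta>\<^sub>p \<beta>\<^sub>m (x s)) + g t"
begin

abbreviation b where "b \<equiv> drift B\<^sub>p B\<^sub>m \<beta>\<^sub>p \<beta>\<^sub>m"

definition I where "I t = integral {0..t} (\<lambda>s. b (x s))"

lemma b_mono: "u \<le> v \<Longrightarrow> b u \<le> b v"
  using mono_drift params by (blast dest: monoD)

lemma integrable_sub: "0 \<le> s \<Longrightarrow> t \<le> T \<Longrightarrow> (\<lambda>s. b (x s)) integrable_on {s..t}"
  by (rule integrable_on_subinterval[OF integrable]) auto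

lemma I_continuous: "0 \<le> s \<Longrightarrow> continuous_on {s..T} I"
  unfolding I_def by (rule continuous_on_subset[OF indefinite_integral_continuous_1[OF integrable]]) auto

lemma I_diff: "0 \<le> s \<Longrightarrow> s \<le> t \<Longrightarrow> t \<le> T \<Longrightarrow> I t - I s = integral {s..t} (\<lambda>s. b (x s))"
  unfolding I_def using Henstock_Kurzweil_Integration.integral_combine[OF _ _ integrable_sub, of 0 s t] by simp

lemma equation': "t \<in> {0..T} \<Longrightarrow> x t = I t + g t"
  using equation by (simp add: I_def)

text \<open>As long as the integrated drift is above \<open>- \<eta>\<close>, the path is above \<open>- (m + \<eta>)\<close>, and by monotonicity of the drift
the integrated drift is then at least \<open>- S * B\<^sub>m * (m + \<eta>) powr \<beta>\<^sub>m\<close>.\<close>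

lemma short_time_lower_bound:
  assumes S: "S \<le> T" and \<eta>: "0 < \<eta>" and m: "0 \<le> m" "\<And>t. t \<in> {0..S} \<Longrightarrow> - m \<le> g t"
    and small: "S * (B\<^sub>m * (m + \<eta>) powr \<beta>\<^sub>m) < \<eta>" and t: "t \<in> {0..S}"
  shows "g t - \<eta> \<le> x t"
proof -
  have "0 < I t + \<eta>"
  proof (rule barrier[OF _ _ t])
    show "continuous_on {0..S} (\<lambda>t. I t + \<eta>)"
      using continuous_on_subset[OF I_continuous[of 0]] S by (intro continuous_intros) auto
    fix t assume t: "t \<in> {0..S}" and *: "\<And>u. u \<in> {0..<t} \<Longrightarrow> 0 < I u + \<eta>"
    define c where "c = B\<^sub>m * (m + \<eta>) powr \<beta>\<^sub>m"
    have c: "0 \<le> c" using params by (simp add: c_def)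
    have "integral {0..t} (\<lambda>_. - c) \<le> integral {0..t} (\<lambda>s. b (x s))"
    proof (rule integral_mono_halfopen)
      show "(\<lambda>s. b (x s)) integrable_on {0..t}" using t S by (intro integrable_sub) auto
      fix u assume u: "u \<in> {0..<t}"
      then have "- (m + \<eta>) \<le> x u" using *[OF u] m(2)[of u] equation'[of u] t S by auto
      then have "b (- (m + \<eta>)) \<le> b (x u)" by (rule b_mono)
      moreover have "b (- (m + \<eta>)) = - c" using \<eta> m(1) by (simp add: c_def drift_def add.commute)
      ultimately show "- c \<le> b (x u)" by simp
    qed auto
    then have "- (t * c) \<le> I t" using t by (simp add: I_def)
    moreover have "t * c \<le> S * c" using t c by (intro mult_right_mono) auto
    ultimately show "0 < I t + \<eta>" using small by (simp add: c_def)
  qed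
  then show ?thesis using equation'[of t] t S by auto
qed

text \<open>On the curve \<open>\<kappa> * u powr \<gamma>\<close> the drift contributes \<open>B\<^sub>p * (1 - \<beta>\<^sub>p) * \<kappa> powr \<beta>\<^sub>p * u powr \<gamma>\<close> up to time \<open>u\<close>. For small
\<open>\<kappa>\<close> this is at least twice the curve: one half makes up for the losses caused by the noise, the other
keeps the path above the curve. The initial height \<open>r\<close> pays for the constant loss \<open>r / 2\<close>.\<close>

lemma stays_above_power_curve:
  fixes \<kappa> :: real
  defines "\<gamma> \<equiv> 1 / (1 - \<beta>\<^sub>p)"
  assumes s: "0 \<le> s" and r: "0 < r" "r \<le> x s" and \<kappa>: "0 \<le> \<kappa>" "2 * \<kappa> \<le> B\<^sub>p * (1 - \<beta>\<^sub>p) * \<kappa> powr \<beta>\<^sub>p"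
    and g: "\<And>t. t \<in> {s..T} \<Longrightarrow> - r / 2 - \<kappa> * (t - s) powr \<gamma> \<le> g t - g s"
    and t: "t \<in> {s..T}"
  shows "\<kappa> * (t - s) powr \<gamma> \<le> x t"
proof -
  have \<gamma>: "1 \<le> \<gamma>" "\<gamma> * \<beta>\<^sub>p = \<gamma> - 1" using params by (auto simp: \<gamma>_def field_simps)
  define D where "D t = x s + (I t - I s) - r / 2 - 2 * \<kappa> * (t - s) powr \<gamma>" for t
  have x_ge: "D t + \<kappa> * (t - s) powr \<gamma> \<le> x t" if "t \<in> {s..T}" for t
    using g[OF that] equation'[of t] equation'[of s] s that by (simp add: D_def)
  have "0 < D t"
  proof (rule barrier[OF _ _ t])
    show "continuous_on {s..T} D"
      unfolding D_def using \<gamma> s by (intro continuous_intros continuous_on_powr' I_continuous) auto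
    fix t assume t: "t \<in> {s..T}" and *: "\<And>u. u \<in> {s..<t} \<Longrightarrow> 0 < D u"
    have "((\<lambda>u. \<gamma> * (u - s) powr (\<gamma> - 1)) has_integral (t - s) powr \<gamma>) {s..t}"
      using has_integral_power_curve[of s s t \<gamma>] t \<gamma> by simp
    then have hi: "((\<lambda>u. B\<^sub>p * \<kappa> powr \<beta>\<^sub>p * (1 - \<beta>\<^sub>p) * (\<gamma> * (u - s) powr (\<gamma> - 1))) has_integral
        B\<^sub>p * \<kappa> powr \<beta>\<^sub>p * (1 - \<beta>\<^sub>p) * (t - s) powr \<gamma>) {s..t}"
      by (rule has_integral_mult_right)
    have "integral {s..t} (\<lambda>u. B\<^sub>p * \<kappa> powr \<beta>\<^sub>p * (1 - \<beta>\<^sub>p) * (\<gamma> * (u - s) powr (\<gamma> - 1))) \<le> integral {s..t} (\<lambda>s. b (x s))"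
    proof (rule integral_mono_halfopen[OF has_integral_integrable[OF hi]])
      show "(\<lambda>s. b (x s)) integrable_on {s..t}" using t s by (intro integrable_sub) auto
      fix u assume u: "u \<in> {s..<t}"
      then have "\<kappa> * (u - s) powr \<gamma> \<le> x u" using *[OF u] x_ge[of u] t by auto
      then have "b (\<kappa> * (u - s) powr \<gamma>) \<le> b (x u)" by (rule b_mono)
      moreover have "b (\<kappa> * (u - s) powr \<gamma>) = B\<^sub>p * (\<kappa> powr \<beta>\<^sub>p * (u - s) powr (\<gamma> - 1))"
        using \<kappa> by (simp add: drift_def powr_mult powr_powr \<gamma>(2))
      moreover have "(1 - \<beta>\<^sub>p) * \<gamma> = 1" using params by (simp add: \<gamma>_def)
      ultimately show "B\<^sub>p * \<kappa> powr \<beta>\<^sub>p * (1 - \<beta>\<^sub>p) * (\<gamma> * (u - s) powr (\<gamma> - 1)) \<le> b (x u)"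
        by (metis (no_types, opaque_lifting) mult.assoc mult.commute mult_1)
    qed
    then have "B\<^sub>p * \<kappa> powr \<beta>\<^sub>p * (1 - \<beta>\<^sub>p) * (t - s) powr \<gamma> \<le> I t - I s"
      using I_diff[OF s, of t] t unfolding integral_unique[OF hi] by auto
    moreover have "2 * \<kappa> * (t - s) powr \<gamma> \<le> B\<^sub>p * \<kappa> powr \<beta>\<^sub>p * (1 - \<beta>\<^sub>p) * (t - s) powr \<gamma>"
      using \<kappa> by (intro mult_right_mono) (auto simp: mult_ac)
    ultimately show "0 < D t" using r by (simp add: D_def)
  qed
  then show ?thesis using x_ge[OF t] by linarith
qed

text \<open>Increments of the noise are at most \<open>2 * m\<close>, so an initial lead of more than that over a noiseless solution
cannot be lost, since the drift is increasing.\<close>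

lemma above_solution:
  assumes s: "0 \<le> s" and m: "\<And>t. t \<in> {s..T} \<Longrightarrow> \<bar>g t\<bar> \<le> m"
    and W: "continuous_on {s..T} W" "\<And>t. t \<in> {s..T} \<Longrightarrow> ((\<lambda>u. b (W u)) has_integral W t - W s) {s..t}"
    and start: "W s + 2 * m < x s" and t: "t \<in> {s..T}"
  shows "W t \<le> x t"
proof -
  define D where "D t = x s + (I t - I s) - 2 * m - W t" for t
  have x_ge: "D t + W t \<le> x t" if "t \<in> {s..T}" for t
    using m[OF that] m[of s] equation'[of t] equation'[of s] s that by (auto simp: D_def)
  have "0 < D t"
  proof (rule barrier[OF _ _ t])
    show "continuous_on {s..T} D"
      unfolding D_def using s W by (intro continuous_intros I_continuous) auto
    fix t assume t: "t \<in> {s..T}" and *: "\<And>u. u \<in> {s..<t} \<Longrightarrow> 0 < D u"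
    have "integral {s..t} (\<lambda>u. b (W u)) \<le> integral {s..t} (\<lambda>s. b (x s))"
    proof (rule integral_mono_halfopen[OF has_integral_integrable[OF W(2)[OF t]]])
      show "(\<lambda>s. b (x s)) integrable_on {s..t}" using t s by (intro integrable_sub) auto
      fix u assume u: "u \<in> {s..<t}"
      then show "b (W u) \<le> b (x u)" using *[OF u] x_ge[of u] t by (intro b_mono) auto
    qed
    then have "W t - W s \<le> I t - I s"
      using integral_unique[OF W(2)[OF t]] I_diff[OF s, of t] t by simp
    then show "0 < D t" using start by (simp add: D_def)
  qed
  then show ?thesis using x_ge[OF t] by linarith
qed

lemma below_solution:
  assumes s: "0 \<le> s" and m: "\<And>t. t \<in> {s..T} \<Longrightarrow> \<bar>g t\<bar> \<le> m"
    and W: "continuous_on {s..T} W" "\<And>t. t \<in> {s..T} \<Longrightarrow> ((\<lambda>u. b (W u)) has_integral W t - W s) {s..t}"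
    and start: "x s + 2 * m < W s" and t: "t \<in> {s..T}"
  shows "x t \<le> W t"
proof -
  define D where "D t = W t - (x s + (I t - I s) + 2 * m)" for t
  have x_le: "x t \<le> W t - D t" if "t \<in> {s..T}" for t
    using m[OF that] m[of s] equation'[of t] equation'[of s] s that by (auto simp: D_def)
  have "0 < D t"
  proof (rule barrier[OF _ _ t])
    show "continuous_on {s..T} D"
      unfolding D_def using s W by (intro continuous_intros I_continuous) auto
    fix t assume t: "t \<in> {s..T}" and *: "\<And>u. u \<in> {s..<t} \<Longrightarrow> 0 < D u"
    have "integral {s..t} (\<lambda>s. b (x s)) \<le> integral {s..t} (\<lambda>u. b (W u))"
    proof (rule integral_mono_halfopen[OF _ has_integral_integrable[OF W(2)[OF t]]])
      show "(\<lambda>s. b (x s)) integrable_on {s..t}" using t s by (intro integrable_sub) auto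
      fix u assume u: "u \<in> {s..<t}"
      then show "b (x u) \<le> b (W u)" using *[OF u] x_le[of u] t by (intro b_mono) auto
    qed
    then have "I t - I s \<le> W t - W s"
      using integral_unique[OF W(2)[OF t]] I_diff[OF s, of t] t by simp
    then show "0 < D t" using start by (simp add: D_def)
  qed
  then show ?thesis using x_le[OF t] by linarith
qed

end

text \<open>Here \<open>D\<close> and \<open>\<tau>\<close> are the units of length and time in which the positive drift has no small factor:
\<open>\<tau> powr \<gamma> = D\<close>, so that power curves of exponent \<open>\<gamma>\<close> look the same in both units. Over \<open>K\<close> units of time
the negative drift costs less than one unit of length, hence the path inherits the height \<open>R\<close> from the
noise at time \<open>\<theta>\<close>, and from then on \<open>stays_above_power_curve\<close> applies.\<close>

lemma (in driven_path) escape_behind_high_noise: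
  fixes D R K m \<theta> \<kappa> \<tau> :: real and Z :: "real \<Rightarrow> real"
  defines "\<gamma> \<equiv> 1 / (1 - \<beta>\<^sub>p)"
  assumes D: "0 < D" and \<tau>: "\<tau> = D powr (1 - \<beta>\<^sub>p)" and gZ: "\<And>t. g t = D * Z (t / \<tau>)"
    and K: "0 \<le> \<theta>" "\<theta> \<le> K" "\<tau> * K \<le> T"
    and m: "0 \<le> m" "\<And>u. u \<in> {0..K} \<Longrightarrow> \<bar>Z u\<bar> \<le> m"
    and small: "K * (B\<^sub>m * (m + 1) powr \<beta>\<^sub>m) * D powr (\<beta>\<^sub>m - \<beta>\<^sub>p) < 1"
    and R: "0 < R" "R + 1 \<le> Z \<theta>"
    and future: "\<And>u. \<theta> \<le> u \<Longrightarrow> - R / 2 - \<kappa> * (u - \<theta>) powr \<gamma> \<le> Z u - Z \<theta>"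
    and \<kappa>: "0 \<le> \<kappa>" "2 * \<kappa> \<le> B\<^sub>p * (1 - \<beta>\<^sub>p) * \<kappa> powr \<beta>\<^sub>p"
  shows "t \<in> {0..\<tau> * \<theta>} \<Longrightarrow> - (D * (m + 1)) \<le> x t"
    and "t \<in> {\<tau> * \<theta>..T} \<Longrightarrow> \<kappa> * (t - \<tau> * \<theta>) powr \<gamma> \<le> x t"
proof -
  have \<tau>0: "0 < \<tau>" using D by (simp add: \<tau>)
  have \<gamma>: "(1 - \<beta>\<^sub>p) * \<gamma> = 1" using params by (simp add: \<gamma>_def)
  define s where "s = \<tau> * \<theta>"
  have s: "0 \<le> s" "s \<le> \<tau> * K" using \<tau>0 K by (auto simp: s_def)
  have gK: "\<bar>g t\<bar> \<le> D * m" if "t \<in> {0..\<tau> * K}" for t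
  proof -
    have "t / \<tau> \<in> {0..K}" using that \<tau>0 by (auto simp: pos_divide_le_eq mult.commute)
    from m(2)[OF this] show ?thesis using D by (simp add: gZ abs_mult)
  qed
  have drift_small: "\<tau> * K * (B\<^sub>m * (D * m + D) powr \<beta>\<^sub>m) < D"
  proof -
    have "(D * m + D) powr \<beta>\<^sub>m = D powr \<beta>\<^sub>m * (m + 1) powr \<beta>\<^sub>m"
      using D m powr_mult[of D "m + 1" \<beta>\<^sub>m] by (simp add: distrib_left)
    then have "\<tau> * K * (B\<^sub>m * (D * m + D) powr \<beta>\<^sub>m) = K * (B\<^sub>m * (m + 1) powr \<beta>\<^sub>m) * (\<tau> * D powr \<beta>\<^sub>m)"
      by (simp only: mult_ac)
    also have "\<tau> * D powr \<beta>\<^sub>m = D powr (\<beta>\<^sub>m - \<beta>\<^sub>p) * D powr 1"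
      unfolding \<tau> powr_add[symmetric] by (rule arg_cong[where f = "\<lambda>p. D powr p"]) simp
    also have "K * (B\<^sub>m * (m + 1) powr \<beta>\<^sub>m) * (D powr (\<beta>\<^sub>m - \<beta>\<^sub>p) * D powr 1)
        = K * (B\<^sub>m * (m + 1) powr \<beta>\<^sub>m) * D powr (\<beta>\<^sub>m - \<beta>\<^sub>p) * D"
      using D by simp
    also have "\<dots> < 1 * D" using small D by (rule mult_strict_right_mono)
    finally show ?thesis by simp
  qed
  have low: "g t - D \<le> x t" if "t \<in> {0..\<tau> * K}" for t
  proof (rule short_time_lower_bound[OF K(3) D _ _ drift_small that])
    show "0 \<le> D * m" using D m by simp
    show "- (D * m) \<le> g t" if "t \<in> {0..\<tau> * K}" for t using gK[OF that] by linarith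
  qed
  show "- (D * (m + 1)) \<le> x t" if "t \<in> {0..\<tau> * \<theta>}"
  proof -
    have "t \<in> {0..\<tau> * K}" using that s by (auto simp: s_def)
    from low[OF this] gK[OF this] show ?thesis by (simp add: distrib_left)
  qed
  have "D * (R + 1) \<le> g s"
    using R(2) D \<tau>0 by (simp add: gZ s_def)
  then have xs: "D * R \<le> x s" using low[of s] s by (simp add: distrib_left)
  have above: "\<kappa> * (t - s) powr \<gamma> \<le> x t" if "t \<in> {s..T}" for t
    unfolding \<gamma>_def
  proof (rule stays_above_power_curve[OF s(1) _ xs \<kappa> _ that])
    show "0 < D * R" using D R by simp
    fix t assume t: "t \<in> {s..T}"
    have "\<tau> powr \<gamma> = D" using D \<gamma> by (simp add: \<tau> powr_powr)
    then have D\<tau>: "D * ((t - s) / \<tau>) powr \<gamma> = (t - s) powr \<gamma>"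
      using D \<tau>0 t by (simp add: powr_divide)
    have ts: "t / \<tau> - \<theta> = (t - s) / \<tau>" using \<tau>0 by (simp add: s_def diff_divide_distrib)
    have "0 \<le> (t - s) / \<tau>" using t \<tau>0 by simp
    then have "\<theta> \<le> t / \<tau>" unfolding ts[symmetric] by simp
    from mult_left_mono[OF future[OF this] less_imp_le[OF D]]
    have "D * (- R / 2 - \<kappa> * ((t - s) / \<tau>) powr \<gamma>) \<le> D * (Z (t / \<tau>) - Z \<theta>)" unfolding ts .
    also have "\<dots> = g t - g s" using \<tau>0 by (simp add: gZ s_def right_diff_distrib)
    also have "D * (- R / 2 - \<kappa> * ((t - s) / \<tau>) powr \<gamma>) = - (D * R) / 2 - \<kappa> * (D * ((t - s) / \<tau>) powr \<gamma>)"
      by (simp add: right_diff_distrib)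
    finally show "- (D * R) / 2 - \<kappa> * (t - s) powr (1 / (1 - \<beta>\<^sub>p)) \<le> g t - g s"
      unfolding D\<tau> unfolding \<gamma>_def .
  qed
  show "\<kappa> * (t - \<tau> * \<theta>) powr \<gamma> \<le> x t" if "t \<in> {\<tau> * \<theta>..T}"
    by (rule above[unfolded s_def, OF that])
qed

lemma continuous_on_extremal_path: "0 < \<beta> \<Longrightarrow> \<beta> < 1 \<Longrightarrow> continuous_on {0..} (extremal_path B \<beta>)"
  unfolding extremal_path_def by (intro continuous_intros continuous_on_powr') auto

lemma extremal_path_0: "extremal_path B \<beta> 0 = 0"
  by (simp add: extremal_path_def)

text \<open>The path is squeezed between the extremal path started ahead by \<open>a\<close> and the one delayed by \<open>s + a\<close>. The
lead and the delay provide the margins against the noise: at time 0 the former has height \<open>P a\<close>, and at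
time \<open>s + a\<close>, when the latter starts, the path is at least at \<open>\<kappa> * a powr \<gamma>\<close>. Uniform continuity of the
extremal path makes the gap small.\<close>

lemma escaped_path_near_extremal:
  fixes B\<^sub>p B\<^sub>m \<beta>\<^sub>p \<beta>\<^sub>m T \<delta> \<kappa> :: real
  defines "\<gamma> \<equiv> 1 / (1 - \<beta>\<^sub>p)"
  assumes params: "0 < B\<^sub>p" "0 < B\<^sub>m" "0 < \<beta>\<^sub>p" "\<beta>\<^sub>p < 1" and T: "0 < T" and \<delta>: "0 < \<delta>" and \<kappa>: "0 < \<kappa>"
  obtains a m where "0 < a" "0 < m"
    "\<And>x g s t. driven_path B\<^sub>p B\<^sub>m \<beta>\<^sub>p \<beta>\<^sub>m T x g \<Longrightarrow> (\<And>t. t \<in> {0..T} \<Longrightarrow> \<bar>g t\<bar> \<le> m) \<Longrightarrow> 0 \<le> s \<Longrightarrow> s \<le> a \<Longrightarrow>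
      (\<And>t. t \<in> {0..s} \<Longrightarrow> - \<delta> / 2 \<le> x t) \<Longrightarrow> (\<And>t. t \<in> {s..T} \<Longrightarrow> \<kappa> * (t - s) powr \<gamma> \<le> x t) \<Longrightarrow>
      t \<in> {0..T} \<Longrightarrow> \<bar>x t - extremal_path B\<^sub>p \<beta>\<^sub>p t\<bar> \<le> \<delta>"
proof -
  define P where "P = extremal_path B\<^sub>p \<beta>\<^sub>p"
  have P_cont: "continuous_on {0..} P" unfolding P_def using params by (intro continuous_on_extremal_path)
  have "uniformly_continuous_on {0..T + 2} P"
    by (rule compact_uniformly_continuous[OF continuous_on_subset[OF P_cont]]) auto
  then obtain d where d: "0 < d" "\<And>u v. u \<in> {0..T + 2} \<Longrightarrow> v \<in> {0..T + 2} \<Longrightarrow> \<bar>u - v\<bar> < d \<Longrightarrow> \<bar>P u - P v\<bar> < \<delta> / 2"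
    unfolding uniformly_continuous_on_def dist_real_def using \<delta> by (metis half_gt_zero)
  (* The bound 1 keeps t + a inside the interval {0..T + 2} of uniform continuity. *)
  define a where "a = Min {1, d / 3, T}"
  have a: "0 < a" "a \<le> 1" "2 * a < d" using d T by (auto simp: a_def)
  define m where "m = min (\<kappa> * a powr \<gamma>) (P a) / 4"
  have Pa: "0 < P a" using params a by (simp add: P_def extremal_path_def)
  have m: "0 < m" "2 * m < \<kappa> * a powr \<gamma>" "3 * m < P a"
    using Pa \<kappa> a by (auto simp: m_def min_def)
  have shifted: "continuous_on {s..T} (\<lambda>t. P (t - v))" if "v \<le> s" for s v
    using that by (intro continuous_on_compose2[OF P_cont] continuous_intros) auto
  have "\<bar>x t - P t\<bar> \<le> \<delta>"
    if dp: "driven_path B\<^sub>p B\<^sub>m \<beta>\<^sub>p \<beta>\<^sub>m T x g" and g: "\<And>t. t \<in> {0..T} \<Longrightarrow> \<bar>g t\<bar> \<le> m" and s: "0 \<le> s" "s \<le> a"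
      and before: "\<And>t. t \<in> {0..s} \<Longrightarrow> - \<delta> / 2 \<le> x t" and after: "\<And>t. t \<in> {s..T} \<Longrightarrow> \<kappa> * (t - s) powr \<gamma> \<le> x t"
      and t: "t \<in> {0..T}" for x g s t
  proof -
    interpret driven_path B\<^sub>p B\<^sub>m \<beta>\<^sub>p \<beta>\<^sub>m T x g by fact
    have W: "((\<lambda>u. b (P (u - v))) has_integral P (t - v) - P (s - v)) {s..t}" if "t \<in> {s..T}" "v \<le> s" for s t v
      unfolding P_def using params that by (intro extremal_path_integral_equation) auto
    have "x t \<le> P (t - (- a))"
    proof (rule below_solution[where s = 0 and m = m])
      have "x 0 = g 0" using equation[of 0] T by simp
      then show "x 0 + 2 * m < P (0 - - a)" using g[of 0] T m by simp
    qed (use g W[of _ 0 "- a"] shifted[of "- a" 0] a t in auto)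
    moreover have "\<bar>P (t - (- a)) - P t\<bar> < \<delta> / 2" using t a by (intro d) auto
    moreover have "- \<delta> \<le> x t - P t"
    proof (cases "t \<le> s + a")
      case True
      have "- \<delta> / 2 \<le> x t"
      proof (cases "t \<le> s")
        case True then show ?thesis using before t by auto
      next
        case False
        then have "\<kappa> * (t - s) powr \<gamma> \<le> x t" using t by (intro after) auto
        moreover have "0 \<le> \<kappa> * (t - s) powr \<gamma>" using \<kappa> by simp
        ultimately show ?thesis using \<delta> by linarith
      qed
      moreover have "\<bar>P t - P 0\<bar> < \<delta> / 2" using t a s True by (intro d) auto
      moreover have "P 0 = 0" by (simp add: P_def extremal_path_0)
      ultimately show ?thesis by linarith
    next
      case False
      have "P (t - (s + a)) \<le> x t"
      proof (rule above_solution[where s = "s + a" and m = m])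
        have "\<kappa> * (s + a - s) powr \<gamma> \<le> x (s + a)" using False t a by (intro after) auto
        then show "P (s + a - (s + a)) + 2 * m < x (s + a)"
          using m by (simp add: P_def extremal_path_0)
      qed (use g W[of _ "s + a" "s + a"] shifted[of "s + a" "s + a"] a s t False in auto)
      moreover have "\<bar>P (t - (s + a)) - P t\<bar> < \<delta> / 2" using t a s False by (intro d) auto
      ultimately show ?thesis using \<delta> by linarith
    qed
    ultimately show ?thesis using \<delta> by linarith
  qed
  then show ?thesis using a(1) m(1) that unfolding P_def by blast
qed

lemma solution_driven_path:
  assumes params: "0 < B\<^sub>p" "0 < B\<^sub>m" "0 < \<beta>\<^sub>p" "\<beta>\<^sub>p < 1" "0 < \<beta>\<^sub>m"
    and cad: "cadlag_on {0..} x"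
    and eq: "\<And>t. 0 \<le> t \<Longrightarrow> x t = (LINT s:{0..t}|lborel. drift B\<^sub>p B\<^sub>m \<beta>\<^sub>p \<beta>\<^sub>m (x s)) + g t"
  shows "driven_path B\<^sub>p B\<^sub>m \<beta>\<^sub>p \<beta>\<^sub>m T x g"
proof -
  have int: "set_integrable lborel {0..t} (\<lambda>s. drift B\<^sub>p B\<^sub>m \<beta>\<^sub>p \<beta>\<^sub>m (x s))" for t
    using mono_drift params by (intro set_integrable_mono_of_cadlag[OF _ cad]) auto
  show ?thesis
  proof
    show "(\<lambda>s. drift B\<^sub>p B\<^sub>m \<beta>\<^sub>p \<beta>\<^sub>m (x s)) integrable_on {0..T}"
      using set_borel_integral_eq_integral(1)[OF int] .
    fix t assume "t \<in> {0..T}"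
    then show "x t = integral {0..t} (\<lambda>s. drift B\<^sub>p B\<^sub>m \<beta>\<^sub>p \<beta>\<^sub>m (x s)) + g t"
      using eq[of t] set_borel_integral_eq_integral(2)[OF int, of t] by simp
  qed (use params in auto)
qed

section \<open>Selection in probability\<close>

text \<open>The number \<open>n\<close> of visiting times, the level \<open>R\<close>, the times \<open>\<Theta>\<close> and the bound \<open>m\<^sub>K\<close> for the noise on their
range are chosen, in this order, for all stable noise of index \<open>\<alpha>\<close> and intensity \<open>\<sigma>\<close> at once. They can
therefore be applied to the rescaled copy \<open>Z\<close> of the noise, which varies with \<open>\<epsilon>\<close>, and \<open>\<epsilon>\<close> tends to 0
after they are fixed.\<close>

proposition selection_in_probability:
  fixes M :: "'a measure" and X :: "real \<Rightarrow> real \<Rightarrow> 'a \<Rightarrow> real"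
  assumes noise: "stable_noise M F L \<alpha> \<sigma>"
    and params: "0 < B\<^sub>p" "0 < B\<^sub>m" "0 < \<beta>\<^sub>p" "\<beta>\<^sub>p < 1" "\<beta>\<^sub>p < \<beta>\<^sub>m" "1 - \<beta>\<^sub>p < \<alpha>"
    and cad: "\<And>\<epsilon> \<omega>. 0 < \<epsilon> \<Longrightarrow> \<omega> \<in> space M \<Longrightarrow> cadlag_on {0..} (\<lambda>t. X \<epsilon> t \<omega>)"
    and eq: "\<And>\<epsilon>. 0 < \<epsilon> \<Longrightarrow> AE \<omega> in M. \<forall>t\<ge>0. X \<epsilon> t \<omega> =
      (LINT s:{0..t}|lborel. drift B\<^sub>p B\<^sub>m \<beta>\<^sub>p \<beta>\<^sub>m (X \<epsilon> s \<omega>)) + \<epsilon> * L t \<omega>"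
    and T: "0 < T" and \<delta>: "0 < \<delta>" and \<eta>: "0 < \<eta>"
  shows "\<forall>\<^sub>F \<epsilon> in at_right 0. likely M \<eta> (\<lambda>\<omega>. \<forall>t\<in>{0..T}. \<bar>X \<epsilon> t \<omega> - extremal_path B\<^sub>p \<beta>\<^sub>p t\<bar> \<le> \<delta>)"
proof -
  interpret stable_noise M F L \<alpha> \<sigma> by (rule noise)
  define \<gamma> where "\<gamma> = 1 / (1 - \<beta>\<^sub>p)"
  have \<gamma>: "0 < \<gamma>" "(1 - \<beta>\<^sub>p) * \<gamma> = 1" using params by (auto simp: \<gamma>_def)
  have \<alpha>\<gamma>: "1 < \<alpha> * \<gamma>" using params by (simp add: \<gamma>_def field_simps)
  (* This kappa turns the condition 2 * kappa <= B (1 - beta) kappa powr beta into an equality. *)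
  define \<kappa> where "\<kappa> = (B\<^sub>p * (1 - \<beta>\<^sub>p) / 2) powr \<gamma>"
  have half: "0 < B\<^sub>p * (1 - \<beta>\<^sub>p) / 2" using params by simp
  have \<kappa>: "0 < \<kappa>" using params by (simp add: \<kappa>_def)
  have "\<kappa> = \<kappa> powr (1 - \<beta>\<^sub>p) * \<kappa> powr \<beta>\<^sub>p" using \<kappa> by (simp flip: powr_add)
  also have "\<kappa> powr (1 - \<beta>\<^sub>p) = B\<^sub>p * (1 - \<beta>\<^sub>p) / 2"
    using half \<gamma>(2) by (simp add: \<kappa>_def powr_powr mult.commute)
  finally have \<kappa>_drift: "2 * \<kappa> \<le> B\<^sub>p * (1 - \<beta>\<^sub>p) * \<kappa> powr \<beta>\<^sub>p" by simp

  obtain a m\<^sub>T where a: "0 < a" and m\<^sub>T: "0 < m\<^sub>T"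
    and near: "\<And>x g s t. driven_path B\<^sub>p B\<^sub>m \<beta>\<^sub>p \<beta>\<^sub>m T x g \<Longrightarrow> (\<And>t. t \<in> {0..T} \<Longrightarrow> \<bar>g t\<bar> \<le> m\<^sub>T) \<Longrightarrow> 0 \<le> s \<Longrightarrow> s \<le> a \<Longrightarrow>
      (\<And>t. t \<in> {0..s} \<Longrightarrow> - \<delta> / 2 \<le> x t) \<Longrightarrow> (\<And>t. t \<in> {s..T} \<Longrightarrow> \<kappa> * (t - s) powr \<gamma> \<le> x t) \<Longrightarrow>
      t \<in> {0..T} \<Longrightarrow> \<bar>x t - extremal_path B\<^sub>p \<beta>\<^sub>p t\<bar> \<le> \<delta>"
    using escaped_path_near_extremal[OF params(1-4) T \<delta> \<kappa>, of \<beta>\<^sub>m] unfolding \<gamma>_def by blast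

  have \<eta>4: "0 < \<eta> / 4" using \<eta> by simp
  obtain n where high: "\<And>A. 0 < A \<Longrightarrow> \<exists>\<Theta>. finite \<Theta> \<and> \<Theta> \<subseteq> {0<..} \<and> card \<Theta> \<le> n \<and>
      (\<forall>(M :: 'a measure) F L. stable_noise M F L \<alpha> \<sigma> \<longrightarrow> likely M (\<eta> / 4) (\<lambda>\<omega>. \<exists>s\<in>\<Theta>. A \<le> L s \<omega> - L 0 \<omega>))"
    using noise_eventually_high[OF index(1) \<eta>4 intensity] by blast
  (* The failure probability allowed for each of the at most n visiting times. *)
  define \<eta>' where "\<eta>' = \<eta> / 4 / (real n + 1)"
  have \<eta>': "0 < \<eta>'" using \<eta> by (simp add: \<eta>'_def)
  have "N * (e / N) = e" if "0 < N" for N e :: real using that by simp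
  then have n\<eta>': "(real n + 1) * \<eta>' = \<eta> / 4" unfolding \<eta>'_def by this simp
  obtain R where R: "0 < R"
    and above: "\<And>(M :: 'a measure) F L s. stable_noise M F L \<alpha> \<sigma> \<Longrightarrow> 0 \<le> s \<Longrightarrow>
      likely M \<eta>' (\<lambda>\<omega>. \<forall>t\<ge>s. - R / 2 - \<kappa> * (t - s) powr \<gamma> \<le> L t \<omega> - L s \<omega>)"
    using noise_above_power_curve[OF \<alpha>\<gamma> \<kappa> \<eta>' index(1)] by blast
  obtain \<Theta> where \<Theta>: "finite \<Theta>" "\<Theta> \<subseteq> {0<..}" "card \<Theta> \<le> n"
    and visit: "\<And>(M :: 'a measure) F L. stable_noise M F L \<alpha> \<sigma> \<Longrightarrow> likely M (\<eta> / 4) (\<lambda>\<omega>. \<exists>s\<in>\<Theta>. R + 1 \<le> L s \<omega> - L 0 \<omega>)"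
    using high[of "R + 1"] R by auto
  define K where "K = Max (insert 1 \<Theta>)"
  have "1 \<le> K" unfolding K_def using \<Theta>(1) by (intro Max_ge) auto
  then have K: "0 < K" by simp
  have \<Theta>K: "s \<le> K" if "s \<in> \<Theta>" for s
    unfolding K_def using \<Theta>(1) that by (intro Max_ge) auto
  obtain m\<^sub>K where m\<^sub>K: "0 < m\<^sub>K"
    and bounded_K: "\<forall>(N :: 'a measure) G Z. stable_noise N G Z \<alpha> \<sigma> \<longrightarrow> likely N (\<eta> / 4) (\<lambda>\<omega>. \<forall>t\<in>{0..K}. \<bar>Z t \<omega> - Z 0 \<omega>\<bar> \<le> m\<^sub>K)"
    using noise_bounded_with_high_probability[OF less_imp_le[OF K] \<eta>4 index(1), of \<sigma>] by blast
  obtain y where y: "0 < y"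
    and bounded_T: "\<forall>(N :: 'a measure) G Z. stable_noise N G Z \<alpha> \<sigma> \<longrightarrow> likely N (\<eta> / 4) (\<lambda>\<omega>. \<forall>t\<in>{0..T}. \<bar>Z t \<omega> - Z 0 \<omega>\<bar> \<le> y)"
    using noise_bounded_with_high_probability[OF less_imp_le[OF T] \<eta>4 index(1), of \<sigma>] by blast

  define d where "d \<epsilon> = \<epsilon> powr (\<alpha> / (\<alpha> - (1 - \<beta>\<^sub>p)))" for \<epsilon> :: real
  have d0: "(d \<longlongrightarrow> 0) (at_right 0)"
    unfolding d_def using params index
    by (intro tendsto_zero_powrI[OF tendsto_ident_at tendsto_const] eventually_mono[OF eventually_at_right_less]) auto
  have d_powr0: "((\<lambda>\<epsilon>. d \<epsilon> powr p) \<longlongrightarrow> 0) (at_right 0)" if "0 < p" for p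
    using that by (intro tendsto_zero_powrI[OF d0 tendsto_const]) (auto simp: d_def)
  have "((\<lambda>\<epsilon>. d \<epsilon> powr (1 - \<beta>\<^sub>p) * K) \<longlongrightarrow> 0 * K) (at_right 0)"
    using params by (intro tendsto_intros d_powr0) auto
  then have e1: "\<forall>\<^sub>F \<epsilon> in at_right 0. d \<epsilon> powr (1 - \<beta>\<^sub>p) * K < min a T"
    using a T by (intro order_tendstoD(2)) auto
  have "((\<lambda>\<epsilon>. K * (B\<^sub>m * (m\<^sub>K + 1) powr \<beta>\<^sub>m) * d \<epsilon> powr (\<beta>\<^sub>m - \<beta>\<^sub>p)) \<longlongrightarrow> K * (B\<^sub>m * (m\<^sub>K + 1) powr \<beta>\<^sub>m) * 0) (at_right 0)"
    using params by (intro tendsto_intros d_powr0) auto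
  then have e2: "\<forall>\<^sub>F \<epsilon> in at_right 0. K * (B\<^sub>m * (m\<^sub>K + 1) powr \<beta>\<^sub>m) * d \<epsilon> powr (\<beta>\<^sub>m - \<beta>\<^sub>p) < 1"
    by (intro order_tendstoD(2)) auto
  have "((\<lambda>\<epsilon>. d \<epsilon> * (m\<^sub>K + 1)) \<longlongrightarrow> 0 * (m\<^sub>K + 1)) (at_right 0)" by (intro tendsto_intros d0)
  then have e3: "\<forall>\<^sub>F \<epsilon> in at_right 0. d \<epsilon> * (m\<^sub>K + 1) < \<delta> / 2"
    using \<delta> by (intro order_tendstoD(2)) auto
  have "((\<lambda>\<epsilon>. \<epsilon> * y) \<longlongrightarrow> 0 * y) (at_right 0)" by (intro tendsto_intros)
  then have e4: "\<forall>\<^sub>F \<epsilon> in at_right 0. \<epsilon> * y < m\<^sub>T"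
    using m\<^sub>T by (intro order_tendstoD(2)) auto

  show ?thesis using e1 e2 e3 e4 eventually_at_right_less[of 0]
  proof eventually_elim
    case (elim \<epsilon>)
    define D where "D = d \<epsilon>"
    define \<tau> where "\<tau> = D powr (1 - \<beta>\<^sub>p)"
    define c where "c = \<tau> powr (- 1 / \<alpha>)"
    have D: "0 < D" using elim by (simp add: D_def d_def)
    have \<tau>: "0 < \<tau>" using D by (simp add: \<tau>_def)
    have c0: "0 < c" using \<tau> by (simp add: c_def)
    have "c powr \<alpha> = \<tau> powr - 1" unfolding c_def powr_powr using index by simp
    then have c: "\<bar>c\<bar> powr \<alpha> * \<tau> = 1" using \<tau> c0 by (simp add: powr_neg_one)
    (* The defining property of D: eps times the noise over the duration tau is of size D. *)
    have \<epsilon>: "\<epsilon> = D * c"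
    proof -
      have "D * c = D powr 1 * D powr ((1 - \<beta>\<^sub>p) * (- 1 / \<alpha>))"
        using D by (simp add: c_def \<tau>_def powr_powr)
      also have "\<dots> = D powr (1 + (1 - \<beta>\<^sub>p) * (- 1 / \<alpha>))" by (rule powr_add[symmetric])
      also have "\<dots> = \<epsilon> powr (\<alpha> / (\<alpha> - (1 - \<beta>\<^sub>p)) * (1 + (1 - \<beta>\<^sub>p) * (- 1 / \<alpha>)))"
        unfolding D_def d_def powr_powr ..
      also have "1 + (1 - \<beta>\<^sub>p) * (- 1 / \<alpha>) = (\<alpha> - (1 - \<beta>\<^sub>p)) / \<alpha>"
        using index by (simp add: field_simps)
      also have "\<alpha> / (\<alpha> - (1 - \<beta>\<^sub>p)) * ((\<alpha> - (1 - \<beta>\<^sub>p)) / \<alpha>) = 1"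
        using index params by simp
      finally show ?thesis using elim by simp
    qed
    define Z where "Z u \<omega> = c * L (\<tau> * u) \<omega>" for u \<omega>
    have Z: "stable_noise M (\<lambda>t. F (\<tau> * t)) Z \<alpha> \<sigma>"
      unfolding Z_def[abs_def] by (rule stable_noise_rescale[OF noise \<tau> c])
    have ZL: "\<epsilon> * L t \<omega> = D * Z (t / \<tau>) \<omega>" for t \<omega>
      using \<tau> by (simp add: Z_def \<epsilon>)
    have futures: "likely M (card \<Theta> * \<eta>') (\<lambda>\<omega>. \<forall>s\<in>\<Theta>. \<forall>t\<ge>s. - R / 2 - \<kappa> * (t - s) powr \<gamma> \<le> Z t \<omega> - Z s \<omega>)"
    proof (rule likely_Ball[OF \<Theta>(1)])
      fix s assume "s \<in> \<Theta>"
      then show "likely M \<eta>' (\<lambda>\<omega>. \<forall>t\<ge>s. - R / 2 - \<kappa> * (t - s) powr \<gamma> \<le> Z t \<omega> - Z s \<omega>)"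
        using \<Theta>(2) by (intro above[OF Z]) auto
    qed
    note likely_conj[OF likely_conj[OF likely_conj[OF likely_conj[OF likely_conj[OF
      visit[OF Z] futures] bounded_K[rule_format, OF Z]] bounded_T[rule_format, OF noise]]
      likely_of_AE[OF start]] likely_of_AE[OF eq[OF elim(5)]]]
    then show ?case
    proof (rule likely_mono)
      have "card \<Theta> * \<eta>' \<le> (real n + 1) * \<eta>'" using \<Theta>(3) \<eta>' by (intro mult_right_mono) auto
      also note n\<eta>'
      finally show "\<eta> / 4 + card \<Theta> * \<eta>' + \<eta> / 4 + \<eta> / 4 + 0 + 0 \<le> \<eta>" by simp
      fix \<omega> assume \<omega>: "\<omega> \<in> space M"
      define x where "x t = X \<epsilon> t \<omega>" for t
      define g where "g t = \<epsilon> * L t \<omega>" for t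
      assume good: "(((((\<exists>s\<in>\<Theta>. R + 1 \<le> Z s \<omega> - Z 0 \<omega>) \<and>
        (\<forall>s\<in>\<Theta>. \<forall>t\<ge>s. - R / 2 - \<kappa> * (t - s) powr \<gamma> \<le> Z t \<omega> - Z s \<omega>)) \<and>
        (\<forall>t\<in>{0..K}. \<bar>Z t \<omega> - Z 0 \<omega>\<bar> \<le> m\<^sub>K)) \<and>
        (\<forall>t\<in>{0..T}. \<bar>L t \<omega> - L 0 \<omega>\<bar> \<le> y)) \<and> L 0 \<omega> = 0) \<and>
        (\<forall>t\<ge>0. X \<epsilon> t \<omega> = (LINT s:{0..t}|lborel. drift B\<^sub>p B\<^sub>m \<beta>\<^sub>p \<beta>\<^sub>m (X \<epsilon> s \<omega>)) + \<epsilon> * L t \<omega>)"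
      obtain \<theta> where \<theta>: "\<theta> \<in> \<Theta>" "R + 1 \<le> Z \<theta> \<omega> - Z 0 \<omega>"
        using good[THEN conjunct1, THEN conjunct1, THEN conjunct1, THEN conjunct1, THEN conjunct1] by (rule bexE)
      note Zfut = good[THEN conjunct1, THEN conjunct1, THEN conjunct1, THEN conjunct1, THEN conjunct2, rule_format, OF \<theta>(1)]
      note ZK = good[THEN conjunct1, THEN conjunct1, THEN conjunct1, THEN conjunct2, rule_format]
      note LT = good[THEN conjunct1, THEN conjunct1, THEN conjunct2, rule_format]
      note L0 = good[THEN conjunct1, THEN conjunct2]
      have eq\<omega>: "x t = (LINT s:{0..t}|lborel. drift B\<^sub>p B\<^sub>m \<beta>\<^sub>p \<beta>\<^sub>m (x s)) + g t" if "0 \<le> t" for t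
        unfolding x_def g_def by (rule good[THEN conjunct2, rule_format, OF that])
      have Z0: "Z 0 \<omega> = 0" using L0 by (simp add: Z_def)
      have gZ: "g t = D * Z (t / \<tau>) \<omega>" for t unfolding g_def by (rule ZL)
      have \<beta>m: "0 < \<beta>\<^sub>m" using params by simp
      have dp: "driven_path B\<^sub>p B\<^sub>m \<beta>\<^sub>p \<beta>\<^sub>m T x g"
        using cad[OF _ \<omega>, of \<epsilon>] elim eq\<omega> params \<beta>m unfolding x_def[symmetric]
        by (intro solution_driven_path) auto
      interpret driven_path B\<^sub>p B\<^sub>m \<beta>\<^sub>p \<beta>\<^sub>m T x g by (rule dp)
      have \<theta>K: "0 \<le> \<theta>" "\<theta> \<le> K" using \<theta> \<Theta>(2) \<Theta>K by (auto simp: less_imp_le)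
      have \<tau>K: "\<tau> * K < a" "\<tau> * K < T" using elim(1) by (simp_all add: \<tau>_def D_def)
      have ZK0: "\<bar>Z u \<omega>\<bar> \<le> m\<^sub>K" if "u \<in> {0..K}" for u using ZK[OF that] Z0 by simp
      have R\<theta>: "R + 1 \<le> Z \<theta> \<omega>" using \<theta>(2) Z0 by simp
      note escape' = escape_behind_high_noise[OF D \<tau>_def gZ \<theta>K less_imp_le[OF \<tau>K(2)] less_imp_le[OF m\<^sub>K] ZK0
          elim(2)[folded D_def] R R\<theta> Zfut[unfolded \<gamma>_def] less_imp_le[OF \<kappa>] \<kappa>_drift, folded \<gamma>_def]
      have escape: "- (D * (m\<^sub>K + 1)) \<le> x t" if "t \<in> {0..\<tau> * \<theta>}" for t
        by (rule escape'(1)) (use that in auto)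
      have escaped: "\<kappa> * (t - \<tau> * \<theta>) powr \<gamma> \<le> x t" if "t \<in> {\<tau> * \<theta>..T}" for t
        by (rule escape'(2)) (use that in auto)
      have s: "0 \<le> \<tau> * \<theta>" "\<tau> * \<theta> \<le> \<tau> * K" using \<tau> \<theta>K by simp_all
      have small_noise: "\<bar>g t\<bar> \<le> m\<^sub>T" if "t \<in> {0..T}" for t
      proof -
        have "\<bar>g t\<bar> = \<epsilon> * \<bar>L t \<omega>\<bar>" using elim(5) by (simp add: g_def abs_mult)
        also have "\<dots> \<le> \<epsilon> * y" using LT[OF that] L0 elim(5) by (intro mult_left_mono) simp_all
        finally show ?thesis using elim(4) by simp
      qed
      have before: "- \<delta> / 2 \<le> x t" if "t \<in> {0..\<tau> * \<theta>}" for t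
        using escape[OF that] elim(3) unfolding D_def by linarith
      show "\<forall>t\<in>{0..T}. \<bar>X \<epsilon> t \<omega> - extremal_path B\<^sub>p \<beta>\<^sub>p t\<bar> \<le> \<delta>"
        unfolding x_def[symmetric]
      proof
        fix t assume "t \<in> {0..T}"
        then show "\<bar>x t - extremal_path B\<^sub>p \<beta>\<^sub>p t\<bar> \<le> \<delta>"
          using s \<tau>K(1) by (intro near[OF dp small_noise s(1) _ before escaped]) simp_all
      qed
    qed
  qed
qed

section \<open>Weak convergence\<close>

text \<open>A bounded continuous \<open>f\<close> is close to \<open>f z\<close> on a Skorokhod ball around \<open>z\<close>, which contains the uniform ball of half
the radius; the event that the path leaves the latter contributes at most \<open>2 * C\<close> times its small
probability.\<close>

lemma weakly_converges_return:
  fixes M :: "'a measure" and X :: "real \<Rightarrow> real \<Rightarrow> 'a \<Rightarrow> real"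
  assumes prob: "prob_space M" and T: "0 < T"
    and meas: "\<And>\<epsilon> t. 0 < \<epsilon> \<Longrightarrow> 0 \<le> t \<Longrightarrow> X \<epsilon> t \<in> borel_measurable M"
    and cad: "\<And>\<epsilon> \<omega>. 0 < \<epsilon> \<Longrightarrow> \<omega> \<in> space M \<Longrightarrow> cadlag_on {0..} (\<lambda>t. X \<epsilon> t \<omega>)"
    and z: "restrict z {0..T} \<in> skorokhod_space T"
    and conv: "\<And>\<delta> \<eta>. 0 < \<delta> \<Longrightarrow> 0 < \<eta> \<Longrightarrow>
      \<forall>\<^sub>F \<epsilon> in at_right 0. likely M \<eta> (\<lambda>\<omega>. \<forall>t\<in>{0..T}. \<bar>X \<epsilon> t \<omega> - z t\<bar> \<le> \<delta>)"
  shows "weakly_converges (skorokhod_topology T) (\<lambda>\<epsilon>. path_law M T (X \<epsilon>))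
    (return (borel_algebra (skorokhod_topology T)) (restrict z {0..T})) (at_right 0)"
proof -
  interpret prob_space M by (rule prob)
  let ?B = "borel_algebra (skorokhod_topology T)"
  let ?z = "restrict z {0..T}"
  define \<pi> where "\<pi> \<epsilon> \<omega> = (\<lambda>t\<in>{0..T}. X \<epsilon> t \<omega>)" for \<epsilon> \<omega>
  have \<pi>[measurable]: "\<pi> \<epsilon> \<in> measurable M ?B" if "0 < \<epsilon>" for \<epsilon>
    unfolding \<pi>_def by (rule path_map_measurable[OF meas[OF that] cad[OF that] T])
  have law: "path_law M T (X \<epsilon>) = distr M ?B (\<pi> \<epsilon>)" for \<epsilon>
    by (simp add: path_law_def \<pi>_def[abs_def])
  show ?thesis unfolding weakly_converges_def
  proof (intro conjI allI impI)
    show "\<forall>\<^sub>F \<epsilon> in at_right 0. finite_measure (path_law M T (X \<epsilon>)) \<and> sets (path_law M T (X \<epsilon>)) = sets ?B"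
      using eventually_at_right_less[of 0]
    proof eventually_elim
      case (elim \<epsilon>)
      then have "prob_space (distr M ?B (\<pi> \<epsilon>))" by (intro prob_space_distr \<pi>)
      then show ?case by (simp add: law prob_space.finite_measure)
    qed
    have "prob_space (return ?B ?z)" using z by (intro prob_space_return) simp
    then show "finite_measure (return ?B ?z)" by (rule prob_space.finite_measure)
    show "sets (return ?B ?z) = sets ?B" by simp
    fix f :: "(real \<Rightarrow> real) \<Rightarrow> real"
    assume f: "continuous_map (skorokhod_topology T) euclideanreal f" and bf: "bounded (f ` topspace (skorokhod_topology T))"
    have fm[measurable]: "f \<in> borel_measurable ?B"
    proof (rule borel_measurableI)
      fix S :: "real set" assume "open S"
      then have "openin (skorokhod_topology T) {x \<in> topspace (skorokhod_topology T). f x \<in> S}"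
        by (intro openin_continuous_map_preimage[OF f]) auto
      then have "{x \<in> topspace (skorokhod_topology T). f x \<in> S} \<in> sets ?B"
        by (auto simp: sets_borel_algebra)
      then show "f -` S \<inter> space ?B \<in> sets ?B" by (simp add: vimage_def Int_def conj_commute)
    qed
    obtain C where C: "\<And>x. x \<in> skorokhod_space T \<Longrightarrow> \<bar>f x\<bar> \<le> C"
      using bf by (auto simp: bounded_iff)
    have C0: "0 \<le> C" using C[OF z] by linarith
    have \<pi>_space: "\<pi> \<epsilon> \<omega> \<in> skorokhod_space T" if "0 < \<epsilon>" "\<omega> \<in> space M" for \<epsilon> \<omega>
      using measurable_space[OF \<pi>[OF that(1)] that(2)] by simp
    have lim: "((\<lambda>\<epsilon>. \<integral>\<omega>. f (\<pi> \<epsilon> \<omega>) \<partial>M) \<longlongrightarrow> f ?z) (at_right 0)"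
    proof (rule tendstoI)
      fix e :: real assume e: "0 < e"
      have "\<exists>r>0. \<forall>x. x \<in> skorokhod_space T \<and> skorokhod_dist T ?z x < r \<longrightarrow> \<bar>f x - f ?z\<bar> < e / 2"
      proof -
        have "openin (skorokhod_topology T) {x \<in> topspace (skorokhod_topology T). f x \<in> ball (f ?z) (e / 2)}"
          by (intro openin_continuous_map_preimage[OF f]) auto
        then have "\<exists>r>0. Skorokhod.mball T ?z r \<subseteq> {x \<in> skorokhod_space T. f x \<in> ball (f ?z) (e / 2)}"
          using z e by (auto simp: skorokhod_topology_def Skorokhod.openin_mtopology)
        then show ?thesis using z by (fastforce simp: dist_real_def abs_minus_commute)
      qed
      then obtain r where r: "0 < r" "\<And>x. x \<in> skorokhod_space T \<Longrightarrow> skorokhod_dist T ?z x < r \<Longrightarrow> \<bar>f x - f ?z\<bar> < e / 2"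
        by blast
      define \<eta> where "\<eta> = e / (4 * (C + 1))"
      have \<eta>: "0 < \<eta>" using e C0 by (simp add: \<eta>_def)
      have "\<forall>\<^sub>F \<epsilon> in at_right 0. likely M \<eta> (\<lambda>\<omega>. \<forall>t\<in>{0..T}. \<bar>X \<epsilon> t \<omega> - z t\<bar> \<le> r / 2)"
        using r \<eta> by (intro conv) auto
      then show "\<forall>\<^sub>F \<epsilon> in at_right 0. dist (\<integral>\<omega>. f (\<pi> \<epsilon> \<omega>) \<partial>M) (f ?z) < e"
        using eventually_at_right_less[of 0]
      proof eventually_elim
        case (elim \<epsilon>)
        then obtain N where N: "N \<in> sets M" "prob N \<le> \<eta>"
          "\<And>\<omega>. \<omega> \<in> space M - N \<Longrightarrow> \<forall>t\<in>{0..T}. \<bar>X \<epsilon> t \<omega> - z t\<bar> \<le> r / 2"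
          by (auto simp: likely_def)
        have [measurable]: "\<pi> \<epsilon> \<in> measurable M ?B" using elim by (intro \<pi>)
        have bnd: "\<bar>f (\<pi> \<epsilon> \<omega>) - f ?z\<bar> \<le> e / 2 + 2 * C * indicator N \<omega>" if \<omega>: "\<omega> \<in> space M" for \<omega>
        proof (cases "\<omega> \<in> N")
          case True
          have "\<bar>f (\<pi> \<epsilon> \<omega>)\<bar> \<le> C" "\<bar>f ?z\<bar> \<le> C" using elim \<omega> z by (auto intro!: C \<pi>_space)
          then have "\<bar>f (\<pi> \<epsilon> \<omega>) - f ?z\<bar> \<le> e / 2 + 2 * C" using e by linarith
          then show ?thesis using True by simp
        next
          case False
          have "skorokhod_dist T ?z (\<pi> \<epsilon> \<omega>) \<le> r / 2"
            using N(3)[of \<omega>] \<omega> False r elim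
            by (intro skorokhod_dist_le[OF z \<pi>_space time_changes_id]) (auto simp: \<pi>_def abs_minus_commute)
          then have "\<bar>f (\<pi> \<epsilon> \<omega>) - f ?z\<bar> < e / 2" using r elim \<omega> by (intro r(2) \<pi>_space) auto
          then show ?thesis using False by simp
        qed
        have i1: "integrable M (\<lambda>\<omega>. f (\<pi> \<epsilon> \<omega>))"
          using C \<pi>_space elim by (intro integrable_const_bound[of _ C]) auto
        have i2: "integrable M (\<lambda>\<omega>. e / 2 + 2 * C * indicator N \<omega>)"
          using N by (intro Bochner_Integration.integrable_add integrable_const integrable_mult_right integrable_real_indicator) (auto simp: less_top[symmetric])
        have "\<bar>(\<integral>\<omega>. f (\<pi> \<epsilon> \<omega>) \<partial>M) - f ?z\<bar> = \<bar>\<integral>\<omega>. f (\<pi> \<epsilon> \<omega>) - f ?z \<partial>M\<bar>"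
          using i1 by (simp add: prob_space)
        also have "\<dots> \<le> (\<integral>\<omega>. \<bar>f (\<pi> \<epsilon> \<omega>) - f ?z\<bar> \<partial>M)" by (rule integral_abs_bound)
        also have "\<dots> \<le> (\<integral>\<omega>. e / 2 + 2 * C * indicator N \<omega> \<partial>M)"
          using i1 i2 bnd by (intro integral_mono) auto
        also have "\<dots> = e / 2 + 2 * C * prob N"
          using N i2 by (simp add: prob_space less_top[symmetric])
        also have "2 * C * prob N \<le> 2 * C * \<eta>" using N C0 by (intro mult_left_mono) auto
        also have "2 * C * \<eta> < e / 2" using e C0 by (simp add: \<eta>_def field_simps)
        finally show ?case by (simp add: dist_real_def)
      qed
    qed
    have ret: "(\<integral>x. f x \<partial>return ?B ?z) = f ?z" using z by (intro integral_return) auto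
    have "\<forall>\<^sub>F \<epsilon> in at_right 0. (\<integral>\<omega>. f (\<pi> \<epsilon> \<omega>) \<partial>M) = (\<integral>x. f x \<partial>path_law M T (X \<epsilon>))"
      using eventually_at_right_less[of 0]
      by eventually_elim (simp add: law integral_distr)
    with lim show "((\<lambda>\<epsilon>. \<integral>x. f x \<partial>path_law M T (X \<epsilon>)) \<longlongrightarrow> (\<integral>x. f x \<partial>return ?B ?z)) (at_right 0)"
      unfolding ret by (rule Lim_transform_eventually)
  qed
qed

lemma cadlag_on_continuous:
  assumes "continuous_on S x"
  shows "cadlag_on S x"
  unfolding cadlag_on_def
proof (intro ballI conjI)
  fix t assume "t \<in> S"
  with assms have "(x \<longlongrightarrow> x t) (at t within S)" by (simp add: continuous_on_def)
  then show "(x \<longlongrightarrow> x t) (at t within S \<inter> {t<..})" "\<exists>l. (x \<longlongrightarrow> l) (at t within S \<inter> {..<t})"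
    by (meson Int_lower1 tendsto_within_subset)+
qed

lemma cadlag_on_minus:
  assumes "cadlag_on S x"
  shows "cadlag_on S (\<lambda>t. - x t)"
  unfolding cadlag_on_def
proof (intro ballI conjI)
  fix t assume "t \<in> S"
  with assms obtain l where r: "(x \<longlongrightarrow> x t) (at t within S \<inter> {t<..})" and l: "(x \<longlongrightarrow> l) (at t within S \<inter> {..<t})"
    unfolding cadlag_on_def by blast
  show "((\<lambda>t. - x t) \<longlongrightarrow> - x t) (at t within S \<inter> {t<..})" by (rule tendsto_minus[OF r])
  show "\<exists>l. ((\<lambda>t. - x t) \<longlongrightarrow> l) (at t within S \<inter> {..<t})" using tendsto_minus[OF l] by blast
qed

lemma add_measure_scale_1_0:
  assumes "sets \<mu> = sets \<nu>"
  shows "add_measure (scale_measure 1 \<mu>) (scale_measure 0 \<nu>) = \<mu>"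
    and "add_measure (scale_measure 0 \<nu>) (scale_measure 1 \<mu>) = \<mu>"
proof -
  have s: "sets (add_measure (scale_measure 1 \<mu>) (scale_measure 0 \<nu>)) = sets \<mu>"
    "sets (add_measure (scale_measure 0 \<nu>) (scale_measure 1 \<mu>)) = sets \<nu>"
    using sets.space_closed[of \<mu>] sets.space_closed[of \<nu>]
    by (simp_all add: add_measure_def sets.sigma_sets_eq)
  show "add_measure (scale_measure 1 \<mu>) (scale_measure 0 \<nu>) = \<mu>"
    by (rule measure_eqI) (use assms s in \<open>auto simp: emeasure_add_measure\<close>)
  show "add_measure (scale_measure 0 \<nu>) (scale_measure 1 \<mu>) = \<mu>"
    by (rule measure_eqI) (use assms s in \<open>auto simp: emeasure_add_measure\<close>)
qed

lemma strong_solution_measurable: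
  assumes "strong_solution M L b \<epsilon> X" and L: "\<And>t. 0 \<le> t \<Longrightarrow> L t \<in> borel_measurable M" and t: "0 \<le> t"
  shows "X t \<in> borel_measurable M"
proof -
  let ?G = "{L s -` A \<inter> space M | s A. s \<in> {0..t} \<and> A \<in> sets borel} \<union> null_sets M"
  have "L s -` A \<inter> space M \<in> sets M" if "s \<in> {0..t}" "A \<in> sets borel" for s A
    using measurable_sets[OF L that(2)] that(1) by simp
  then have G: "?G \<subseteq> sets M" by auto
  then have "?G \<subseteq> Pow (space M)" using sets.space_closed by blast
  then have "subalgebra M (augmented_natural_filtration M L t)"
    unfolding subalgebra_def augmented_natural_filtration_def
    using sets.sigma_sets_subset[OF G] by (simp add: space_measure_of sets_measure_of)
  moreover have "X t \<in> borel_measurable (augmented_natural_filtration M L t)"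
    using assms(1) t by (simp add: strong_solution_def)
  ultimately show ?thesis by (rule measurable_from_subalg)
qed

theorem theorem1:
  fixes M :: "'a measure" and F :: "real \<Rightarrow> 'a measure"
    and L :: "real \<Rightarrow> 'a \<Rightarrow> real" and X :: "real \<Rightarrow> real \<Rightarrow> 'a \<Rightarrow> real"
    and \<alpha> \<beta>\<^sub>p \<beta>\<^sub>m B\<^sub>p B\<^sub>m T p\<^sub>p p\<^sub>m :: real
  assumes "\<alpha> \<in> {0<..<2}" and "\<beta>\<^sub>p \<in> {0<..<1}" and "\<beta>\<^sub>m \<in> {0<..<1}"
    and "B\<^sub>p > 0" and "B\<^sub>m > 0"
    and "\<alpha> > 1 - min \<beta>\<^sub>p \<beta>\<^sub>m" and "\<beta>\<^sub>p \<noteq> \<beta>\<^sub>m"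
    and "symmetric_stable_process M F \<alpha> L"
    and "\<And>\<epsilon>. \<epsilon> > 0 \<Longrightarrow> strong_solution M L (drift B\<^sub>p B\<^sub>m \<beta>\<^sub>p \<beta>\<^sub>m) \<epsilon> (X \<epsilon>)"
    and "T > 0"
    and "p\<^sub>p = (if \<beta>\<^sub>p < \<beta>\<^sub>m then 1 else 0)" and "p\<^sub>m = 1 - p\<^sub>p"
  shows "weakly_converges (skorokhod_topology T) (\<lambda>\<epsilon>. path_law M T (X \<epsilon>))
    (add_measure
      (scale_measure (ennreal p\<^sub>p)
        (return (borel_algebra (skorokhod_topology T)) (\<lambda>t\<in>{0..T}. extremal_path B\<^sub>p \<beta>\<^sub>p t)))
      (scale_measure (ennreal p\<^sub>m)
        (return (borel_algebra (skorokhod_topology T)) (\<lambda>t\<in>{0..T}. - extremal_path B\<^sub>m \<beta>\<^sub>m t))))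
    (at_right 0)"
proof -
  obtain \<sigma> where noise: "stable_noise M F L \<alpha> \<sigma>"
    using symmetric_stable_process_stable_noise[OF assms(8)] assms(1) by auto
  interpret stable_noise M F L \<alpha> \<sigma> by (rule noise)
  have meas: "X \<epsilon> t \<in> borel_measurable M" if "0 < \<epsilon>" "0 \<le> t" for \<epsilon> t
    by (rule strong_solution_measurable[OF assms(9)[OF that(1)] measurable_L that(2)])
  have cad: "cadlag_on {0..} (\<lambda>t. X \<epsilon> t \<omega>)" if "0 < \<epsilon>" "\<omega> \<in> space M" for \<epsilon> \<omega>
    using assms(9)[OF that(1)] that(2) by (simp add: strong_solution_def)
  have eq: "AE \<omega> in M. \<forall>t\<ge>0. X \<epsilon> t \<omega> =
      (LINT s:{0..t}|lborel. drift B\<^sub>p B\<^sub>m \<beta>\<^sub>p \<beta>\<^sub>m (X \<epsilon> s \<omega>)) + \<epsilon> * L t \<omega>" if "0 < \<epsilon>" for \<epsilon>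
    using assms(9)[OF that] by (simp add: strong_solution_def)
  have extremal: "continuous_on {0..} (extremal_path B \<beta>)" if "\<beta> \<in> {0<..<1}" for B \<beta>
    using that by (intro continuous_on_extremal_path) auto
  show ?thesis
  proof (cases "\<beta>\<^sub>p < \<beta>\<^sub>m")
    case True
    have "weakly_converges (skorokhod_topology T) (\<lambda>\<epsilon>. path_law M T (X \<epsilon>))
      (return (borel_algebra (skorokhod_topology T)) (restrict (extremal_path B\<^sub>p \<beta>\<^sub>p) {0..T})) (at_right 0)"
    proof (rule weakly_converges_return[OF prob_space_axioms assms(10) meas cad])
      show "restrict (extremal_path B\<^sub>p \<beta>\<^sub>p) {0..T} \<in> skorokhod_space T"
        by (rule restrict_in_skorokhod_space[OF cadlag_on_continuous[OF extremal[OF assms(2)]]]) simp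
      fix \<delta> \<eta> :: real assume "0 < \<delta>" "0 < \<eta>"
      then show "\<forall>\<^sub>F \<epsilon> in at_right 0. likely M \<eta> (\<lambda>\<omega>. \<forall>t\<in>{0..T}. \<bar>X \<epsilon> t \<omega> - extremal_path B\<^sub>p \<beta>\<^sub>p t\<bar> \<le> \<delta>)"
        using assms True by (intro selection_in_probability[OF noise _ _ _ _ True _ cad eq]) auto
    qed auto
    moreover have "p\<^sub>p = 1" "p\<^sub>m = 0" using True assms(11,12) by simp_all
    ultimately show ?thesis
      by (simp only: ennreal_1 ennreal_0 add_measure_scale_1_0(1) sets_return)
  next
    case False
    then have less: "\<beta>\<^sub>m < \<beta>\<^sub>p" using assms(7) by simp
    (* Reflection in 0 exchanges the two sides of the drift and preserves the noise. *)
    have noise': "stable_noise M F (\<lambda>t \<omega>. - L t \<omega>) \<alpha> \<sigma>"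
      using stable_noise_rescale[OF noise, of 1 "-1"] by simp
    have cad': "cadlag_on {0..} (\<lambda>t. - X \<epsilon> t \<omega>)" if "0 < \<epsilon>" "\<omega> \<in> space M" for \<epsilon> \<omega>
      by (rule cadlag_on_minus[OF cad[OF that]])
    have eq': "AE \<omega> in M. \<forall>t\<ge>0. - X \<epsilon> t \<omega> =
        (LINT s:{0..t}|lborel. drift B\<^sub>m B\<^sub>p \<beta>\<^sub>m \<beta>\<^sub>p (- X \<epsilon> s \<omega>)) + \<epsilon> * - L t \<omega>" if "0 < \<epsilon>" for \<epsilon>
      using eq[OF that]
    proof eventually_elim
      case (elim \<omega>)
      show ?case
      proof (intro allI impI)
        fix t :: real assume "0 \<le> t"
        with elim have "X \<epsilon> t \<omega> = (LINT s:{0..t}|lborel. drift B\<^sub>p B\<^sub>m \<beta>\<^sub>p \<beta>\<^sub>m (X \<epsilon> s \<omega>)) + \<epsilon> * L t \<omega>" by blast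
        then show "- X \<epsilon> t \<omega> = (LINT s:{0..t}|lborel. drift B\<^sub>m B\<^sub>p \<beta>\<^sub>m \<beta>\<^sub>p (- X \<epsilon> s \<omega>)) + \<epsilon> * - L t \<omega>"
          by (simp add: drift_minus set_lebesgue_integral_def)
      qed
    qed
    have "weakly_converges (skorokhod_topology T) (\<lambda>\<epsilon>. path_law M T (X \<epsilon>))
      (return (borel_algebra (skorokhod_topology T)) (\<lambda>t\<in>{0..T}. - extremal_path B\<^sub>m \<beta>\<^sub>m t)) (at_right 0)"
    proof (rule weakly_converges_return[OF prob_space_axioms assms(10) meas cad])
      show "(\<lambda>t\<in>{0..T}. - extremal_path B\<^sub>m \<beta>\<^sub>m t) \<in> skorokhod_space T"
        by (rule restrict_in_skorokhod_space[OF cadlag_on_continuous[OF continuous_on_minus[OF extremal[OF assms(3)]]]]) simp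
      fix \<delta> \<eta> :: real assume "0 < \<delta>" "0 < \<eta>"
      then have "\<forall>\<^sub>F \<epsilon> in at_right 0. likely M \<eta> (\<lambda>\<omega>. \<forall>t\<in>{0..T}. \<bar>- X \<epsilon> t \<omega> - extremal_path B\<^sub>m \<beta>\<^sub>m t\<bar> \<le> \<delta>)"
        using assms less by (intro selection_in_probability[OF noise' _ _ _ _ less _ cad' eq']) auto
      moreover have "\<bar>- X \<epsilon> t \<omega> - extremal_path B\<^sub>m \<beta>\<^sub>m t\<bar> = \<bar>X \<epsilon> t \<omega> - - extremal_path B\<^sub>m \<beta>\<^sub>m t\<bar>" for \<epsilon> t \<omega>
        by linarith
      ultimately show "\<forall>\<^sub>F \<epsilon> in at_right 0. likely M \<eta> (\<lambda>\<omega>. \<forall>t\<in>{0..T}. \<bar>X \<epsilon> t \<omega> - - extremal_path B\<^sub>m \<beta>\<^sub>m t\<bar> \<le> \<delta>)"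
        by simp
    qed auto
    moreover have "p\<^sub>p = 0" "p\<^sub>m = 1" using False assms(11,12) by simp_all
    ultimately show ?thesis
      by (simp only: ennreal_1 ennreal_0 add_measure_scale_1_0(2) sets_return)
  qed
qed

end
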